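(* Let $\mathbf{k}$ be a commutative ring, and let $r\ge0$. Then $\delta\in\mathbf{k}$ is non-singular at ranks $\preceq r$ if and only if for every $m\in X_r$, $\delta-i(m)\in\mathbf{k}$ is invertible, where $i:\mathbb{Z}\to\mathbf{k}$ is the unique ring homomorphism and $$X_r=X_r^0\cup\{i,-2i\mid 1\le i\le r-2,\ i\in\mathbb{Z}\}\cup\{j\in\mathbb{Z}\mid 4-r\le j\le-1\}\subset\mathbb{Z},$$ with $X_r^0=\{0\}$ if $r\ne0,1,3,5$ and $X_r^0=\emptyset$ if $r\in\{0,1,3,5\}$.
   Context: For $p,q\ge0$, a $(p,q)$-Brauer diagram is a partition of $[p]^+\sqcup[q]^-=\{1^+,\dots,p^+\}\sqcup\{1^-,\dots,q^-\}$ into unordered pairs ($i^+$ top points, $i^-$ bottom points). Upward: no pair of two top points; level: every pair consists of one top and one bottom point; monotone: $(i-k)(j-l)>0$ for any two distinct pairs $\{i^+,j^-\},\{k^+,l^-\}$. $\mathbb{B}^{+,m}(p,q)$ is the set of upward monotone $(p,q)$-Brauer diagrams. $\overline f$ is $f$ with $i^\pm\leftrightarrow i^\mp$ exchanged. Level $(p,p)$-diagrams are identified with $\mathfrak{S}_p$ via $\sigma\mapsto\{\{i^+,\sigma(i)^-\}\}_i$. $p\preceq q$ iff $p\le q$ and $q-p$ even. For $p\preceq q$ and $f,g\in\mathbb{B}^{+,m}(p,q)$, place $g$ above $\overline f$ and identify the bottom points of $g$ with the top points of $\overline f$; let $l$ be the number of closed loops and $\overline f\hat\circ g$ the resulting $(p,p)$-diagram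 with loops deleted. Put $a_{f,g}=x^{l}\,(\overline f\hat\circ g)\in\mathbb{Z}[x][\mathfrak{S}_p]$ if $\overline f\hat\circ g$ is level, and $a_{f,g}=0$ otherwise. Let $A_{p,q}=(a_{f,g})_{f,g\in\mathbb{B}^{+,m}(p,q)}\in M_n(\mathbb{Z}[x][\mathfrak{S}_p])$, $n=|\mathbb{B}^{+,m}(p,q)|$; let $\iota:M_n(\mathbb{Z}[x][\mathfrak{S}_p])\hookrightarrow M_{n\,p!}(\mathbb{Z}[x])$ be the ring homomorphism induced by the left regular representation of $\mathfrak{S}_p$, and $f_{p,q}(x)=\det\iota(A_{p,q})\in\mathbb{Z}[x]$. $\delta\in\mathbf{k}$ is non-singular at rank $(p,q)$ if $f_{p,q}(\delta)$ is invertible in $\mathbf{k}$; it is non-singular at ranks $\preceq r$ if it is non-singular at rank $(p,q)$ for all $p\preceq q\preceq r$. *)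

theory Defs
  imports
    "HOL-Algebra.Sym_Groups"
    "HOL-Library.Disjoint_Sets"
    "HOL-Library.Countable_Set"
    "HOL-Computational_Algebra.Polynomial"
    "Jordan_Normal_Form.Determinant"
begin

section \<open>Brauer diagrams\<close>

datatype point = Top nat | Bot nat

type_synonym diagram = "point set set"

definition points :: "nat \<Rightarrow> nat \<Rightarrow> point set" where
  "points p q = Top ` {1..p} \<union> Bot ` {1..q}"

definition brauer_diagram :: "nat \<Rightarrow> nat \<Rightarrow> diagram \<Rightarrow> bool" where
  "brauer_diagram p q d \<longleftrightarrow> partition_on (points p q) d \<and> (\<forall>e\<in>d. card e = 2)"

definition upward :: "diagram \<Rightarrow> bool" where
  "upward d \<longleftrightarrow> \<not> (\<exists>i k. {Top i, Top k} \<in> d)"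

definition level :: "diagram \<Rightarrow> bool" where
  "level d \<longleftrightarrow> (\<forall>e\<in>d. \<exists>i j. e = {Top i, Bot j})"

definition monotone_diagram :: "diagram \<Rightarrow> bool" where
  "monotone_diagram d \<longleftrightarrow>
     (\<forall>i j k l. {Top i, Bot j} \<in> d \<longrightarrow> {Top k, Bot l} \<in> d \<longrightarrow>
        {Top i, Bot j} \<noteq> {Top k, Bot l} \<longrightarrow> (int i - int k) * (int j - int l) > 0)"

definition upward_monotone :: "nat \<Rightarrow> nat \<Rightarrow> diagram set" where
  "upward_monotone p q = {d. brauer_diagram p q d \<and> upward d \<and> monotone_diagram d}"

fun flip_point :: "point \<Rightarrow> point" where
  "flip_point (Top i) = Bot i"
| "flip_point (Bot i) = Top i"

definition flip :: "diagram \<Rightarrow> diagram" where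
  "flip d = (`) flip_point ` d"

definition diagram_of_perm :: "nat \<Rightarrow> (nat \<Rightarrow> nat) \<Rightarrow> diagram" where
  "diagram_of_perm p \<sigma> = (\<lambda>i. {Top i, Bot (\<sigma> i)}) ` {1..p}"

definition perm_of_diagram :: "nat \<Rightarrow> diagram \<Rightarrow> (nat \<Rightarrow> nat)" where
  "perm_of_diagram p d = (THE \<sigma>. \<sigma> \<in> carrier (sym_group p) \<and> diagram_of_perm p \<sigma> = d)"

section \<open>Stacking diagrams\<close>

datatype stacked_point = Upper nat | Middle nat | Lower nat

fun in_upper :: "point \<Rightarrow> stacked_point" where
  "in_upper (Top i) = Upper i"
| "in_upper (Bot i) = Middle i"

fun in_lower :: "point \<Rightarrow> stacked_point" where
  "in_lower (Top i) = Middle i"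
| "in_lower (Bot i) = Lower i"

text \<open>
  The graph obtained by placing \<open>g\<close> above \<open>h\<close>. An edge occurring in both \<open>g\<close> and \<open>h\<close> (a loop
  through two middle points) is listed only once, which does not change the connected components.
\<close>

definition stacked_edges :: "diagram \<Rightarrow> diagram \<Rightarrow> stacked_point set set" where
  "stacked_edges h g = (`) in_upper ` g \<union> (`) in_lower ` h"

definition components :: "'a set set \<Rightarrow> 'a set set" where
  "components E = \<Union>E // {(u, v). \<exists>e\<in>E. u \<in> e \<and> v \<in> e}\<^sup>*"

text \<open>
  Every component of the stacked graph is either a closed loop, all of whose vertices are middle
  points, or a path joining two outer points.
\<close>

definition closed_loops :: "diagram \<Rightarrow> diagram \<Rightarrow> stacked_point set set" where
  "closed_loops h g = {C \<in> components (stacked_edges h g). C \<subseteq> range Middle}"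

definition compose_diagram :: "diagram \<Rightarrow> diagram \<Rightarrow> diagram" where
  "compose_diagram h g =
     (\<lambda>C. {Top i |i. Upper i \<in> C} \<union> {Bot i |i. Lower i \<in> C}) `
       (components (stacked_edges h g) - closed_loops h g)"

section \<open>Group rings over the integer polynomials\<close>

text \<open>
  For a finite group \<open>G\<close>, an element of \<open>\<int>[x][G]\<close> is represented by its coefficient function,
  which vanishes outside \<open>carrier G\<close>.
\<close>

definition gr_single :: "int poly \<Rightarrow> 'g \<Rightarrow> ('g \<Rightarrow> int poly)" where
  "gr_single c s = (\<lambda>t. if t = s then c else 0)"

definition gr_mult :: "('g, 'm) monoid_scheme \<Rightarrow> ('g \<Rightarrow> int poly) \<Rightarrow> ('g \<Rightarrow> int poly) \<Rightarrow> ('g \<Rightarrow> int poly)" where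
  "gr_mult G a b = (\<lambda>s. \<Sum>(t, u) \<in> {(t, u). t \<in> carrier G \<and> u \<in> carrier G \<and> t \<otimes>\<^bsub>G\<^esub> u = s}. a t * b u)"

text \<open>The matrix of \<open>b \<mapsto> a b\<close> in the basis \<open>G\<close>: column \<open>t\<close> holds the coefficients of \<open>a t\<close>.\<close>

definition left_regular :: "('g, 'm) monoid_scheme \<Rightarrow> ('g \<Rightarrow> int poly) \<Rightarrow> 'g \<Rightarrow> 'g \<Rightarrow> int poly" where
  "left_regular G a s t = gr_mult G a (gr_single 1 t) s"

text \<open>
  The map \<open>\<iota>\<close>: replace every entry of a matrix over \<open>\<int>[x][G]\<close> by its block under the left regular
  representation. Rows and columns of the result are indexed by pairs.
\<close>

definition iota :: "('g, 'm) monoid_scheme \<Rightarrow> ('i \<Rightarrow> 'i \<Rightarrow> 'g \<Rightarrow> int poly) \<Rightarrow> 'i \<times> 'g \<Rightarrow> 'i \<times> 'g \<Rightarrow> int poly" where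
  "iota G A = (\<lambda>(f, s) (g, t). left_regular G (A f g) s t)"

text \<open>
  Determinant of a square matrix indexed by a finite set. The same enumeration of the index set is
  used for rows and columns, so the value does not depend on it.
\<close>

definition det_on :: "'i set \<Rightarrow> ('i \<Rightarrow> 'i \<Rightarrow> 'a :: comm_ring_1) \<Rightarrow> 'a" where
  "det_on S M = det (mat (card S) (card S) (\<lambda>(i, j). M (from_nat_into S i) (from_nat_into S j)))"

section \<open>The polynomials \<open>f\<^sub>p\<^sub>,\<^sub>q\<close> and non-singular parameters\<close>

definition gram_entry :: "nat \<Rightarrow> diagram \<Rightarrow> diagram \<Rightarrow> (nat \<Rightarrow> nat) \<Rightarrow> int poly" where
  "gram_entry p f g =
     (if level (compose_diagram (flip f) g)
      then gr_single (Polynomial.monom 1 (card (closed_loops (flip f) g)))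
             (perm_of_diagram p (compose_diagram (flip f) g))
      else (\<lambda>_. 0))"

definition f_poly :: "nat \<Rightarrow> nat \<Rightarrow> int poly" where
  "f_poly p q =
     det_on (upward_monotone p q \<times> carrier (sym_group p)) (iota (sym_group p) (gram_entry p))"

definition preceq :: "nat \<Rightarrow> nat \<Rightarrow> bool" (infix "\<preceq>" 50) where
  "p \<preceq> q \<longleftrightarrow> p \<le> q \<and> even (q - p)"

definition of_int_ring :: "('a, 'm) ring_scheme \<Rightarrow> int \<Rightarrow> 'a" where
  "of_int_ring k m = [m] \<cdot>\<^bsub>k\<^esub> \<one>\<^bsub>k\<^esub>"

definition eval_int_poly :: "('a, 'm) ring_scheme \<Rightarrow> int poly \<Rightarrow> 'a \<Rightarrow> 'a" where
  "eval_int_poly k f \<delta> =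
     (\<Oplus>\<^bsub>k\<^esub> i \<in> {..Polynomial.degree f}. of_int_ring k (Polynomial.coeff f i) \<otimes>\<^bsub>k\<^esub> (\<delta> [^]\<^bsub>k\<^esub> i))"

definition nonsingular_at :: "('a, 'm) ring_scheme \<Rightarrow> 'a \<Rightarrow> nat \<Rightarrow> nat \<Rightarrow> bool" where
  "nonsingular_at k \<delta> p q \<longleftrightarrow> eval_int_poly k (f_poly p q) \<delta> \<in> Units k"

definition nonsingular_upto :: "('a, 'm) ring_scheme \<Rightarrow> 'a \<Rightarrow> nat \<Rightarrow> bool" where
  "nonsingular_upto k \<delta> r \<longleftrightarrow> (\<forall>p q. p \<preceq> q \<longrightarrow> q \<preceq> r \<longrightarrow> nonsingular_at k \<delta> p q)"

definition X0 :: "nat \<Rightarrow> int set" where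
  "X0 r = (if r \<in> {0, 1, 3, 5} then {} else {0})"

definition X :: "nat \<Rightarrow> int set" where
  "X r = X0 r \<union> {i. 1 \<le> i \<and> i \<le> int r - 2} \<union> {- 2 * i |i. 1 \<le> i \<and> i \<le> int r - 2}
           \<union> {j. 4 - int r \<le> j \<and> j \<le> - 1}"

end

theory Submission
  imports
    Defs
    "HOL-Combinatorics.Permutations"
    "HOL-Computational_Algebra.Fundamental_Theorem_Algebra"
begin

text \<open>
  Reordering the tops identifies \<open>\<iota>(A\<^sub>p\<^sub>,\<^sub>q)\<close> with a matrix indexed by all upward diagrams. Its diagonal
  consists of powers of \<open>x\<close> and the other entries of lower powers, so \<open>f\<^sub>p\<^sub>,\<^sub>q\<close> is monic, and it suffices
  to find its complex roots: if they are integers, then \<open>f\<^sub>p\<^sub>,\<^sub>q\<close> is a product of factors \<open>x - a\<close>.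

  A complex number \<open>\<delta>\<close> is a root of \<open>f\<^sub>p\<^sub>,\<^sub>q\<close> iff the Gram matrix has a kernel at \<open>\<delta>\<close>. Applying caps to a
  kernel vector leads to a combination of upward \<open>(p, q')\<close>-diagrams, \<open>p < q' \<le> q\<close>, that is killed by
  all caps (a harmonic vector); conversely harmonic vectors lie in the kernel. Turning bottom points
  into tops preserves harmonicity, so one can reduce to diagrams with a single cup. There harmonicity
  says that \<open>1 - \<delta>\<close> is an eigenvalue of the sum of the last two Jucys-Murphy elements of \<open>S\<^sub>n\<close> on
  vectors fixed by the last simple transposition, where \<open>n \<le> r\<close>, and the Okounkov-Vershik description
  of their joint spectrum places \<open>\<delta>\<close> in \<open>X r\<close>. Reducing to a single cup may change the parity of \<open>n\<close>,
  which matters only for \<open>\<delta> = 0\<close> and \<open>(p, q) = (1, 5)\<close>; that case is settled by hand.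

  For the converse, the elements of \<open>X r\<close> are realised by the harmonic vectors that come from the second
  fundamental theorem of invariant theory: antisymmetrisers for \<open>\<delta> > 0\<close>, sums over all matchings
  for \<open>\<delta>\<close> even and not positive, and powers of Gram determinants for the other negative \<open>\<delta>\<close> and
  for \<open>\<delta> = 0\<close> with \<open>r\<close> odd.
\<close>

section \<open>Content sequences\<close>

text \<open>Multiplicities of roots are irrelevant: in a commutative ring a product of factors
  \<open>\<delta> - a\<close> is invertible iff every factor is, so the set of integer roots decides
  invertibility over every \<open>k\<close>. The main obstacle is that on vectors fixed by the last
  simple transposition \<open>s\<close> only symmetric functions of the last two Jucys-Murphy
  elements act, so no common eigenvector need exist there. Either a vector splits into two, with
  content sequences ending in \<open>x, y\<close> and in \<open>y, x\<close>, or its sequence ends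
  in \<open>x, x + 1\<close>: two boxes removable in either order, or a horizontal domino. Young
  diagrams are not formalised; all bounds on contents follow from the four properties in
  \<open>content_set\<close>, which the joint spectrum satisfies. Bending turns
  \<open>p + 2 * Suc l\<close> bottom points into \<open>n = p + l + 2\<close>. The admissible
  ranges grow with \<open>n\<close> except at 0: \<open>n = 4\<close> admits 0 while
  \<open>r = 5\<close> forbids it, whence the exceptional pair (1, 5).\<close>

locale content_set =
  fixes n :: nat and C :: "(nat \<Rightarrow> 'a :: {ring_char_0, comm_ring_1}) set"
  assumes zero: "c \<in> C \<Longrightarrow> 0 < n \<Longrightarrow> c 0 = 0"
    and neighbours: "c \<in> C \<Longrightarrow> Suc i < n \<Longrightarrow> c i \<noteq> c (Suc i)"
    and swap: "c \<in> C \<Longrightarrow> Suc i < n \<Longrightarrow> c (Suc i) \<noteq> c i + 1 \<Longrightarrow> c (Suc i) \<noteq> c i - 1 \<Longrightarrow>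
      c \<circ> transpose i (Suc i) \<in> C"
    and braid: "c \<in> C \<Longrightarrow> Suc (Suc i) < n \<Longrightarrow> c (Suc (Suc i)) = c i \<Longrightarrow>
      c (Suc i) \<noteq> c i + 1 \<and> c (Suc i) \<noteq> c i - 1"
begin

text \<open>Unless the entry just before is adjacent in value, a swap moves the entry one place to
  the left and leaves everything further left unchanged, so induction on the position
  applies.\<close>

lemma predecessor:
  "c \<in> C \<Longrightarrow> q < n \<Longrightarrow> c q \<noteq> 0 \<Longrightarrow> \<exists>p<q. c p = c q - 1 \<or> c p = c q + 1"
proof (induction q arbitrary: c)
  case 0
  then show ?case using zero by auto
next
  case (Suc q)
  show ?case
  proof (cases "c (Suc q) = c q + 1 \<or> c (Suc q) = c q - 1")
    case True
    then show ?thesis by (intro exI[of _ q]) auto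
  next
    case False
    then have "c \<circ> transpose q (Suc q) \<in> C" using Suc.prems swap by blast
    from Suc.IH[OF this] Suc.prems obtain p where p: "p < q"
      "(c \<circ> transpose q (Suc q)) p = c (Suc q) - 1 \<or> (c \<circ> transpose q (Suc q)) p = c (Suc q) + 1"
      by auto
    then have "(c \<circ> transpose q (Suc q)) p = c p" by (simp add: transpose_def)
    with p show ?thesis by (intro exI[of _ p]) auto
  qed
qed

text \<open>Negation is the transposition of Young diagrams. It turns statements about
  \<open>c + 1\<close> into statements about \<open>c - 1\<close> and upper bounds into lower
  ones.\<close>

lemma negated: "content_set n ((\<lambda>c i. - c i) ` C)"
proof
  show "c 0 = 0" if "c \<in> (\<lambda>c i. - c i) ` C" "0 < n" for c
    using that zero by auto
  show "c i \<noteq> c (Suc i)" if "c \<in> (\<lambda>c i. - c i) ` C" "Suc i < n" for c i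
    using that neighbours by auto
  show "c \<circ> transpose i (Suc i) \<in> (\<lambda>c i. - c i) ` C"
    if c: "c \<in> (\<lambda>c i. - c i) ` C" "Suc i < n" "c (Suc i) \<noteq> c i + 1" "c (Suc i) \<noteq> c i - 1" for c i
  proof -
    obtain b where b: "b \<in> C" "c = (\<lambda>i. - b i)" using c by auto
    have "b (Suc i) \<noteq> b i + 1" "b (Suc i) \<noteq> b i - 1" using c(3,4) b(2) by auto
    then have "b \<circ> transpose i (Suc i) \<in> C" using swap b c by auto
    then show ?thesis using b by (auto simp: image_iff intro!: bexI[of _ "b \<circ> transpose i (Suc i)"])
  qed
  show "c (Suc i) \<noteq> c i + 1 \<and> c (Suc i) \<noteq> c i - 1"
    if c: "c \<in> (\<lambda>c i. - c i) ` C" "Suc (Suc i) < n" "c (Suc (Suc i)) = c i" for c i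
  proof -
    obtain b where b: "b \<in> C" "c = (\<lambda>i. - b i)" using c by auto
    have "b (Suc i) \<noteq> b i + 1 \<and> b (Suc i) \<noteq> b i - 1" using braid b c by auto
    then show ?thesis
      using b(2) by (metis (no_types, lifting) add.inverse_inverse minus_add_distrib minus_diff_eq uminus_add_conv_diff diff_minus_eq_add)
  qed
qed

text \<open>In a minimal counterexample both inner neighbours of \<open>p\<close> and
  \<open>q\<close> must have content \<open>c p - 1\<close>, since otherwise a swap shortens the
  gap. If they are the same entry, \<open>braid\<close> is violated; if not, they form a shorter
  instance, which puts the content \<open>c p\<close> strictly between \<open>p\<close> and
  \<open>q\<close>.\<close>

lemma between_plus:
  "c \<in> C \<Longrightarrow> p < q \<Longrightarrow> q < n \<Longrightarrow> c p = c q \<Longrightarrow> \<exists>m. p < m \<and> m < q \<and> c m = c p + 1"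
proof (induction "q - p" arbitrary: c p q rule: less_induct)
  case less
  show ?case
  proof (rule ccontr)
    assume no: "\<not> ?thesis"
    \<comment> \<open>A third equal content in between would give a shorter instance, whose witness
      also lies between \<open>p\<close> and \<open>q\<close>.\<close>
    have none: False if "p < m" "m < q" "c m = c p" for m
      using less.hyps[of m p c] less.prems that no by (force simp: less_diff_iff)
    have "Suc p \<noteq> q" using neighbours[of c p] less.prems by auto
    then obtain r where r: "q = Suc r" "p < r" using less.prems(2) by (cases q) auto
    have 1: "c r = c p - 1"
    proof (rule ccontr)
      assume "c r \<noteq> c p - 1"
      then have ne: "c (Suc r) \<noteq> c r + 1" using less.prems(4) r by auto
      moreover have "c r \<noteq> c p + 1" using no r by auto
      then have "c (Suc r) \<noteq> c r - 1" using less.prems(4) r by auto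
      ultimately have "c \<circ> transpose r (Suc r) \<in> C" using swap less.prems r by blast
      from less.hyps[OF _ this, of r p] r less.prems
      have "\<exists>m>p. m < r \<and> (c \<circ> transpose r (Suc r)) m = (c \<circ> transpose r (Suc r)) p + 1"
        by (simp add: transpose_def)
      then obtain m where m: "p < m" "m < r" "c m = c p + 1"
        using r by (auto simp: transpose_def split: if_splits)
      then show False using no r by auto
    qed
    have 2: "c (Suc p) = c p - 1"
    proof (rule ccontr)
      assume "c (Suc p) \<noteq> c p - 1"
      moreover have "c (Suc p) \<noteq> c p + 1" using no r by auto
      ultimately have "c \<circ> transpose p (Suc p) \<in> C" using swap less.prems r by auto
      from less.hyps[OF _ this, of q "Suc p"] r less.prems
      have "\<exists>m>Suc p. m < q \<and> (c \<circ> transpose p (Suc p)) m = (c \<circ> transpose p (Suc p)) (Suc p) + 1"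
        by (simp add: transpose_def)
      then obtain m where m: "Suc p < m" "m < q" "c m = c p + 1"
        using r by (auto simp: transpose_def split: if_splits)
      then show False using no r by auto
    qed
    show False
    proof (cases "r = Suc p")
      case True
      then show False using braid[of c p] less.prems r 1 by auto
    next
      case False
      moreover have "r - Suc p < q - p" using r by simp
      ultimately obtain m where "Suc p < m" "m < r" "c m = c (Suc p) + 1"
        using less.hyps[of r "Suc p" c] less.prems r 1 2 by auto
      then show False using none[of m] 2 r by auto
    qed
  qed
qed

end

lemma (in content_set) between_minus:
  assumes "c \<in> C" "p < q" "q < n" "c p = c q"
  shows "\<exists>m. p < m \<and> m < q \<and> c m = c p - 1"
proof -
  interpret neg: content_set n "(\<lambda>c i. - c i) ` C" by (rule negated)
  from neg.between_plus[of "\<lambda>i. - c i" p q] assms obtain m where "p < m" "m < q" "- c m = - c p + 1" by auto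
  then show ?thesis by (intro exI[of _ m]) (auto simp: algebra_simps minus_equation_iff)
qed

text \<open>A nonzero content differs by 1 from an earlier one, so everything is reached from 0 by
  unit steps.\<close>

lemma (in content_set) content_int:
  "c \<in> C \<Longrightarrow> q < n \<Longrightarrow> c q \<in> \<int>"
proof (induction q rule: less_induct)
  case (less q)
  show ?case
  proof (cases "c q = 0")
    case False
    then obtain p where p: "p < q" "c p = c q - 1 \<or> c p = c q + 1" using predecessor less.prems by blast
    then have "c p \<in> \<int>" using less by auto
    then have "c p + 1 \<in> \<int>" "c p - 1 \<in> \<int>" by auto
    with p show ?thesis by auto
  qed auto
qed

section \<open>How many entries a large integer content forces\<close>

locale int_content_set = content_set n C for n and C :: "(nat \<Rightarrow> int) set"
begin

text \<open>The first entry \<open>r\<close> that reaches the value \<open>c q\<close> has a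
  neighbouring value before it, and that value is still below \<open>c q\<close>; over the integers
  it can only be \<open>c q - 1\<close>.\<close>

lemma smaller_earlier_step:
  assumes "c \<in> C" "q < n" "c q > 0"
  shows "\<exists>p<q. c p = c q - 1"
proof -
  define r where "r = (LEAST i. c i \<ge> c q)"
  have r: "c r \<ge> c q" "r \<le> q" "\<And>i. i < r \<Longrightarrow> c i < c q"
    unfolding r_def by (rule LeastI[of _ q], simp, rule Least_le, simp) (use not_less_Least in force)
  obtain p where p: "p < r" "c p = c r - 1 \<or> c p = c r + 1"
    using predecessor[of c r] assms r by auto
  with r(3)[of p] r(1) have "c p = c q - 1" by auto
  then show ?thesis using p(1) r(2) by (metis order_less_le_trans)
qed

lemma smaller_earlier:
  assumes "c \<in> C" "q < n" "0 \<le> z" "z < c q"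
  shows "\<exists>p<q. c p = z"
  using assms(2,4)
proof (induction q rule: less_induct)
  case (less q)
  from smaller_earlier_step[OF assms(1) less.prems(1)] less.prems assms(3)
  obtain p where p: "p < q" "c p = c q - 1" by auto
  show ?case
  proof (cases "z = c p")
    case False
    then obtain i where "i < p" "c i = z" using less.IH[of p] p less.prems by auto
    then show ?thesis using p(1) less_trans by blast
  qed (use p in auto)
qed

text \<open>In terms of Young diagrams: the second box of content \<open>y \<ge> 0\<close> lies in the second row and has
  \<open>y + 1\<close> boxes to its left, of contents \<open>-1, \<dots>, y - 1\<close>.\<close>

lemma repeated_smaller:
  assumes "c \<in> C" "p < q" "q < n" "c p = c q" "0 \<le> z" "z < c q"
  shows "\<exists>i j. i < j \<and> j < q \<and> c i = z \<and> c j = z"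
  using assms(2-4,6)
proof (induction "nat (c q)" arbitrary: p q rule: less_induct)
  case less
  obtain j where j: "p < j" "j < q" "c j = c p - 1" using between_minus[OF assms(1)] less.prems by blast
  obtain i where i: "i < p" "c i = c p - 1" using smaller_earlier_step[OF assms(1), of p] less.prems assms(5) by auto
  show ?case
  proof (cases "z = c j")
    case True
    then show ?thesis using i j by (intro exI[of _ i] exI[of _ j]) auto
  next
    case False
    then obtain i' j' where "i' < j'" "j' < j" "c i' = z" "c j' = z"
      using less.hyps[of j i] less.prems i j assms(5) by auto
    moreover from this(2) j(2) have "j' < q" by simp
    ultimately show ?thesis by blast
  qed
qed

text \<open>A repeated nonnegative content leads down to a repeated 0, and -1 has to stand between
  two zeros.\<close>

lemma repeated_minus_one:
  assumes "c \<in> C" "p < q" "q < n" "c p = c q" "0 \<le> c q"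
  shows "\<exists>i<q. c i = - 1"
proof -
  obtain p' q' where q': "p' < q'" "q' \<le> q" "c p' = 0" "c q' = 0"
  proof (cases "c q = 0")
    case True
    then show ?thesis using that[of p q] assms by auto
  next
    case False
    then obtain i j where "i < j" "j < q" "c i = 0" "c j = 0"
      using repeated_smaller[OF assms(1-4), of 0] assms(5) by auto
    then show ?thesis using that[of i j] by simp
  qed
  then show ?thesis using between_minus[OF assms(1), of p' q'] assms(3) by force
qed

text \<open>Entries before \<open>q\<close> are counted by content: -1 occurs at least once, each of
  \<open>0, ..., c q - 1\<close> at least twice and each of \<open>c q, ..., x - 1\<close> at least
  once, which makes \<open>1 + 2 * c q + (x - c q)\<close> entries.\<close>

lemma repeated_bound:
  assumes c: "c \<in> C" "p < q" "q < n" "c p = c q" "0 \<le> c q"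
    and x: "c q \<le> x" "\<And>z. c q \<le> z \<Longrightarrow> z < x \<Longrightarrow> \<exists>i<q. c i = z"
  shows "x + c q + 1 \<le> int q"
proof -
  let ?N = "\<lambda>z. {i. i < q \<and> c i = z}"
  have one: "1 \<le> card (?N z)" if "\<exists>i<q. c i = z" for z
    using that by (auto simp: Suc_le_eq card_gt_0_iff)
  have two: "2 \<le> card (?N z)" if z: "0 \<le> z" "z < c q" for z
  proof -
    obtain i j where ij: "i < j" "j < q" "c i = z" "c j = z"
      using repeated_smaller[OF c(1-4) z] by auto
    then have "card {i, j} \<le> card (?N z)" by (intro card_mono) auto
    then show ?thesis using ij by simp
  qed
  have "x + c q + 1 = 1 + (\<Sum>z\<in>{0..<c q}. 2) + (\<Sum>z\<in>{c q..<x}. (1::int))"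
    using c(5) x(1) by simp
  also have "\<dots> \<le> int (card (?N (-1))) + (\<Sum>z\<in>{0..<c q}. int (card (?N z))) + (\<Sum>z\<in>{c q..<x}. int (card (?N z)))"
    using one[OF repeated_minus_one[OF c]] two one x(2)
    by (intro add_mono sum_mono) (force simp: Suc_le_eq)+
  also have "\<dots> = (\<Sum>z\<in>{-1..<x}. int (card (?N z)))"
  proof -
    have eq: "{-1..<x} = {-1} \<union> ({0..<c q} \<union> {c q..<x})" using c(5) x(1) by auto
    have "{-1} \<inter> ({0..<c q} \<union> {c q..<x}) = {}" "{0..<c q} \<inter> {c q..<x} = {}" using c(5) by auto
    then show ?thesis unfolding eq by (simp only: sum.union_disjoint finite_Un finite.intros finite_atLeastLessThan_int) simp
  qed
  also have "\<dots> = int (card (\<Union>z\<in>{-1..<x}. ?N z))"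
    by (subst card_UN_disjoint) auto
  also have "\<dots> \<le> int (card {..<q})"
    by (intro iffD2[OF of_nat_le_iff] card_mono) auto
  finally show ?thesis by simp
qed

text \<open>This concerns two boxes of contents \<open>x > y\<close> that may be removed in either
  order. If \<open>x > 0 > y\<close>, the contents \<open>0, ..., x - 1\<close> alone occupy
  \<open>x\<close> of the first \<open>n - 2\<close> places. If \<open>y \<ge> 0\<close>, then
  \<open>y\<close> occurs early because it is below \<open>x\<close>, so in \<open>c'\<close> it is
  a repetition at place \<open>n - 2\<close>, preceded by all contents below \<open>x\<close>, and
  \<open>repeated_bound\<close> applies.\<close>

lemma two_ends_bound:
  assumes n: "2 \<le> n" and c: "c \<in> C" "c' \<in> C" "\<And>i. i < n - 2 \<Longrightarrow> c' i = c i"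
    "c' (n - 2) = c (n - 1)" "c (n - 1) < c (n - 2)"
  shows "c (n - 2) + c (n - 1) \<le> int n - 3"
proof (cases "c (n - 2) \<le> 0")
  case True
  have "n \<noteq> 2"
  proof
    assume "n = 2"
    then show False using zero[OF c(1)] zero[OF c(2)] c(4,5) by auto
  qed
  then show ?thesis using True c(5) n by auto
next
  case False
  let ?x = "c (n - 2)" and ?y = "c (n - 1)"
  have earlier: "\<exists>i<n-2. c i = z" if "0 \<le> z" "z < ?x" for z
    using smaller_earlier[OF c(1) _ that] n by auto
  show ?thesis
  proof (cases "?y < 0")
    case True
    have "{0..<?x} \<subseteq> c ` {..<n - 2}" using earlier by force
    from surj_card_le[OF _ this] have "card {0..<?x} \<le> n - 2" by simp
    then show ?thesis using True False n by auto
  next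
    case y: False
    obtain p where p: "p < n - 2" "c p = ?y" using earlier[of ?y] y c(5) by auto
    have "?x + c' (n - 2) + 1 \<le> int (n - 2)"
    proof (rule repeated_bound[OF c(2), of p])
      show "\<exists>i<n-2. c' i = z" if "c' (n-2) \<le> z" "z < ?x" for z
        using earlier[of z] that c(3,4) y by auto
    qed (use n p c y in auto)
    then show ?thesis using c(4) n by auto
  qed
qed

text \<open>The last two boxes form a vertical domino of contents \<open>x, x - 1\<close>. Reaching
  \<open>x \<ge> 1\<close> needs an earlier \<open>x - 1\<close>, so the final entry is a repetition
  that already has \<open>x\<close> before it: \<open>repeated_bound\<close> with upper end
  \<open>x + 1\<close>.\<close>

lemma descending_end_bound:
  assumes n: "2 \<le> n" and c: "c \<in> C" "c (n - 1) = c (n - 2) - 1" "1 \<le> c (n - 2)"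
  shows "2 * c (n - 2) \<le> int n - 2"
proof -
  obtain p where p: "p < n - 2" "c p = c (n - 1)" using smaller_earlier_step[OF c(1), of "n - 2"] c n by auto
  have "(c (n - 2) + 1) + c (n - 1) + 1 \<le> int (n - 1)"
  proof (rule repeated_bound[OF c(1), of p])
    show "\<exists>i<n - 1. c i = z" if "c (n-1) \<le> z" "z < c (n - 2) + 1" for z
      using that c p n by (cases "z = c (n - 2)") (auto intro: exI[of _ p] exI[of _ "n-2"])
  qed (use n p c in auto)
  then show ?thesis using c by auto
qed

lemma content_le:
  assumes "c \<in> C" "q < n"
  shows "c q \<le> int q"
proof -
  have "{0..<c q} \<subseteq> c ` {..<q}" using smaller_earlier[OF assms] by force
  from surj_card_le[OF _ this] have "card {0..<c q} \<le> q" by simp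
  then show ?thesis by auto
qed

end

section \<open>Jucys-Murphy elements\<close>

type_synonym perm_fun = "(nat \<Rightarrow> nat) \<Rightarrow> complex"

text \<open>The group algebra of the symmetric group on \<open>{..<n}\<close> is realised inside all
  functions on maps. Permutations act by right translation of the argument, and
  \<open>jucys_murphy k\<close> sums the transpositions \<open>(i k)\<close> with
  \<open>i < k\<close>, letters being counted from 0.\<close>

definition supported :: "nat \<Rightarrow> perm_fun \<Rightarrow> bool" where
  "supported n F \<longleftrightarrow> (\<forall>\<omega>. \<not> \<omega> permutes {..<n} \<longrightarrow> F \<omega> = 0)"

definition act :: "(nat \<Rightarrow> nat) \<Rightarrow> perm_fun \<Rightarrow> perm_fun" where
  "act \<tau> F = (\<lambda>\<omega>. F (\<omega> \<circ> \<tau>))"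

definition jucys_murphy :: "nat \<Rightarrow> perm_fun \<Rightarrow> perm_fun" where
  "jucys_murphy k F = (\<lambda>\<omega>. \<Sum>i<k. F (\<omega> \<circ> transpose i k))"

definition inner_on :: "nat \<Rightarrow> perm_fun \<Rightarrow> perm_fun \<Rightarrow> complex" where
  "inner_on n F G = (\<Sum>\<omega> | \<omega> permutes {..<n}. F \<omega> * cnj (G \<omega>))"

lemma act_act: "act \<sigma> (act \<tau> F) = act (\<sigma> \<circ> \<tau>) F"
  by (simp add: act_def comp_assoc)

lemma act_transpose_twice [simp]: "act (transpose a b) (act (transpose a b) F) = F"
  by (simp add: act_def comp_assoc)

lemma jucys_murphy_act: "jucys_murphy k F \<omega> = (\<Sum>i<k. act (transpose i k) F \<omega>)"
  by (simp add: jucys_murphy_def act_def)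

lemma act_lin: "act \<tau> (\<lambda>\<omega>. a * F \<omega> + b * G \<omega>) = (\<lambda>\<omega>. a * act \<tau> F \<omega> + b * act \<tau> G \<omega>)"
  by (simp add: act_def)

lemma jucys_murphy_lin:
  "jucys_murphy k (\<lambda>\<omega>. a * F \<omega> + b * G \<omega>) = (\<lambda>\<omega>. a * jucys_murphy k F \<omega> + b * jucys_murphy k G \<omega>)"
  by (simp add: jucys_murphy_def sum.distrib sum_distrib_left)

lemma permutes_comp_iff:
  assumes "\<tau> permutes S"
  shows "(\<omega> \<circ> \<tau>) permutes S \<longleftrightarrow> \<omega> permutes S"
proof
  assume "(\<omega> \<circ> \<tau>) permutes S"
  from permutes_compose[OF permutes_inv[OF assms] this] show "\<omega> permutes S"
    by (simp add: comp_assoc permutes_inv_o[OF assms])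
qed (rule permutes_compose[OF assms])

lemma supported_act: "\<tau> permutes {..<n} \<Longrightarrow> supported n F \<Longrightarrow> supported n (act \<tau> F)"
  by (simp add: supported_def act_def permutes_comp_iff)

lemma transpose_permutes: "i < n \<Longrightarrow> k < n \<Longrightarrow> transpose i k permutes {..<n::nat}"
  by (auto intro: permutes_swap_id)

lemma supported_jucys_murphy:
  assumes "k < n" "supported n F"
  shows "supported n (jucys_murphy k F)"
proof -
  have "supported n (act (transpose i k) F)" if "i < k" for i
    using assms that by (intro supported_act transpose_permutes) auto
  then show ?thesis by (auto simp: supported_def jucys_murphy_act)
qed

lemma supported_lin: "supported n F \<Longrightarrow> supported n G \<Longrightarrow> supported n (\<lambda>\<omega>. a * F \<omega> + b * G \<omega>)"
  by (simp add: supported_def)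

lemma comp_transpose_eq:
  assumes "inj \<tau>"
  shows "\<tau> \<circ> transpose i k = transpose (\<tau> i) (\<tau> k) \<circ> \<tau>"
  using assms by (auto simp: fun_eq_iff transpose_def inj_eq)

text \<open>Conjugation by a permutation of the letters below \<open>k\<close> merely permutes the
  transpositions \<open>(i k)\<close>.\<close>

lemma act_jucys_murphy_below:
  assumes "\<tau> permutes {..<k}"
  shows "act \<tau> (jucys_murphy k F) = jucys_murphy k (act \<tau> F)"
proof
  fix \<omega>
  have "\<tau> k = k" using assms by (simp add: permutes_not_in)
  then have "\<tau> \<circ> transpose i k = transpose (\<tau> i) k \<circ> \<tau>" for i
    using comp_transpose_eq[of \<tau> i k] assms permutes_inj by metis
  then have "act \<tau> (jucys_murphy k F) \<omega> = (\<Sum>i<k. F (\<omega> \<circ> (transpose (\<tau> i) k \<circ> \<tau>)))"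
    by (simp add: act_def jucys_murphy_def comp_assoc)
  also have "\<dots> = (\<Sum>i<k. F (\<omega> \<circ> (transpose i k \<circ> \<tau>)))"
    using sum.permute[OF assms, of "\<lambda>i. F (\<omega> \<circ> (transpose i k \<circ> \<tau>))"] by (simp add: comp_def)
  finally show "act \<tau> (jucys_murphy k F) \<omega> = jucys_murphy k (act \<tau> F) \<omega>"
    by (simp add: act_def jucys_murphy_def comp_assoc)
qed

lemma jucys_murphy_commute_less:
  assumes "j < k"
  shows "jucys_murphy j (jucys_murphy k F) = jucys_murphy k (jucys_murphy j F)"
proof
  fix \<omega>
  have "jucys_murphy j (jucys_murphy k F) \<omega> = (\<Sum>i<j. jucys_murphy k (act (transpose i j) F) \<omega>)"
    unfolding jucys_murphy_act[of j]
    by (intro sum.cong refl) (use assms in \<open>simp add: act_jucys_murphy_below transpose_permutes\<close>)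
  also have "\<dots> = jucys_murphy k (jucys_murphy j F) \<omega>"
    by (simp add: jucys_murphy_def act_def) (rule sum.swap)
  finally show "jucys_murphy j (jucys_murphy k F) \<omega> = jucys_murphy k (jucys_murphy j F) \<omega>" .
qed

lemma jucys_murphy_commute: "jucys_murphy j (jucys_murphy k F) = jucys_murphy k (jucys_murphy j F)"
  using jucys_murphy_commute_less[of j k F] jucys_murphy_commute_less[of k j F] by (cases j k rule: linorder_cases) auto

lemma act_jucys_murphy_above:
  assumes "k < a" "k < b"
  shows "act (transpose a b) (jucys_murphy k F) = jucys_murphy k (act (transpose a b) F)"
proof -
  have "transpose a b \<circ> transpose i k = transpose i k \<circ> transpose a b" if "i < k" for i
    using comp_transpose_eq[of "transpose a b" i k] assms that by (simp add: inj_transpose)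
  then show ?thesis
    by (auto simp: act_def jucys_murphy_def comp_assoc intro!: ext sum.cong)
qed

text \<open>This is the relation of the degenerate affine Hecke algebra. Conjugation by
  \<open>s\<close> carries the summands of \<open>jucys_murphy k\<close> to those of
  \<open>jucys_murphy (Suc k)\<close> except \<open>s\<close> itself, and that missing summand
  accounts for the term \<open>F\<close>.\<close>

lemma act_jucys_murphy:
  "act (transpose k (Suc k)) (jucys_murphy k F) =
    (\<lambda>\<omega>. jucys_murphy (Suc k) (act (transpose k (Suc k)) F) \<omega> - F \<omega>)"
proof
  fix \<omega>
  let ?s = "transpose k (Suc k)"
  have "transpose i (Suc k) \<circ> ?s = ?s \<circ> transpose i k" if "i < k" for i
    using comp_transpose_eq[of ?s i k] that by (simp add: inj_transpose)
  then show "act ?s (jucys_murphy k F) \<omega> = jucys_murphy (Suc k) (act ?s F) \<omega> - F \<omega>"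
    by (simp add: act_def jucys_murphy_def comp_assoc)
qed

lemma act_jucys_murphy_Suc:
  "act (transpose k (Suc k)) (jucys_murphy (Suc k) F) =
    (\<lambda>\<omega>. jucys_murphy k (act (transpose k (Suc k)) F) \<omega> + F \<omega>)"
proof -
  let ?s = "transpose k (Suc k)"
  have 1: "jucys_murphy (Suc k) F = (\<lambda>\<omega>. 1 * act ?s (jucys_murphy k (act ?s F)) \<omega> + 1 * act ?s F \<omega>)"
    using act_jucys_murphy[of k "act ?s F"] by (auto simp: fun_eq_iff)
  show ?thesis
    by (subst 1, subst act_lin) simp
qed

lemma inner_act:
  assumes "\<tau> permutes {..<n}"
  shows "inner_on n (act \<tau> F) (act \<tau> G) = inner_on n F G"
  unfolding inner_on_def act_def
  by (rule sum.reindex_bij_witness[of _ "\<lambda>\<omega>. \<omega> \<circ> inv_into UNIV \<tau>" "\<lambda>\<omega>. \<omega> \<circ> \<tau>"])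
    (auto simp: comp_assoc permutes_inv_o[OF assms] permutes_comp_iff[OF assms] intro: permutes_compose permutes_inv assms)

lemma inner_act_transpose:
  assumes "i < n" "k < n"
  shows "inner_on n (act (transpose i k) F) G = inner_on n F (act (transpose i k) G)"
  using inner_act[OF transpose_permutes[OF assms], of F "act (transpose i k) G"] by simp

text \<open>Transpositions act as unitary involutions, so sums of them are self-adjoint.\<close>

lemma inner_jucys_murphy:
  assumes "k < n"
  shows "inner_on n (jucys_murphy k F) G = inner_on n F (jucys_murphy k G)"
proof -
  have "inner_on n (jucys_murphy k F) G = (\<Sum>i<k. inner_on n (act (transpose i k) F) G)"
    unfolding inner_on_def jucys_murphy_act sum_distrib_right by (rule sum.swap)
  also have "\<dots> = (\<Sum>i<k. inner_on n F (act (transpose i k) G))"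
    using assms by (intro sum.cong refl inner_act_transpose) auto
  also have "\<dots> = inner_on n F (jucys_murphy k G)"
    unfolding inner_on_def jucys_murphy_act cnj_sum sum_distrib_left by (rule sum.swap)
  finally show ?thesis .
qed

lemma inner_scale_left: "inner_on n (\<lambda>\<omega>. a * F \<omega>) G = a * inner_on n F G"
  by (simp add: inner_on_def sum_distrib_left mult.assoc)

lemma inner_scale_right: "inner_on n F (\<lambda>\<omega>. a * G \<omega>) = cnj a * inner_on n F G"
  by (simp add: inner_on_def sum_distrib_left mult.left_commute)

lemma inner_diff_left: "inner_on n (\<lambda>\<omega>. F \<omega> - F' \<omega>) G = inner_on n F G - inner_on n F' G"
  by (simp add: inner_on_def sum_subtractf left_diff_distrib)

lemma inner_diff_right: "inner_on n G (\<lambda>\<omega>. F \<omega> - F' \<omega>) = inner_on n G F - inner_on n G F'"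
  by (simp add: inner_on_def sum_subtractf right_diff_distrib)

lemma inner_eq_0:
  assumes "supported n F" "inner_on n F F = 0"
  shows "F = (\<lambda>_. 0)"
proof
  fix \<omega>
  have "complex_of_real (\<Sum>\<omega> | \<omega> permutes {..<n}. (cmod (F \<omega>))\<^sup>2) = 0"
    using assms(2) by (simp add: inner_on_def complex_norm_square[symmetric] flip: of_real_power)
  then have "(\<Sum>\<omega> | \<omega> permutes {..<n}. (cmod (F \<omega>))\<^sup>2) = 0" by (simp only: of_real_eq_0_iff)
  then have "\<forall>\<omega>\<in>{\<omega>. \<omega> permutes {..<n}}. (cmod (F \<omega>))\<^sup>2 = 0"
    by (subst (asm) sum_nonneg_eq_0_iff) (auto simp: finite_permutations)
  then show "F \<omega> = 0" using assms(1) by (cases "\<omega> permutes {..<n}") (auto simp: supported_def)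
qed

definition joint_eigen :: "nat \<Rightarrow> perm_fun \<Rightarrow> (nat \<Rightarrow> complex) \<Rightarrow> bool" where
  "joint_eigen n F c \<longleftrightarrow> F \<noteq> (\<lambda>_. 0) \<and> supported n F \<and> (\<forall>k<n. jucys_murphy k F = (\<lambda>\<omega>. c k * F \<omega>))"

lemma joint_eigen_inner: "joint_eigen n F c \<Longrightarrow> inner_on n F F \<noteq> 0"
  using inner_eq_0 by (auto simp: joint_eigen_def)

lemma joint_eigen_real:
  assumes "joint_eigen n F c" "k < n"
  shows "cnj (c k) = c k"
proof -
  have "c k * inner_on n F F = cnj (c k) * inner_on n F F"
    using inner_jucys_murphy[OF assms(2), of F F] assms
    by (simp add: joint_eigen_def inner_scale_left inner_scale_right)
  then show ?thesis using joint_eigen_inner[OF assms(1)] by simp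
qed

text \<open>If both contents were \<open>a\<close>, the operator \<open>jucys_murphy i\<close> minus
  \<open>a\<close> would send \<open>act s F\<close> to \<open>- F\<close>. But it is self-adjoint
  and kills \<open>F\<close>, so its image is orthogonal to \<open>F\<close>.\<close>

lemma joint_eigen_neighbours:
  assumes F: "joint_eigen n F c" and i: "Suc i < n"
  shows "c i \<noteq> c (Suc i)"
proof
  assume eq: "c i = c (Suc i)"
  let ?s = "transpose i (Suc i)"
  have J: "jucys_murphy i F = (\<lambda>\<omega>. c i * F \<omega>)" "jucys_murphy (Suc i) F = (\<lambda>\<omega>. c i * F \<omega>)"
    using F i eq by (auto simp: joint_eigen_def)
  have "jucys_murphy i (act ?s F) = (\<lambda>\<omega>. c i * act ?s F \<omega> - F \<omega>)"
    using act_jucys_murphy_Suc[of i F] J by (auto simp: fun_eq_iff act_def algebra_simps)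
  then have "c i * inner_on n (act ?s F) F - inner_on n F F = cnj (c i) * inner_on n (act ?s F) F"
    using inner_jucys_murphy[of i n "act ?s F" F] i J
    by (simp add: inner_diff_left inner_scale_left inner_scale_right)
  then show False using joint_eigen_real[OF F, of i] joint_eigen_inner[OF F] i by simp
qed

text \<open>On the span of \<open>F\<close> and \<open>act s F\<close> both Jucys-Murphy elements
  are triangular; the multiple of \<open>F\<close> subtracted in \<open>G\<close> is the one that
  makes them diagonal, with the two eigenvalues exchanged.\<close>

lemma joint_eigen_swap_aux:
  fixes c :: "nat \<Rightarrow> complex"
  assumes F: "joint_eigen n F c" and i: "Suc i < n"
  defines "s \<equiv> transpose i (Suc i)"
  defines "G \<equiv> (\<lambda>\<omega>. act s F \<omega> - F \<omega> / (c (Suc i) - c i))"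
  assumes "G \<noteq> (\<lambda>_. 0)"
  shows "joint_eigen n G (c \<circ> s)"
  unfolding joint_eigen_def
proof (intro conjI allI impI)
  have ne: "c (Suc i) - c i \<noteq> 0" using joint_eigen_neighbours[OF F i] by simp
  have G: "G = (\<lambda>\<omega>. 1 * act s F \<omega> + (- (1 / (c (Suc i) - c i))) * F \<omega>)"
    by (simp add: G_def)
  have J: "jucys_murphy k F = (\<lambda>\<omega>. c k * F \<omega>)" if "k < n" for k
    using F that by (simp add: joint_eigen_def)
  have act_scale: "act s (\<lambda>\<omega>. a * F \<omega>) = (\<lambda>\<omega>. a * act s F \<omega>)" for a by (simp add: act_def)
  show "supported n G" using F i unfolding G
    by (intro supported_lin supported_act) (auto simp: joint_eigen_def s_def intro!: transpose_permutes)
  show "jucys_murphy k G = (\<lambda>\<omega>. (c \<circ> s) k * G \<omega>)" if k: "k < n" for k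
  proof -
    have split: "jucys_murphy k G = (\<lambda>\<omega>. jucys_murphy k (act s F) \<omega> - c k * F \<omega> / (c (Suc i) - c i))"
      unfolding G jucys_murphy_lin J[OF k] by (simp add: fun_eq_iff)
    consider "k = i" | "k = Suc i" | "k < i" | "Suc i < k" by linarith
    then show ?thesis
    proof cases
      case 1
      have "jucys_murphy i (act s F) = (\<lambda>\<omega>. c (Suc i) * act s F \<omega> - F \<omega>)"
        using act_jucys_murphy_Suc[of i F, folded s_def] unfolding J[OF i] act_scale
        by (simp add: fun_eq_iff)
      with ne show ?thesis unfolding split unfolding 1 by (simp add: fun_eq_iff s_def G_def) (simp add: field_simps)
    next
      case 2
      have "jucys_murphy (Suc i) (act s F) = (\<lambda>\<omega>. c i * act s F \<omega> + F \<omega>)"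
        using act_jucys_murphy[of i F, folded s_def] unfolding J[OF Suc_lessD[OF i]] act_scale
        by (simp add: fun_eq_iff)
      with ne show ?thesis unfolding split unfolding 2 by (simp add: fun_eq_iff s_def G_def) (simp add: field_simps)
    next
      case 3
      then have "jucys_murphy k (act s F) = (\<lambda>\<omega>. c k * act s F \<omega>)"
        using act_jucys_murphy_above[of k i "Suc i" F, folded s_def] unfolding J[OF k] act_scale by simp
      then show ?thesis using 3 split by (auto simp: fun_eq_iff s_def G_def field_simps transpose_def)
    next
      case 4
      then have "jucys_murphy k (act s F) = (\<lambda>\<omega>. c k * act s F \<omega>)"
        using act_jucys_murphy_below[OF transpose_permutes[of i k "Suc i", folded s_def], of F]
        unfolding J[OF k] act_scale by simp
      then show ?thesis using 4 split by (auto simp: fun_eq_iff s_def G_def field_simps transpose_def)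
    qed
  qed
qed (fact assms)

text \<open>If the intertwined vector vanished, \<open>s\<close> would act on \<open>F\<close> by
  the inverse of the difference of the two contents; \<open>s\<close> being an involution, that
  difference would be 1 or -1.\<close>

lemma joint_eigen_swap:
  assumes F: "joint_eigen n F c" and i: "Suc i < n" and ne: "c (Suc i) \<noteq> c i + 1" "c (Suc i) \<noteq> c i - 1"
  shows "\<exists>G. joint_eigen n G (c \<circ> transpose i (Suc i))"
proof -
  let ?s = "transpose i (Suc i)" and ?d = "c (Suc i) - c i"
  have d: "?d \<noteq> 0" using joint_eigen_neighbours[OF F i] by simp
  have "(\<lambda>\<omega>. act ?s F \<omega> - F \<omega> / ?d) \<noteq> (\<lambda>_. 0)"
  proof
    assume "(\<lambda>\<omega>. act ?s F \<omega> - F \<omega> / ?d) = (\<lambda>_. 0)"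
    then have eq: "act ?s F = (\<lambda>\<omega>. F \<omega> / ?d)" by (auto simp: fun_eq_iff)
    have "F \<omega> = F \<omega> / ?d / ?d" for \<omega>
    proof -
      have "F \<omega> = act ?s (act ?s F) \<omega>" by simp
      also have "\<dots> = act ?s F \<omega> / ?d" by (subst eq) (simp add: act_def)
      also have "\<dots> = F \<omega> / ?d / ?d" by (subst eq) simp
      finally show ?thesis .
    qed
    moreover obtain \<omega> where "F \<omega> \<noteq> 0" using F by (auto simp: joint_eigen_def)
    ultimately have "?d * ?d = 1" using d by (metis divide_divide_eq_left divide_self_if mult_cancel_left1 nonzero_mult_div_cancel_left eq_divide_eq)
    then have "?d = 1 \<or> ?d = - 1" by (simp add: square_eq_1_iff)
    then show False using ne by (auto simp: algebra_simps)
  qed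
  from joint_eigen_swap_aux[OF F i this] show ?thesis by blast
qed

text \<open>Otherwise \<open>G = act s F - e F\<close> is an eigenvector for the swapped contents,
  hence orthogonal to \<open>F\<close>. Since \<open>s\<close> acts on \<open>G\<close> by
  \<open>- e\<close>, it is orthogonal to \<open>act s F\<close> as well, and therefore to
  itself.\<close>

lemma joint_eigen_adjacent:
  assumes F: "joint_eigen n F c" and i: "Suc i < n" and e: "c (Suc i) = c i + e" "e = 1 \<or> e = -1"
  shows "act (transpose i (Suc i)) F = (\<lambda>\<omega>. e * F \<omega>)"
proof (rule ccontr)
  let ?s = "transpose i (Suc i)"
  define G where "G = (\<lambda>\<omega>. act ?s F \<omega> - F \<omega> / (c (Suc i) - c i))"
  have G': "G = (\<lambda>\<omega>. act ?s F \<omega> - e * F \<omega>)" using e by (auto simp: G_def)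
  assume "act ?s F \<noteq> (\<lambda>\<omega>. e * F \<omega>)"
  then have "G \<noteq> (\<lambda>_. 0)" by (auto simp: G' fun_eq_iff)
  then have G: "joint_eigen n G (c \<circ> ?s)" using joint_eigen_swap_aux[OF F i] by (simp add: G_def)
  have "c (Suc i) * inner_on n G F = c i * inner_on n G F"
    using inner_jucys_murphy[of i n G F] i G F joint_eigen_real[OF F, of i]
    by (simp add: joint_eigen_def inner_scale_left inner_scale_right)
  then have GF: "inner_on n G F = 0" using e by auto
  have ee: "cnj e = e" "e * e = 1" using e by auto
  have "inner_on n G (act ?s F) = inner_on n (act ?s G) F"
    using inner_act_transpose[of i n "Suc i" G F] i by simp
  also have "act ?s G = (\<lambda>\<omega>. - e * G \<omega>)"
    using ee by (auto simp: G' act_def comp_assoc fun_eq_iff algebra_simps)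
  finally have "inner_on n G (act ?s F) = 0" using GF by (simp only: inner_scale_left) simp
  then have "inner_on n G G = 0" using GF ee by (subst (2) G') (simp add: inner_diff_right inner_scale_right)
  then show False using joint_eigen_inner[OF G] by simp
qed

section \<open>The joint spectrum of the Jucys-Murphy elements\<close>

definition contents :: "nat \<Rightarrow> (nat \<Rightarrow> complex) set" where
  "contents n = {c. \<exists>F. joint_eigen n F c}"

text \<open>The first content is 0 because \<open>jucys_murphy 0\<close> is an empty sum. On a
  sequence \<open>a, a + e, a\<close> the two simple transpositions would act by the opposite signs
  \<open>e\<close> and \<open>- e\<close>, and the braid relation would then give
  \<open>F = - F\<close>.\<close>

lemma content_set_contents: "content_set n (contents n)"
proof
  show "c 0 = 0" if "c \<in> contents n" "0 < n" for c
  proof -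
    obtain F where "joint_eigen n F c" using \<open>c \<in> contents n\<close> by (auto simp: contents_def)
    then have "F \<noteq> (\<lambda>_. 0)" "jucys_murphy 0 F = (\<lambda>\<omega>. c 0 * F \<omega>)" using that by (auto simp: joint_eigen_def)
    then show ?thesis by (auto simp: jucys_murphy_def fun_eq_iff)
  qed
  show "c (Suc i) \<noteq> c i + 1 \<and> c (Suc i) \<noteq> c i - 1"
    if c: "c \<in> contents n" and i: "Suc (Suc i) < n" and eq: "c (Suc (Suc i)) = c i" for c i
  proof (rule ccontr)
    assume "\<not> ?thesis"
    then obtain e where e: "e = 1 \<or> e = -1" "c (Suc i) = c i + e" by (metis diff_conv_add_uminus)
    obtain F where F: "joint_eigen n F c" using c by (auto simp: contents_def)
    let ?s = "transpose i (Suc i)" and ?t = "transpose (Suc i) (Suc (Suc i))"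
    have s: "act ?s F = (\<lambda>\<omega>. e * F \<omega>)" using joint_eigen_adjacent[OF F, of i e] e i by simp
    have t: "act ?t F = (\<lambda>\<omega>. - e * F \<omega>)" using joint_eigen_adjacent[OF F, of "Suc i" "- e"] e i eq by auto
    have scale: "act \<tau> (\<lambda>\<omega>. a * H \<omega>) = (\<lambda>\<omega>. a * act \<tau> H \<omega>)" for \<tau> a H by (simp add: act_def)
    have "?s \<circ> (?t \<circ> ?s) = ?t \<circ> (?s \<circ> ?t)" by (auto simp: fun_eq_iff transpose_def)
    then have "act ?s (act ?t (act ?s F)) = act ?t (act ?s (act ?t F))" by (simp add: act_act)
    then have "\<And>\<omega>. e * (- e * (e * F \<omega>)) = - e * (e * (- e * F \<omega>))"
      unfolding s t scale by (auto simp: fun_eq_iff)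
    then have "F \<omega> = 0" for \<omega> using e(1) by fastforce
    then have "F = (\<lambda>_. 0)" by (rule ext)
    then show False using F by (simp add: joint_eigen_def)
  qed
qed (use joint_eigen_neighbours joint_eigen_swap in \<open>auto simp: contents_def\<close>)

text \<open>The argument is that of the minimal polynomial of \<open>v\<close>: if \<open>p\<close>
  has least degree among the nonzero polynomials with \<open>p(J) v = 0\<close> and \<open>c\<close>
  is a root of \<open>p\<close>, the cofactor \<open>q\<close> of \<open>[:- c, 1:]\<close> gives
  the eigenvector \<open>q(J) v\<close>.\<close>

lemma eigenvector_in_subspace:
  fixes J :: "('x \<Rightarrow> complex) \<Rightarrow> 'x \<Rightarrow> complex"
  assumes fin: "finite \<Omega>" and supp: "\<And>F x. F \<in> S \<Longrightarrow> x \<notin> \<Omega> \<Longrightarrow> F x = 0"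
    and J_lin: "\<And>F G a b. J (\<lambda>x. a * F x + b * G x) = (\<lambda>x. a * J F x + b * J G x)"
    and S_lin: "\<And>F G a b. F \<in> S \<Longrightarrow> G \<in> S \<Longrightarrow> (\<lambda>x. a * F x + b * G x) \<in> S"
    and S_J: "\<And>F. F \<in> S \<Longrightarrow> J F \<in> S"
    and v: "v \<in> S" "v \<noteq> (\<lambda>_. 0)"
  shows "\<exists>w\<in>S. \<exists>c. w \<noteq> (\<lambda>_. 0) \<and> J w = (\<lambda>x. c * w x)"
proof -
  \<comment> \<open>\<open>E p\<close> stands for \<open>p(J) v\<close>.\<close>
  define E where "E p = (\<lambda>x. \<Sum>i\<le>Polynomial.degree p. Polynomial.coeff p i * (J ^^ i) v x)" for p
  have J0: "J (\<lambda>_. 0) = (\<lambda>_. 0)" using J_lin[of 0 v 0 v] by simp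
  have J_sum: "J (\<lambda>x. \<Sum>i\<le>(n::nat). a i * G i x) = (\<lambda>x. \<Sum>i\<le>n. a i * J (G i) x)" for n a G
  proof (induction n)
    case 0
    show ?case using J_lin[of "a 0" "G 0" 0 v] by simp
  next
    case (Suc n)
    then show ?case using J_lin[of 1 "\<lambda>x. \<Sum>i\<le>n. a i * G i x" "a (Suc n)" "G (Suc n)"] by simp
  qed
  have pow: "(J ^^ i) v \<in> S" for i by (induction i) (auto intro: S_J v)
  have E_S: "E p \<in> S" for p
  proof -
    have "(\<lambda>x. \<Sum>i\<le>n. a i * (J ^^ i) v x) \<in> S" for n :: nat and a
    proof (induction n)
      case 0
      show ?case using S_lin[OF v(1) v(1), of "a 0" 0] by simp
    next
      case (Suc n)
      show ?case using S_lin[OF Suc pow[of "Suc n"], of 1 "a (Suc n)"] by simp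
    qed
    then show ?thesis by (simp add: E_def)
  qed
  have E_ext: "E p x = (\<Sum>i\<le>n. Polynomial.coeff p i * (J ^^ i) v x)" if "Polynomial.degree p \<le> n" for p n x
    unfolding E_def using that by (intro sum.mono_neutral_left) (auto simp: coeff_eq_0)
  have E_mult: "E ([:- c, 1:] * q) = (\<lambda>x. J (E q) x - c * E q x)" for c q
  proof
    fix x
    let ?n = "Polynomial.degree q"
    have eq: "[:- c, 1:] * q = pCons 0 q - Polynomial.smult c q" by simp
    have deg: "Polynomial.degree ([:- c, 1:] * q) \<le> Suc ?n"
      using degree_mult_le[of "[:- c, 1:]" q] by simp
    have "J (E q) x = (\<Sum>i\<le>?n. Polynomial.coeff q i * (J ^^ Suc i) v x)"
      unfolding E_def J_sum by simp
    also have "\<dots> = (\<Sum>i\<le>Suc ?n. Polynomial.coeff (pCons 0 q) i * (J ^^ i) v x)"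
      by (subst sum.atMost_Suc_shift) simp
    finally have 1: "J (E q) x = \<dots>" .
    have 2: "E q x = (\<Sum>i\<le>Suc ?n. Polynomial.coeff q i * (J ^^ i) v x)" by (intro E_ext) simp
    show "E ([:- c, 1:] * q) x = J (E q) x - c * E q x"
      unfolding E_ext[OF deg] 1 2 unfolding eq
      by (simp only: coeff_diff coeff_smult left_diff_distrib sum_subtractf sum_distrib_left mult.assoc)
  qed
  obtain p where p: "p \<noteq> 0" "E p = (\<lambda>_. 0)"
  proof -
    let ?N = "card \<Omega>"
    obtain e where e: "bij_betw e {..<?N} \<Omega>" using ex_bij_betw_nat_finite[OF fin] by (auto simp: atLeast0LessThan)
    \<comment> \<open>The columns are the iterates of \<open>v\<close> up to exponent
      \<open>?N\<close>, one more than there are points. A zero row makes the matrix square with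
      determinant 0, and a kernel vector is a linear dependence, that is, an annihilating
      polynomial.\<close>
    define A where "A = mat (Suc ?N) (Suc ?N) (\<lambda>(r, i). if r < ?N then (J ^^ i) v (e r) else 0)"
    have A: "A \<in> carrier_mat (Suc ?N) (Suc ?N)" by (simp add: A_def)
    have "det A = 0"
      by (subst laplace_expansion_row[OF A, of ?N]) (simp_all add: A_def)
    then obtain u where u: "u \<in> carrier_vec (Suc ?N)" "u \<noteq> 0\<^sub>v (Suc ?N)" "A *\<^sub>v u = 0\<^sub>v (Suc ?N)"
      using det_0_iff_vec_prod_zero[OF A] by auto
    define p where "p = Poly (list_of_vec u)"
    have len: "length (list_of_vec u) = Suc ?N" using u(1) by simp
    have cf: "Polynomial.coeff p i = (if i < Suc ?N then u $ i else 0)" for i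
      using len by (simp add: p_def nth_default_def list_of_vec_index)
    have deg: "Polynomial.degree p \<le> ?N" by (rule degree_le) (simp add: cf)
    have "p \<noteq> 0"
    proof
      assume "p = 0"
      then have "u $ i = 0" if "i < Suc ?N" for i using cf[of i] that by simp
      then show False using u(1,2) by (auto simp: vec_eq_iff)
    qed
    moreover have "E p = (\<lambda>_. 0)"
    proof
      fix x
      show "E p x = 0"
      proof (cases "x \<in> \<Omega>")
        case True
        then obtain r where r: "r < ?N" "x = e r" using e by (auto simp: bij_betw_def)
        have "0 = (A *\<^sub>v u) $ r" using u(3) r by simp
        also have "\<dots> = (\<Sum>i\<le>?N. u $ i * (J ^^ i) v x)"
          using r u(1) by (simp add: A_def scalar_prod_def lessThan_Suc_atMost atLeast0LessThan mult.commute)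
        also have "\<dots> = E p x" unfolding E_ext[OF deg] by (intro sum.cong) (auto simp: cf)
        finally show ?thesis by simp
      qed (use supp[OF E_S] in auto)
    qed
    ultimately show ?thesis by (rule that)
  qed
  define P where "P = (\<lambda>p. p \<noteq> 0 \<and> E p = (\<lambda>_. 0))"
  obtain p where p: "P p" "\<And>q. P q \<Longrightarrow> Polynomial.degree p \<le> Polynomial.degree q"
    using ex_has_least_nat[of P p Polynomial.degree] p by (auto simp: P_def)
  have "Polynomial.degree p \<noteq> 0"
  proof
    assume d: "Polynomial.degree p = 0"
    then obtain a where a: "p = [:a:]" using degree_eq_zeroE by blast
    then have "E p = (\<lambda>x. a * v x)" by (simp add: E_def)
    then show False using p(1) a v(2) by (auto simp: P_def fun_eq_iff)
  qed
  then obtain c where "poly p c = 0"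
    using fundamental_theorem_of_algebra[of p] constant_degree[of p] by auto
  then obtain q where q: "p = [:- c, 1:] * q" by (auto simp: poly_eq_0_iff_dvd)
  have q0: "q \<noteq> 0" using p(1) q by (auto simp: P_def)
  have "Polynomial.degree p = Suc (Polynomial.degree q)"
    using q0 unfolding q by (subst degree_mult_eq) auto
  then have "E q \<noteq> (\<lambda>_. 0)" using p(2)[of q] q0 by (auto simp: P_def)
  moreover have "J (E q) = (\<lambda>x. c * E q x)"
    using E_mult[of c q] p(1) q by (auto simp: P_def fun_eq_iff)
  ultimately show ?thesis using E_S by blast
qed

definition int_contents :: "nat \<Rightarrow> (nat \<Rightarrow> int) set" where
  "int_contents n = {c. (\<lambda>i. of_int (c i)) \<in> contents n}"

lemma int_content_set_contents: "int_content_set n (int_contents n)"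
proof -
  interpret C: content_set n "contents n" by (rule content_set_contents)
  show ?thesis
  proof
    fix c i assume c: "c \<in> int_contents n"
    note c' = c[unfolded int_contents_def mem_Collect_eq]
    show "c 0 = 0" if "0 < n" using C.zero[OF c' that] by simp
    show "c i \<noteq> c (Suc i)" if "Suc i < n" using C.neighbours[OF c' that] by simp
    show "c \<circ> transpose i (Suc i) \<in> int_contents n"
      if "Suc i < n" "c (Suc i) \<noteq> c i + 1" "c (Suc i) \<noteq> c i - 1"
    proof -
      have "(\<lambda>i. complex_of_int (c i)) \<circ> transpose i (Suc i) \<in> contents n"
      proof (rule C.swap[OF c' that(1)])
        show "complex_of_int (c (Suc i)) \<noteq> of_int (c i) + 1"
          using that(2) by (metis of_int_1 of_int_add of_int_eq_iff)
        show "complex_of_int (c (Suc i)) \<noteq> of_int (c i) - 1"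
          using that(3) by (metis of_int_1 of_int_diff of_int_eq_iff)
      qed
      then show ?thesis by (simp add: int_contents_def comp_def)
    qed
    show "c (Suc i) \<noteq> c i + 1 \<and> c (Suc i) \<noteq> c i - 1" if "Suc (Suc i) < n" "c (Suc (Suc i)) = c i"
      using C.braid[OF c' that(1)] that(2) by auto
  qed
qed

text \<open>Only entries below \<open>n\<close> enter \<open>joint_eigen\<close>, so
  \<open>c\<close> can be replaced by an integer sequence that agrees with it there and is arbitrary
  beyond.\<close>

lemma joint_eigen_int:
  assumes "joint_eigen n F c"
  obtains z where "\<And>k. k < n \<Longrightarrow> c k = of_int (z k)" "z \<in> int_contents n"
proof -
  interpret C: content_set n "contents n" by (rule content_set_contents)
  have "c \<in> contents n" using assms by (auto simp: contents_def)
  then have "\<exists>m. c k = of_int m" if "k < n" for k using C.content_int that by (metis Ints_cases)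
  then obtain z where z: "\<And>k. k < n \<Longrightarrow> c k = of_int (z k)" by metis
  with assms have "joint_eigen n F (\<lambda>k. of_int (z k))" by (simp add: joint_eigen_def)
  then show ?thesis using that[of z] z by (auto simp: int_contents_def contents_def)
qed

text \<open>An upper bound for the parameters at which diagrams with a single cup and
  \<open>n\<close> bottom points have harmonic vectors. Away from 0 it is the nonzero part of
  \<open>X n\<close> and grows with \<open>n\<close>, so for \<open>n \<le> r\<close> only the value
  0 can fail to lie in \<open>X r\<close>.\<close>

definition one_cup_values :: "nat \<Rightarrow> int set" where
  "one_cup_values n = {z. (\<exists>c. 1 \<le> c \<and> c \<le> int n - 2 \<and> z = - 2 * c) \<or> (1 \<le> z \<and> z \<le> int n - 2) \<or>
     (4 - int n \<le> z \<and> z \<le> - 1) \<or> (z = 0 \<and> n \<noteq> 3 \<and> n \<noteq> 5)}"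

context int_content_set
begin

lemma int_negated: "int_content_set n ((\<lambda>c i. - c i) ` C)"
  unfolding int_content_set_def by (rule negated)

text \<open>The last two boxes form a horizontal domino of contents \<open>c, c + 1\<close>, and
  \<open>1 - c - (c + 1) = - 2 * c\<close>. For negative \<open>c\<close> the domino is transposed
  into a vertical one; for \<open>c = 0\<close> it does not fit at the end of a sequence of 3 or 5
  boxes.\<close>

lemma ascending_end_value:
  assumes n: "2 \<le> n" and c: "c \<in> C" "c (n - 1) = c (n - 2) + 1"
  shows "- 2 * c (n - 2) \<in> one_cup_values n"
proof -
  interpret neg: int_content_set n "(\<lambda>c i. - c i) ` C" by (rule int_negated)
  consider "c (n - 2) \<ge> 1" | "c (n - 2) \<le> -1" | "c (n - 2) = 0" by linarith
  then show ?thesis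
  proof cases
    case 1
    then show ?thesis using content_le[OF c(1), of "n - 2"] n by (auto simp: one_cup_values_def)
  next
    case 2
    then have "2 * (- c (n - 2)) \<le> int n - 2"
      using neg.descending_end_bound[of "\<lambda>i. - c i"] n c by auto
    then show ?thesis using 2 by (auto simp: one_cup_values_def)
  next
    case 3
    have "n \<noteq> 3"
    proof
      assume "n = 3"
      then show False using neighbours[OF c(1), of 0] zero[OF c(1)] 3 by auto
    qed
    moreover have "n \<noteq> 5"
    proof
      assume n5: "n = 5"
      have c0: "c 0 = 0" "c 3 = 0" "c 4 = 1" using zero[OF c(1)] c 3 n5 by auto
      obtain m where m: "0 < m" "m < 3" "c m = 1" using between_plus[OF c(1), of 0 3] c0 n5 by auto
      obtain l where l: "0 < l" "l < 3" "c l = -1" using between_minus[OF c(1), of 0 3] c0 n5 by auto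
      obtain j where j: "m < j" "j < 4" "c j = 2" using between_plus[OF c(1), of m 4] c0 n5 m by auto
      \<comment> \<open>The three contents 1, -1 and 2 would have to share the places 1 and
        2.\<close>
      have "j \<noteq> 3" "m \<noteq> l" "j \<noteq> l" using j c0 l m by auto
      then show False using m l j by linarith
    qed
    ultimately show ?thesis using 3 by (auto simp: one_cup_values_def)
  qed
qed

text \<open>The final contents would be \<open>x\<close> and \<open>1 - x\<close>. For
  \<open>x = 3\<close> the contents 0, 1, 2 and -1 are needed in three places. For
  \<open>x = 2\<close> the places before hold 0, 1 and necessarily -1, whose repetition at the end
  would force a -2 in between.\<close>

lemma two_ends_five:
  assumes n5: "n = 5" and c: "c \<in> C" "c' \<in> C" "\<And>i. i < 3 \<Longrightarrow> c' i = c i" "c' 3 = c 4" "c 3 + c 4 = 1" "2 \<le> c 3"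
  shows False
proof -
  interpret neg: int_content_set n "(\<lambda>c i. - c i) ` C" by (rule int_negated)
  have e: "c 0 = 0" "c 4 = 1 - c 3" "c' 3 = 1 - c 3" using zero[OF c(1)] c n5 by auto
  have low: "\<exists>i<3. c i = z" if "0 \<le> z" "z < c 3" for z
    using smaller_earlier[OF c(1), of 3 z] that e n5 by auto
  have "c 3 \<le> 3" using content_le[OF c(1), of 3] e n5 by auto
  then consider "c 3 = 3" | "c 3 = 2" using c(6) by linarith
  then show False
  proof cases
    case 1
    have "\<exists>i<3. - c' i = 1" using neg.smaller_earlier[of "\<lambda>i. - c' i" 3 1] e n5 1 c(2) by auto
    then obtain i where i: "i < 3" "c i = - 1" using c(3) n5 by (auto simp: minus_equation_iff)
    obtain j where j: "j < 3" "c j = 1" using low[of 1] 1 by auto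
    obtain k where k: "k < 3" "c k = 2" using low[of 2] 1 by auto
    have "\<And>l. c l \<noteq> 0 \<Longrightarrow> l \<noteq> 0" using e(1) by metis
    then have "i \<noteq> 0" "j \<noteq> 0" "k \<noteq> 0" using i j k by (metis zero_neq_neg_one zero_neq_one zero_neq_numeral)+
    moreover have "i \<noteq> j" "i \<noteq> k" "j \<noteq> k" using i j k by auto
    ultimately show False using i(1) j(1) k(1) by linarith
  next
    case 2
    obtain j where j: "j < 3" "c j = 1" using low[of 1] 2 by auto
    then have "j \<noteq> 0" using e by (metis zero_neq_one)
    with j consider "j = 1" | "j = 2" by linarith
    then show False
    proof cases
      case 1
      have ne: "c 2 \<noteq> 1" "c 2 \<noteq> 2" using neighbours[OF c(1), of 1] neighbours[OF c(1), of 2] 1 j e 2 n5 by (auto simp: numeral_eq_Suc)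
      have "c 2 \<noteq> 0"
      proof
        assume "c 2 = 0"
        then obtain m where m: "0 < m" "m < 2" "c m = - 1" using between_minus[OF c(1), of 0 2] e n5 by auto
        then have "m = j" using 1 by linarith
        then show False using m(3) j(2) by simp
      qed
      then obtain p where p: "p < 2" "c p = c 2 - 1 \<or> c p = c 2 + 1" using predecessor[OF c(1), of 2] n5 by auto
      then have "p = 0 \<or> p = 1" by linarith
      then have "c 2 = -1" using p(2) e 1 j ne \<open>c 2 \<noteq> 0\<close> by auto
      then obtain m where m: "2 < m" "m < 4" "c m = - 2" using between_minus[OF c(1), of 2 4] e n5 2 by auto
      then have "m = 3" by linarith
      with m(3) e 2 show False by simp
    next
      case j2: 2
      have ne: "c 1 \<noteq> 1" "c 1 \<noteq> 0" using neighbours[OF c(1), of 0] neighbours[OF c(1), of 1] j2 j e 2 n5 by (auto simp: numeral_eq_Suc)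
      then obtain p where p: "p < 1" "c p = c 1 - 1 \<or> c p = c 1 + 1" using predecessor[OF c(1), of 1] n5 by auto
      then have "c 1 = -1" using e ne by auto
      then obtain m where m: "1 < m" "m < 4" "c m = - 2" using between_minus[OF c(1), of 1 4] e n5 2 by auto
      then have "m = 2 \<or> m = 3" by linarith
      with m(3) e 2 j2 j show False by auto
    qed
  qed
qed

text \<open>The lower bound is the upper bound for the negated sequences. Negation reverses the
  order of the two contents, so \<open>c\<close> and \<open>c'\<close> exchange their roles.\<close>

lemma two_ends_value:
  assumes n: "2 \<le> n" and c: "c \<in> C" "c' \<in> C" "\<And>i. i < n - 2 \<Longrightarrow> c' i = c i"
    "c' (n - 2) = c (n - 1)" "c' (n - 1) = c (n - 2)" "c (n - 1) + 1 < c (n - 2)"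
  shows "1 - c (n - 2) - c (n - 1) \<in> one_cup_values n"
proof -
  interpret neg: int_content_set n "(\<lambda>c i. - c i) ` C" by (rule int_negated)
  let ?x = "c (n - 2)" and ?y = "c (n - 1)"
  have 1: "?x + ?y \<le> int n - 3" using two_ends_bound[OF n c(1,2)] c by auto
  have 2: "- ?x - ?y \<le> int n - 3"
    using neg.two_ends_bound[OF n, of "\<lambda>i. - c' i" "\<lambda>i. - c i"] c by auto
  have "n \<noteq> 3 \<and> n \<noteq> 5" if xy: "?x + ?y = 1"
  proof
    have x: "?x \<ge> 2" using xy c(6) by auto
    show "n \<noteq> 3"
    proof
      assume "n = 3"
      then show False using x content_le[OF c(1), of 1] by auto
    qed
    show "n \<noteq> 5"
      using two_ends_five[of c c'] c x xy by auto
  qed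
  then show ?thesis using 1 2 by (auto simp: one_cup_values_def)
qed

end

section \<open>Diagonalisation on vectors fixed by the last transposition\<close>

lemma act_jucys_murphy_pair:
  fixes m defines "s \<equiv> transpose m (Suc m)"
  assumes "act s F = F"
  shows "act s (jucys_murphy m (jucys_murphy (Suc m) F)) = jucys_murphy m (jucys_murphy (Suc m) F)"
proof -
  let ?J = "jucys_murphy m" and ?J' = "jucys_murphy (Suc m)"
  have 1: "act s (?J' F) = (\<lambda>\<omega>. 1 * ?J F \<omega> + 1 * F \<omega>)"
    using act_jucys_murphy_Suc[of m F] assms by (simp add: s_def)
  have "act s (?J (?J' F)) = (\<lambda>\<omega>. ?J' (act s (?J' F)) \<omega> - ?J' F \<omega>)"
    using act_jucys_murphy[of m "?J' F"] by (simp add: s_def)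
  also have "\<dots> = ?J' (?J F)" unfolding 1 jucys_murphy_lin by simp
  finally show ?thesis by (simp add: jucys_murphy_commute)
qed

text \<open>The operators \<open>jucys_murphy k\<close> with \<open>k < m\<close> and the product of
  the last two commute with each other and preserve the space described by the hypotheses, so
  \<open>eigenvector_in_subspace\<close> can be applied to one of them after the other. The factor
  \<open>jucys_murphy m\<close> by itself need not preserve \<open>act s G = G\<close>, which is why
  the product is diagonalised instead.\<close>

lemma one_cup_joint_eigen:
  fixes m :: nat and b :: complex
  defines "s \<equiv> transpose m (Suc m)"
  assumes F: "supported (Suc (Suc m)) F" "F \<noteq> (\<lambda>_. 0)" "act s F = F"
    "\<And>\<omega>. jucys_murphy m F \<omega> + jucys_murphy (Suc m) F \<omega> = b * F \<omega>"
  obtains G c e where "supported (Suc (Suc m)) G" "G \<noteq> (\<lambda>_. 0)" "act s G = G"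
    "\<And>\<omega>. jucys_murphy m G \<omega> + jucys_murphy (Suc m) G \<omega> = b * G \<omega>"
    "\<And>k. k < m \<Longrightarrow> jucys_murphy k G = (\<lambda>\<omega>. c k * G \<omega>)"
    "jucys_murphy m (jucys_murphy (Suc m) G) = (\<lambda>\<omega>. e * G \<omega>)"
proof -
  let ?n = "Suc (Suc m)" and ?J = "jucys_murphy m" and ?J' = "jucys_murphy (Suc m)"
  define S0 where "S0 = {G. supported ?n G \<and> act s G = G \<and> (\<forall>\<omega>. ?J G \<omega> + ?J' G \<omega> = b * G \<omega>)}"
  define S where "S k c = {G \<in> S0. \<forall>i<k. jucys_murphy i G = (\<lambda>\<omega>. c i * G \<omega>)}" for k and c :: "nat \<Rightarrow> complex"
  have fin: "finite {\<omega>. \<omega> permutes {..<?n}}" by (simp add: finite_permutations)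
  have supp: "G \<omega> = 0" if "G \<in> S k c" "\<omega> \<notin> {\<omega>. \<omega> permutes {..<?n}}" for G \<omega> k c
    using that by (auto simp: S_def S0_def supported_def)
  have lin0: "(\<lambda>x. x1 * G x + x2 * H x) \<in> S0" if "G \<in> S0" "H \<in> S0" for G H x1 x2
    using that supported_lin by (auto simp: S0_def act_lin jucys_murphy_lin algebra_simps fun_eq_iff simp flip: distrib_left)
  have lin: "(\<lambda>x. x1 * G x + x2 * H x) \<in> S k c" if "G \<in> S k c" "H \<in> S k c" for G H x1 x2 k c
    using that lin0 by (auto simp: S_def jucys_murphy_lin algebra_simps fun_eq_iff)
  have comm: "(\<lambda>\<omega>. ?J (jucys_murphy k G) \<omega> + ?J' (jucys_murphy k G) \<omega>) = (\<lambda>\<omega>. b * jucys_murphy k G \<omega>)"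
    if "G \<in> S0" for G k
  proof -
    have "(\<lambda>\<omega>. 1 * ?J G \<omega> + 1 * ?J' G \<omega>) = (\<lambda>\<omega>. b * G \<omega> + 0 * G \<omega>)" using that by (simp add: S0_def)
    then have "jucys_murphy k (\<lambda>\<omega>. 1 * ?J G \<omega> + 1 * ?J' G \<omega>) = jucys_murphy k (\<lambda>\<omega>. b * G \<omega> + 0 * G \<omega>)" by (rule arg_cong)
    then show ?thesis unfolding jucys_murphy_lin by (simp add: jucys_murphy_commute)
  qed
  have closed: "jucys_murphy i (jucys_murphy k G) = (\<lambda>\<omega>. c i * jucys_murphy k G \<omega>)"
    if "jucys_murphy i G = (\<lambda>\<omega>. c i * G \<omega>)" for i k G and c :: "nat \<Rightarrow> complex"
    using jucys_murphy_lin[of k "c i" G 0 G] that by (simp add: jucys_murphy_commute[of i k])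
  have step: "jucys_murphy k G \<in> S k c" if "G \<in> S k c" "k < m" for G k c
  proof -
    have "G \<in> S0" using that by (simp add: S_def)
    moreover from this have "act s (jucys_murphy k G) = jucys_murphy k G"
      using act_jucys_murphy_above[of k m "Suc m" G] that(2) by (simp add: S0_def s_def)
    ultimately have "jucys_murphy k G \<in> S0" using that(2) comm[of G k]
      by (auto simp: S0_def fun_eq_iff intro!: supported_jucys_murphy)
    then show ?thesis using that closed by (auto simp: S_def)
  qed
  have "\<exists>c. \<exists>G\<in>S k c. G \<noteq> (\<lambda>_. 0)" if "k \<le> m" for k
    using that
  proof (induction k)
    case 0
    have "F \<in> S 0 (\<lambda>_. 0)" using F by (simp add: S_def S0_def)
    then show ?case using F(2) by blast
  next
    case (Suc k)
    then obtain c G where G: "G \<in> S k c" "G \<noteq> (\<lambda>_. 0)" by auto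
    have "\<exists>H\<in>S k c. \<exists>a. H \<noteq> (\<lambda>_. 0) \<and> jucys_murphy k H = (\<lambda>x. a * H x)"
      by (rule eigenvector_in_subspace[OF fin])
        (use supp lin step G Suc.prems jucys_murphy_lin in \<open>auto 0 3\<close>)
    then obtain H a where H: "H \<in> S k c" "H \<noteq> (\<lambda>_. 0)" "jucys_murphy k H = (\<lambda>x. a * H x)" by auto
    then have "H \<in> S (Suc k) (c(k := a))" by (auto simp: S_def less_Suc_eq)
    then show ?case using H(2) by blast
  qed
  from this[OF le_refl] obtain c G where G: "G \<in> S m c" "G \<noteq> (\<lambda>_. 0)" by auto
  have lin2: "?J (?J' (\<lambda>x. x1 * F x + x2 * G x)) = (\<lambda>x. x1 * ?J (?J' F) x + x2 * ?J (?J' G) x)" for F G x1 x2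
    by (simp add: jucys_murphy_lin)
  have step2: "?J (?J' G) \<in> S m c" if "G \<in> S m c" for G
  proof -
    have "(\<lambda>\<omega>. ?J (?J (?J' G)) \<omega> + ?J' (?J (?J' G)) \<omega>) = ?J (?J' (\<lambda>\<omega>. 1 * ?J G \<omega> + 1 * ?J' G \<omega>))"
      unfolding lin2 by (simp add: jucys_murphy_commute[of m "Suc m"])
    also have "\<dots> = ?J (?J' (\<lambda>\<omega>. b * G \<omega> + 0 * G \<omega>))" using that by (simp add: S_def S0_def)
    also have "\<dots> = (\<lambda>\<omega>. b * ?J (?J' G) \<omega>)" unfolding lin2 by simp
    finally have "?J (?J' G) \<in> S0" using that act_jucys_murphy_pair[of m G]
      by (auto simp: S_def S0_def s_def fun_eq_iff intro!: supported_jucys_murphy)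
    then show ?thesis using that by (auto simp: S_def intro!: closed)
  qed
  have "\<exists>H\<in>S m c. \<exists>e. H \<noteq> (\<lambda>_. 0) \<and> ?J (?J' H) = (\<lambda>x. e * H x)"
    by (rule eigenvector_in_subspace[OF fin]) (use supp lin step2 G lin2 in \<open>auto 0 3\<close>)
  then obtain H e where H: "H \<in> S m c" "H \<noteq> (\<lambda>_. 0)" "?J (?J' H) = (\<lambda>x. e * H x)" by auto
  then show ?thesis using that[of H c e] by (auto simp: S_def S0_def)
qed

text \<open>The contents are integers that differ by at least 2; the larger of them takes the role
  of \<open>c (n - 2)\<close> in \<open>two_ends_value\<close>.\<close>

lemma joint_eigen_pair_value:
  assumes n: "n = Suc (Suc m)" and G: "joint_eigen n G c" "joint_eigen n G' c'"
    and eq: "\<And>k. k < m \<Longrightarrow> c k = c' k" "c m = x" "c (Suc m) = y" "c' m = y" "c' (Suc m) = x"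
    and ne: "x \<noteq> y + 1" "y \<noteq> x + 1"
  shows "\<exists>z\<in>one_cup_values n. 1 - x - y = of_int z"
proof -
  interpret C: int_content_set n "int_contents n" by (rule int_content_set_contents)
  obtain z where z: "\<And>k. k < n \<Longrightarrow> c k = of_int (z k)" "z \<in> int_contents n" using joint_eigen_int[OF G(1)] by auto
  obtain z' where z': "\<And>k. k < n \<Longrightarrow> c' k = of_int (z' k)" "z' \<in> int_contents n" using joint_eigen_int[OF G(2)] by auto
  have xy: "x = of_int (z m)" "y = of_int (z (Suc m))" "y = of_int (z' m)" "x = of_int (z' (Suc m))"
    using z(1)[of m] z(1)[of "Suc m"] z'(1)[of m] z'(1)[of "Suc m"] eq n by auto
  then have z'': "z' m = z (Suc m)" "z' (Suc m) = z m" by auto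
  have same: "z' k = z k" if "k < m" for k
    using z(1)[of k] z'(1)[of k] eq(1)[of k] that n by auto
  have "z m \<noteq> z (Suc m)" using C.neighbours[OF z(2)] n by auto
  moreover have "z m \<noteq> z (Suc m) + 1" "z (Suc m) \<noteq> z m + 1" using ne xy(1,2) by auto
  ultimately consider "z (Suc m) + 1 < z m" | "z m + 1 < z (Suc m)" by linarith
  then have "1 - z m - z (Suc m) \<in> one_cup_values n"
  proof cases
    case 1
    then show ?thesis using C.two_ends_value[of z z'] z(2) z'(2) n z'' same by auto
  next
    case 2
    then have "1 - z (Suc m) - z m \<in> one_cup_values n"
      using C.two_ends_value[of z' z] z(2) z'(2) n z'' same by auto
    then show ?thesis by (simp add: algebra_simps)
  qed
  then show ?thesis using xy(1,2) by (intro bexI[of _ "1 - z m - z (Suc m)"]) auto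
qed

lemma joint_eigen_ascending_value:
  assumes n: "n = Suc (Suc m)" and G: "joint_eigen n G c" "c (Suc m) = c m + 1"
  shows "\<exists>z\<in>one_cup_values n. 1 - c m - c (Suc m) = of_int z"
proof -
  interpret C: int_content_set n "int_contents n" by (rule int_content_set_contents)
  obtain z where z: "\<And>k. k < n \<Longrightarrow> c k = of_int (z k)" "z \<in> int_contents n" using joint_eigen_int[OF G(1)] by auto
  have zz: "c m = of_int (z m)" "c (Suc m) = of_int (z (Suc m))" using z(1) n by auto
  have "of_int (z (Suc m)) = (of_int (z m + 1) :: complex)" using G(2) zz by simp
  then have "z (Suc m) = z m + 1" by (simp only: of_int_eq_iff)
  then have "- 2 * z m \<in> one_cup_values n" using C.ascending_end_value[of z] z(2) n by auto
  moreover have "1 - c m - c (Suc m) = of_int (- 2 * z m)" unfolding G(2) zz(1) by simp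
  ultimately show ?thesis by blast
qed

text \<open>Sum and product of the last two Jucys-Murphy elements act on \<open>F\<close> by
  \<open>b\<close> and \<open>e\<close>; \<open>x\<close> and \<open>y\<close> are the roots of the
  quadratic polynomial with these coefficients. Subtracting one root, as in \<open>H\<close>, leaves
  an eigenvector for the other. If this vector is 0, then \<open>F\<close> is already a joint
  eigenvector, and being fixed by \<open>s\<close> it has contents ascending by 1.\<close>

theorem one_cup_spectrum:
  fixes m :: nat and b :: complex
  defines "s \<equiv> transpose m (Suc m)"
  assumes F0: "supported (Suc (Suc m)) F0" "F0 \<noteq> (\<lambda>_. 0)" "act s F0 = F0"
    "\<And>\<omega>. jucys_murphy m F0 \<omega> + jucys_murphy (Suc m) F0 \<omega> = b * F0 \<omega>"
  shows "\<exists>z\<in>one_cup_values (Suc (Suc m)). 1 - b = of_int z"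
proof -
  let ?n = "Suc (Suc m)" and ?J = "jucys_murphy m" and ?J' = "jucys_murphy (Suc m)"
  obtain F c e where F: "supported ?n F" "F \<noteq> (\<lambda>_. 0)" "act s F = F"
    "\<And>\<omega>. ?J F \<omega> + ?J' F \<omega> = b * F \<omega>"
    "\<And>k. k < m \<Longrightarrow> jucys_murphy k F = (\<lambda>\<omega>. c k * F \<omega>)" "?J (?J' F) = (\<lambda>\<omega>. e * F \<omega>)"
    unfolding s_def by (rule one_cup_joint_eigen[OF F0[unfolded s_def]]) blast
  define x where "x = (b + csqrt (b\<^sup>2 - 4 * e)) / 2"
  define y where "y = b - x"
  have xy: "x + y = b" "x * y = e"
  proof -
    have "4 * (x * y) = b\<^sup>2 - (csqrt (b\<^sup>2 - 4 * e))\<^sup>2"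
      unfolding y_def x_def by (simp add: field_simps power2_eq_square)
    then show "x * y = e" by simp
  qed (simp add: y_def)
  have J': "?J' F = (\<lambda>\<omega>. b * F \<omega> - ?J F \<omega>)" using F(4) by (auto simp: fun_eq_iff algebra_simps)
  have JJ: "?J (?J F) = (\<lambda>\<omega>. b * ?J F \<omega> - e * F \<omega>)"
  proof -
    have "?J (?J' F) = (\<lambda>\<omega>. b * ?J F \<omega> - ?J (?J F) \<omega>)"
      using jucys_murphy_lin[of m b F "-1" "?J F"] by (simp add: J')
    from trans[OF F(6)[symmetric] this] show ?thesis by (auto simp: fun_eq_iff algebra_simps)
  qed
  define H where "H t = (\<lambda>\<omega>. ?J F \<omega> - t * F \<omega>)" for t
  have H': "H t = (\<lambda>\<omega>. 1 * ?J F \<omega> + (- t) * F \<omega>)" for t by (simp add: H_def)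
  have H_eigen: "joint_eigen ?n (H t) (c(m := t', Suc m := t))"
    if "t + t' = b" "t * t' = e" "H t \<noteq> (\<lambda>_. 0)" for t t'
    unfolding joint_eigen_def
  proof (intro conjI allI impI)
    show "supported ?n (H t)" unfolding H' using F(1) by (intro supported_lin supported_jucys_murphy) auto
    fix k assume "k < ?n"
    have J: "?J (H t) = (\<lambda>\<omega>. t' * H t \<omega>)"
      unfolding H' jucys_murphy_lin JJ using that(1,2) by (auto simp: fun_eq_iff algebra_simps)
    have J'2: "?J' (H t) = (\<lambda>\<omega>. t * H t \<omega>)"
    proof -
      have "?J' (H t) = (\<lambda>\<omega>. b * H t \<omega> - ?J (H t) \<omega>)"
        unfolding H' jucys_murphy_lin jucys_murphy_commute[of "Suc m" m] F(6) JJ unfolding J'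
        by (auto simp: fun_eq_iff algebra_simps)
      then show ?thesis unfolding J using that(1) by (auto simp: fun_eq_iff algebra_simps)
    qed
    consider "k < m" | "k = m" | "k = Suc m" using \<open>k < ?n\<close> by linarith
    then show "jucys_murphy k (H t) = (\<lambda>\<omega>. (c(m := t', Suc m := t)) k * H t \<omega>)"
    proof cases
      case 1
      have "jucys_murphy k (?J F) = (\<lambda>\<omega>. c k * ?J F \<omega>)"
        unfolding jucys_murphy_commute[of k m] F(5)[OF 1] using jucys_murphy_lin[of m "c k" F 0 F] by simp
      then show ?thesis using 1 unfolding H' jucys_murphy_lin F(5)[OF 1] by (auto simp: algebra_simps fun_eq_iff)
    qed (use J J'2 in auto)
  qed fact
  have asc: ?thesis if "t + t' = b" "H t = (\<lambda>_. 0)" for t t'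
  proof -
    have J: "?J F = (\<lambda>\<omega>. t * F \<omega>)" using that(2) by (auto simp: H_def fun_eq_iff)
    have J'2: "?J' F = (\<lambda>\<omega>. t' * F \<omega>)" using that(1) by (auto simp: J' J fun_eq_iff algebra_simps)
    have eig: "joint_eigen ?n F (c(m := t, Suc m := t'))"
      using F(1,2,5) J J'2 by (auto simp: joint_eigen_def less_Suc_eq)
    have "act s (\<lambda>\<omega>. t * F \<omega>) = (\<lambda>\<omega>. ?J' F \<omega> - F \<omega>)"
      using act_jucys_murphy[of m F] F(3) by (simp add: J s_def)
    moreover have "act s (\<lambda>\<omega>. t * F \<omega>) = (\<lambda>\<omega>. t * act s F \<omega>)" by (simp add: act_def)
    ultimately have "t * F \<omega> = t' * F \<omega> - F \<omega>" for \<omega> using F(3) J'2 by (simp add: fun_eq_iff)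
    moreover obtain \<omega> where "F \<omega> \<noteq> 0" using F(2) by auto
    ultimately have "(t' - (t + 1)) * F \<omega> = 0" "F \<omega> \<noteq> 0" by (auto simp: algebra_simps)
    then have "t' = t + 1" by simp
    then have "\<exists>z\<in>one_cup_values ?n. 1 - t - t' = of_int z"
      using joint_eigen_ascending_value[OF refl eig] by simp
    then show ?thesis unfolding that(1)[symmetric] by (simp add: diff_diff_eq)
  qed
  show ?thesis
  proof (cases "H x = (\<lambda>_. 0) \<or> H y = (\<lambda>_. 0)")
    case True
    then show ?thesis using asc[of x y] asc[of y x] xy by (auto simp: add.commute)
  next
    case False
    then have eig: "joint_eigen ?n (H y) (c(m := x, Suc m := y))" "joint_eigen ?n (H x) (c(m := y, Suc m := x))"
      using H_eigen[of y x] H_eigen[of x y] xy by (auto simp: add.commute mult.commute)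
    have diff: "act s (\<lambda>\<omega>. H y \<omega> - H x \<omega>) = (\<lambda>\<omega>. H y \<omega> - H x \<omega>)"
    proof -
      have "(\<lambda>\<omega>. H y \<omega> - H x \<omega>) = (\<lambda>\<omega>. (x - y) * F \<omega>)" by (auto simp: H_def algebra_simps fun_eq_iff)
      moreover have "act s (\<lambda>\<omega>. (x - y) * F \<omega>) = (\<lambda>\<omega>. (x - y) * act s F \<omega>)" by (simp add: act_def)
      ultimately show ?thesis using F(3) by simp
    qed
    have act_diff: "act s (\<lambda>\<omega>. H y \<omega> - H x \<omega>) = (\<lambda>\<omega>. act s (H y) \<omega> - act s (H x) \<omega>)" by (simp add: act_def)
    \<comment> \<open>For adjacent contents \<open>s\<close> would act on \<open>H y\<close> and
      \<open>H x\<close> by opposite signs, whereas their difference is a multiple of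
      \<open>F\<close> and thus fixed by \<open>s\<close>.\<close>
    have "x \<noteq> y + 1"
    proof
      assume "x = y + 1"
      then have "act s (H y) = (\<lambda>\<omega>. - 1 * H y \<omega>)" "act s (H x) = (\<lambda>\<omega>. 1 * H x \<omega>)"
        using joint_eigen_adjacent[OF eig(1), of m "- 1"] joint_eigen_adjacent[OF eig(2), of m 1] by (simp_all add: s_def)
      with diff act_diff have "H y = (\<lambda>_. 0)" by (auto simp: fun_eq_iff)
      then show False using False by simp
    qed
    moreover have "y \<noteq> x + 1"
    proof
      assume "y = x + 1"
      then have "act s (H y) = (\<lambda>\<omega>. 1 * H y \<omega>)" "act s (H x) = (\<lambda>\<omega>. - 1 * H x \<omega>)"
        using joint_eigen_adjacent[OF eig(1), of m 1] joint_eigen_adjacent[OF eig(2), of m "- 1"] by (simp_all add: s_def)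
      with diff act_diff have "H x = (\<lambda>_. 0)" by (auto simp: fun_eq_iff)
      then show False using False by simp
    qed
    ultimately have "\<exists>z\<in>one_cup_values ?n. 1 - x - y = of_int z"
      by (intro joint_eigen_pair_value[OF refl eig]) auto
    then show ?thesis unfolding xy(1)[symmetric] by (simp add: diff_diff_eq)
  qed
qed

section \<open>Harmonic vectors\<close>

text \<open>A perfect matching of \<open>S\<close> is encoded as the involution that exchanges the two ends of each pair.\<close>

definition matchings :: "'a set \<Rightarrow> ('a \<Rightarrow> 'a) set" where
  "matchings S = {d. (\<forall>x\<in>S. d x \<in> S \<and> d x \<noteq> x \<and> d (d x) = x) \<and> (\<forall>x. x \<notin> S \<longrightarrow> d x = x)}"

definition upward_matchings :: "'a set \<Rightarrow> 'a set \<Rightarrow> ('a \<Rightarrow> 'a) set" where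
  "upward_matchings T B = {d \<in> matchings (T \<union> B). \<forall>x\<in>T. d x \<in> B}"

definition add_pair :: "'a \<Rightarrow> 'a \<Rightarrow> ('a \<Rightarrow> 'a) \<Rightarrow> 'a \<Rightarrow> 'a" where
  "add_pair i j d = d(i := j, j := i)"

text \<open>Cuts the pair \<open>{a, d a}\<close> and joins its ends to \<open>i\<close> and
  \<open>j\<close>. As \<open>a\<close> varies, these are exactly the diagrams that the cap on
  \<open>i, j\<close> turns into \<open>d\<close> without closing a loop.\<close>

definition reconnect :: "'a \<Rightarrow> 'a \<Rightarrow> 'a \<Rightarrow> ('a \<Rightarrow> 'a) \<Rightarrow> 'a \<Rightarrow> 'a" where
  "reconnect i j a d = d(i := a, a := i, j := d a, d a := j)"

text \<open>The coefficient of \<open>d\<close> in the image of the linear combination \<open>v\<close> of diagrams under the cap that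
  joins \<open>i\<close> and \<open>j\<close>.\<close>

definition cap_coeff :: "complex \<Rightarrow> 'a set \<Rightarrow> 'a \<Rightarrow> 'a \<Rightarrow> (('a \<Rightarrow> 'a) \<Rightarrow> complex) \<Rightarrow> ('a \<Rightarrow> 'a) \<Rightarrow> complex" where
  "cap_coeff \<delta> S i j v d = \<delta> * v (add_pair i j d) + (\<Sum>a\<in>S - {i, j}. v (reconnect i j a d))"

text \<open>A cap may also join two strands that end in tops. Such results are dropped, as in the
  quotient by diagrams with a pair of tops, so only coefficients of upward \<open>d\<close> are
  tested.\<close>

definition harmonic :: "complex \<Rightarrow> 'a set \<Rightarrow> 'a set \<Rightarrow> (('a \<Rightarrow> 'a) \<Rightarrow> complex) \<Rightarrow> bool" where
  "harmonic \<delta> T B v \<longleftrightarrow> (\<forall>i\<in>B. \<forall>j\<in>B. i \<noteq> j \<longrightarrow>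
     (\<forall>d\<in>upward_matchings T (B - {i, j}). cap_coeff \<delta> (T \<union> B) i j v d = 0))"

definition has_harmonic :: "complex \<Rightarrow> 'a set \<Rightarrow> 'a set \<Rightarrow> bool" where
  "has_harmonic \<delta> T B \<longleftrightarrow> (\<exists>v. harmonic \<delta> T B v \<and> (\<exists>d\<in>upward_matchings T B. v d \<noteq> 0))"

lemma matchingsD:
  assumes "d \<in> matchings S"
  shows "x \<in> S \<Longrightarrow> d x \<in> S" "x \<in> S \<Longrightarrow> d x \<noteq> x" "d (d x) = x" "x \<notin> S \<Longrightarrow> d x = x"
  using assms by (auto simp: matchings_def)

lemma matchings_eq_iff: "d \<in> matchings S \<Longrightarrow> d x = d y \<longleftrightarrow> x = y"
  by (metis matchingsD(3))

lemma matchings_permutes: "d \<in> matchings S \<Longrightarrow> d permutes S"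
  unfolding permutes_def by (metis matchingsD(3,4))

lemma finite_matchings: "finite S \<Longrightarrow> finite (matchings S)"
  by (rule finite_subset[of _ "{d. d permutes S}"]) (auto simp: matchings_permutes finite_permutations)

lemma finite_upward_matchings: "finite T \<Longrightarrow> finite B \<Longrightarrow> finite (upward_matchings T B)"
  by (simp add: upward_matchings_def finite_matchings)

lemma upward_matchingsD:
  assumes "d \<in> upward_matchings T B"
  shows "d \<in> matchings (T \<union> B)" "x \<in> T \<Longrightarrow> d x \<in> B"
  using assms by (auto simp: upward_matchings_def)

lemma matchings_add_pair:
  assumes "d \<in> matchings (S - {i, j})" "i \<in> S" "j \<in> S" "i \<noteq> j"
  shows "add_pair i j d \<in> matchings S"
  using assms matchingsD[OF assms(1)] by (auto simp: matchings_def add_pair_def)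

lemma matchings_reconnect:
  assumes d: "d \<in> matchings (S - {i, j})" and ij: "i \<in> S" "j \<in> S" "i \<noteq> j" and a: "a \<in> S - {i, j}"
  shows "reconnect i j a d \<in> matchings S"
proof -
  note D = matchingsD[OF d]
  have da: "d a \<in> S - {i, j}" "d a \<noteq> a" "d (d a) = a" using D a by auto
  have out: "d i = i" "d j = j" using D(4) by auto
  have ne: "d x \<noteq> a" "d x \<noteq> d a" "d x \<noteq> i" "d x \<noteq> j" if "x \<in> S" "x \<noteq> i" "x \<noteq> j" "x \<noteq> a" "x \<noteq> d a" for x
    using D(1)[of x] D(3)[of x] da(3) that by auto
  let ?r = "reconnect i j a d"
  have dist: "a \<noteq> i" "a \<noteq> j" "d a \<noteq> i" "d a \<noteq> j" "a \<in> S" "d a \<in> S" using a da by auto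
  have vals: "?r i = a" "?r a = i" "?r j = d a" "?r (d a) = j"
    "\<And>x. x \<noteq> i \<Longrightarrow> x \<noteq> j \<Longrightarrow> x \<noteq> a \<Longrightarrow> x \<noteq> d a \<Longrightarrow> ?r x = d x"
    using dist da(2) ij(3) by (simp_all add: reconnect_def)
  have "?r x \<in> S \<and> ?r x \<noteq> x \<and> ?r (?r x) = x" if x: "x \<in> S" for x
  proof (cases "x = i \<or> x = j \<or> x = a \<or> x = d a")
    case True
    then show ?thesis using vals(1-4) dist da(2) ij by (elim disjE) simp_all
  next
    case False
    then have n: "x \<noteq> i" "x \<noteq> j" "x \<noteq> a" "x \<noteq> d a" by auto
    have "?r x = d x" "?r (d x) = d (d x)"
      using vals(5)[OF n] vals(5)[OF ne(3,4,1,2)[OF x n]] by simp_all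
    then show ?thesis using D(1)[of x] D(2)[of x] D(3)[of x] x n by simp
  qed
  moreover have "?r x = x" if x: "x \<notin> S" for x
    using vals(5)[of x] x dist ij D(4)[of x] by auto
  ultimately show ?thesis by (simp add: matchings_def)
qed

lemma upward_add_pair:
  assumes "d \<in> upward_matchings T (B - {i, j})" "i \<in> B" "j \<in> B" "i \<noteq> j" "T \<inter> B = {}"
  shows "add_pair i j d \<in> upward_matchings T B"
proof -
  have eq: "T \<union> (B - {i, j}) = T \<union> B - {i, j}" using assms by auto
  have "add_pair i j d \<in> matchings (T \<union> B)"
    using matchings_add_pair[of d "T \<union> B" i j] assms upward_matchingsD(1)[OF assms(1)] by (simp add: eq)
  then show ?thesis using assms upward_matchingsD(2)[OF assms(1)]
    by (auto simp: upward_matchings_def add_pair_def)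
qed

lemma upward_reconnect:
  assumes d: "d \<in> upward_matchings T (B - {i, j})" and ij: "i \<in> B" "j \<in> B" "i \<noteq> j" and TB: "T \<inter> B = {}"
    and a: "a \<in> T \<union> B - {i, j}"
  shows "reconnect i j a d \<in> upward_matchings T B"
proof -
  have eq: "T \<union> (B - {i, j}) = T \<union> B - {i, j}" using ij TB by auto
  have "reconnect i j a d \<in> matchings (T \<union> B)"
    using matchings_reconnect[of d "T \<union> B" i j a] ij a upward_matchingsD(1)[OF d] by (simp add: eq)
  then show ?thesis using ij TB upward_matchingsD(2)[OF d]
    by (auto simp: upward_matchings_def reconnect_def)
qed

text \<open>The set of all points, and with it each sum in \<open>cap_coeff\<close>, stays the same.
  Conditions are only lost: fewer caps are available and fewer diagrams are upward.\<close>

lemma harmonic_bend: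
  assumes "harmonic \<delta> T B v" "z \<in> B"
  shows "harmonic \<delta> (insert z T) (B - {z}) v"
proof -
  have 1: "upward_matchings (insert z T) (B - {z} - {i, j}) \<subseteq> upward_matchings T (B - {i, j})"
    if "i \<in> B - {z}" "j \<in> B - {z}" for i j
  proof -
    have "insert z T \<union> (B - {z} - {i, j}) = T \<union> (B - {i, j})" using assms(2) that by auto
    then show ?thesis by (auto simp: upward_matchings_def)
  qed
  have 2: "insert z T \<union> (B - {z}) = T \<union> B" using assms(2) by auto
  show ?thesis unfolding harmonic_def 2 using assms(1) 1 unfolding harmonic_def by blast
qed

lemma upward_ex_cup:
  assumes d: "d \<in> upward_matchings T B" and "finite T" and "card T < card B" and TB: "T \<inter> B = {}"
  shows "\<exists>x\<in>B. d x \<in> B"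
proof (rule ccontr)
  assume "\<not> ?thesis"
  then have "d ` B \<subseteq> T" using matchingsD(1)[OF upward_matchingsD(1)[OF d]] by auto
  moreover have "inj_on d B" using matchings_eq_iff[OF upward_matchingsD(1)[OF d]] by (auto simp: inj_on_def)
  ultimately show False using card_inj_on_le[of d B T] assms by auto
qed

text \<open>The danger is that the bent vector vanishes on all upward diagrams. Taking
  \<open>z\<close> as an end of a cup of some \<open>d\<close> with \<open>v d \<noteq> 0\<close>
  avoids it, since \<open>d\<close> then remains upward.\<close>

lemma has_harmonic_bend:
  assumes h: "has_harmonic \<delta> T B" and fin: "finite T" and c: "card T < card B" and TB: "T \<inter> B = {}"
  obtains z where "z \<in> B" "has_harmonic \<delta> (insert z T) (B - {z})"
proof -
  obtain v d where v: "harmonic \<delta> T B v" "d \<in> upward_matchings T B" "v d \<noteq> 0"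
    using h by (auto simp: has_harmonic_def)
  obtain z where z: "z \<in> B" "d z \<in> B" using upward_ex_cup[OF v(2) fin c TB] by auto
  note D = matchingsD[OF upward_matchingsD(1)[OF v(2)]]
  have eq: "insert z T \<union> (B - {z}) = T \<union> B" using z by auto
  have "d \<in> upward_matchings (insert z T) (B - {z})"
    unfolding upward_matchings_def eq
    using v(2) z D(2)[of z] D(3) TB by (auto simp: upward_matchings_def)
  then show ?thesis using that[of z] z(1) harmonic_bend[OF v(1) z(1)] v(3) by (auto simp: has_harmonic_def)
qed

text \<open>Each bend moves one bottom point to the top and so uses up one cup; \<open>k\<close>
  bends leave a single cup.\<close>

lemma has_harmonic_one_cup:
  fixes T B :: "'a set"
  assumes "has_harmonic \<delta> T B" "finite T" "finite B" "T \<inter> B = {}" "card B = card T + 2 * Suc k"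
  shows "\<exists>T' B' :: 'a set. has_harmonic \<delta> T' B' \<and> finite T' \<and> finite B' \<and> T' \<inter> B' = {} \<and>
    card B' = card T' + 2 \<and> card B' = card B - k"
  using assms
proof (induction k arbitrary: T B)
  case 0
  then have "has_harmonic \<delta> T B \<and> finite T \<and> finite B \<and> T \<inter> B = {} \<and> card B = card T + 2 \<and> card B = card B - 0"
    by simp
  then show ?case by blast
next
  case (Suc k)
  have less: "card T < card B" using Suc.prems by simp
  obtain z where z: "z \<in> B" "has_harmonic \<delta> (insert z T) (B - {z})"
    by (rule has_harmonic_bend[OF Suc.prems(1,2) less Suc.prems(4)])
  have "z \<notin> T" using z Suc.prems by auto
  have card: "card (insert z T) = Suc (card T)" "card (B - {z}) = card B - 1"
    using z Suc.prems \<open>z \<notin> T\<close> by auto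
  have "card (B - {z}) = card (insert z T) + 2 * Suc k" unfolding card using Suc.prems by simp
  from Suc.IH[OF z(2) _ _ _ this] Suc.prems have "\<exists>T' B' :: 'a set. has_harmonic \<delta> T' B' \<and> finite T' \<and> finite B' \<and>
    T' \<inter> B' = {} \<and> card B' = card T' + 2 \<and> card B' = card (B - {z}) - k" by auto
  then show ?case by (simp add: card)
qed

text \<open>Exactly two bottom points are not joined to tops, and they can only be joined to each
  other.\<close>

lemma upward_one_cup_unique:
  assumes d: "d \<in> upward_matchings T B" and d': "d' \<in> upward_matchings T B"
    and fin: "finite T" "finite B" and TB: "T \<inter> B = {}" and c: "card B = card T + 2"
    and eq: "\<And>x. x \<in> T \<Longrightarrow> d x = d' x"
  shows "d = d'"
proof
  fix x
  note D = matchingsD[OF upward_matchingsD(1)[OF d]] and D' = matchingsD[OF upward_matchingsD(1)[OF d']]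
  have dT: "d ` T \<subseteq> B" using upward_matchingsD(2)[OF d] by auto
  have "inj_on d T" using matchings_eq_iff[OF upward_matchingsD(1)[OF d]] by (auto simp: inj_on_def)
  then have "card (B - d ` T) = 2" using dT fin c by (simp add: card_Diff_subset card_image)
  then obtain p q where pq: "B - d ` T = {p, q}" "p \<noteq> q" by (auto simp: card_2_iff)
  have d'T: "d' ` T = d ` T" using eq by auto
  have in_pq: "d y \<in> {p, q} \<and> d' y \<in> {p, q}" if "y \<in> {p, q}" for y
  proof -
    have y: "y \<in> B" "y \<notin> d ` T" using that pq by auto
    have "d y \<notin> T" using y D(3)[of y] by (metis imageI)
    moreover have "d' y \<notin> T" using y d'T D'(3)[of y] by (metis imageI)
    moreover have "d y \<notin> d ` T" using y TB D(3) by (metis disjoint_iff imageE)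
    moreover have "d' y \<notin> d' ` T" using y TB D'(3) by (metis disjoint_iff imageE)
    ultimately show ?thesis using D(1)[of y] D'(1)[of y] y pq d'T by auto
  qed
  consider "x \<in> T" | "x \<in> d ` T" | "x \<in> {p, q}" | "x \<notin> T \<union> B" using pq by blast
  then show "d x = d' x"
  proof cases
    case 1
    then show ?thesis using eq by simp
  next
    case 2
    then obtain y where "y \<in> T" "x = d y" by auto
    then show ?thesis using eq[of y] D(3) D'(3) by metis
  next
    case 3
    then show ?thesis using in_pq[of x] pq(1) D(2)[of x] D'(2)[of x] by auto
  next
    case 4
    then show ?thesis using D(4) D'(4) by metis
  qed
qed

text \<open>The extra \<open>f\<close> will be the summand of the last Jucys-Murphy element that
  comes from the last simple transposition, which fixes the vector.\<close>

lemma shift_eigenvalue: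
  fixes a b f \<delta> :: complex
  assumes "\<delta> * f + (a + b) = 0"
  shows "a + (b + f) = (1 - \<delta>) * f"
proof -
  have "a + b = - (\<delta> * f)" using assms by (rule add_eq_0_iff[THEN iffD1])
  then have "(a + b) + f = f - \<delta> * f" by simp
  then show ?thesis by (simp only: left_diff_distrib add.assoc mult_1)
qed

text \<open>A diagram with one cup is a permutation up to the order of its last two letters: the
  first \<open>m\<close> letters are the partners of the tops, the last two are the ends of the cup.
  Removing this cup and reconnecting at \<open>t l\<close> or at its partner
  \<open>b (\<omega> l)\<close> realises the transposition of \<open>l\<close> with \<open>m\<close>
  or with \<open>Suc m\<close>. Hence the cap condition at the cup of \<open>D \<omega>\<close> is
  the eigenvalue equation for the sum of the last two Jucys-Murphy elements.\<close>

theorem has_harmonic_one_cup_value: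
  fixes T B :: "'a set"
  assumes h: "has_harmonic \<delta> T B" and fin: "finite T" "finite B" and TB: "T \<inter> B = {}"
    and c: "card B = card T + 2"
  shows "\<exists>z\<in>one_cup_values (card B). \<delta> = of_int z"
proof -
  define m where "m = card T"
  let ?n = "Suc (Suc m)"
  have n: "card B = ?n" using c by (simp add: m_def)
  obtain t where t: "bij_betw t {..<m} T" using ex_bij_betw_nat_finite[OF fin(1)] by (auto simp: m_def atLeast0LessThan)
  obtain b where b: "bij_betw b {..<?n} B" using ex_bij_betw_nat_finite[OF fin(2)] n by (auto simp: atLeast0LessThan)
  define ti where "ti = inv_into {..<m} t"
  define bi where "bi = inv_into {..<?n} b"
  have tT: "t l \<in> T" "ti (t l) = l" if "l < m" for l
    using t that unfolding ti_def by (auto simp: bij_betw_def)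
  have Tt: "\<exists>l<m. x = t l" if "x \<in> T" for x using t that by (auto simp: bij_betw_def)
  have bB: "b l \<in> B" "bi (b l) = l" if "l < ?n" for l
    using b that unfolding bi_def by (auto simp: bij_betw_def)
  have Bb: "\<exists>l<?n. x = b l" if "x \<in> B" for x using b that by (auto simp: bij_betw_def)
  have biB: "bi x < ?n" "b (bi x) = x" if "x \<in> B" for x using Bb[OF that] bB by auto
  define D where "D \<omega> x = (if x \<in> T then b (\<omega> (ti x)) else if x \<in> B then
      (let l = inv_into UNIV \<omega> (bi x) in if l < m then t l else if l = m then b (\<omega> (Suc m)) else b (\<omega> m)) else x)"
    for \<omega> :: "nat \<Rightarrow> nat" and x
  have perm: "\<omega> l < ?n" "inv_into UNIV \<omega> (\<omega> l) = l" if "\<omega> permutes {..<?n}" "l < ?n" for \<omega> l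
    using permutes_in_image[OF that(1), of l] that permutes_inverses(2)[OF that(1)] by auto
  have DT: "D \<omega> (t l) = b (\<omega> l)" if "l < m" for \<omega> l using that tT by (simp add: D_def)
  have DB: "D \<omega> (b (\<omega> l)) = (if l < m then t l else if l = m then b (\<omega> (Suc m)) else b (\<omega> m))"
    if "\<omega> permutes {..<?n}" "l < ?n" for \<omega> l
  proof -
    have "b (\<omega> l) \<in> B" "bi (b (\<omega> l)) = \<omega> l" using perm(1)[OF that] bB[of "\<omega> l"] by simp_all
    moreover from this TB have "b (\<omega> l) \<notin> T" by blast
    ultimately show ?thesis using perm(2)[OF that] by (simp add: D_def)
  qed
  have Bbw: "\<exists>l<?n. x = b (\<omega> l)" if x: "x \<in> B" and w: "\<omega> permutes {..<?n}" for x \<omega>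
  proof -
    obtain l where l: "l < ?n" "x = b l" using Bb[OF x] by auto
    then have "inv_into UNIV \<omega> l < ?n" using permutes_in_image[OF permutes_inv[OF w], of l] by simp
    moreover have "\<omega> (inv_into UNIV \<omega> l) = l" by (rule permutes_inverses(1)[OF w])
    ultimately show ?thesis using l by metis
  qed
  have D_up: "D \<omega> \<in> upward_matchings T B" if w: "\<omega> permutes {..<?n}" for \<omega>
  proof -
    have inj: "b (\<omega> l) = b (\<omega> k) \<longleftrightarrow> l = k" if "l < ?n" "k < ?n" for l k
      using that bB perm[OF w] by metis
    have "D \<omega> x \<in> T \<union> B \<and> D \<omega> x \<noteq> x \<and> D \<omega> (D \<omega> x) = x" if x: "x \<in> T" for x
    proof -
      obtain l where l: "l < m" "x = t l" using Tt[OF x] by auto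
      then show ?thesis using DT[OF l(1), of \<omega>] DB[OF w, of l] bB[of "\<omega> l"] perm[OF w, of l] x TB by auto
    qed
    moreover have "D \<omega> x \<in> T \<union> B \<and> D \<omega> x \<noteq> x \<and> D \<omega> (D \<omega> x) = x" if x: "x \<in> B" for x
    proof -
      obtain l where l: "l < ?n" "x = b (\<omega> l)" using Bbw[OF x w] by auto
      then consider "l < m" | "l = m" | "l = Suc m" by linarith
      then show ?thesis
      proof cases
        case 1
        then show ?thesis using DB[OF w l(1)] DT[OF 1, of \<omega>] l tT[OF 1] x TB by auto
      qed (use DB[OF w l(1)] DB[OF w, of m] DB[OF w, of "Suc m"] l bB perm[OF w] inj[of m "Suc m"] in auto)
    qed
    moreover have "D \<omega> x \<in> B" if "x \<in> T" for x
      using Tt[OF that] DT bB perm[OF w] by (metis less_SucI)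
    moreover have "D \<omega> x = x" if "x \<notin> T \<union> B" for x using that by (simp add: D_def)
    ultimately show ?thesis unfolding upward_matchings_def matchings_def by blast
  qed
  have D_eq: "d = D \<omega>" if "\<omega> permutes {..<?n}" "d \<in> upward_matchings T B" "\<And>l. l < m \<Longrightarrow> d (t l) = b (\<omega> l)" for \<omega> d
  proof (rule upward_one_cup_unique[OF that(2) D_up[OF that(1)] fin TB c])
    fix x assume "x \<in> T"
    then obtain l where "l < m" "x = t l" using Tt by blast
    then show "d x = D \<omega> x" using DT[of l \<omega>] that(3)[of l] by simp
  qed
  have D_surj: "\<exists>\<omega>. \<omega> permutes {..<?n} \<and> d = D \<omega>" if d: "d \<in> upward_matchings T B" for d
  proof -
    have dT: "d ` T \<subseteq> B" using upward_matchingsD(2)[OF d] by auto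
    have inj: "inj_on d T" using matchings_eq_iff[OF upward_matchingsD(1)[OF d]] by (auto simp: inj_on_def)
    then have "card (B - d ` T) = 2" using dT fin c by (simp add: card_Diff_subset card_image)
    then obtain p q where pq: "B - d ` T = {p, q}" "p \<noteq> q" by (auto simp: card_2_iff)
    \<comment> \<open>The ends \<open>p\<close> and \<open>q\<close> of the cup could be taken in
      either order; \<open>D\<close> does not distinguish them.\<close>
    define \<omega> where "\<omega> l = (if l < m then bi (d (t l)) else if l = m then bi p else if l = Suc m then bi q else l)" for l
    have "{..<?n} \<subseteq> \<omega> ` {..<?n}"
    proof
      fix k assume "k \<in> {..<?n}"
      then have k: "b k \<in> B" "bi (b k) = k" using bB by auto
      consider "b k \<in> d ` T" | "b k = p" | "b k = q" using k pq by auto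
      then show "k \<in> \<omega> ` {..<?n}"
      proof cases
        case 1
        then obtain l where "l < m" "b k = d (t l)" using Tt by auto
        then show ?thesis using k by (intro image_eqI[of _ _ l]) (auto simp: \<omega>_def)
      next
        case 2
        then show ?thesis using k by (intro image_eqI[of _ _ m]) (auto simp: \<omega>_def)
      next
        case 3
        then show ?thesis using k by (intro image_eqI[of _ _ "Suc m"]) (auto simp: \<omega>_def)
      qed
    qed
    moreover have "\<omega> ` {..<?n} \<subseteq> {..<?n}"
    proof -
      have "p \<in> B" "q \<in> B" using pq by auto
      moreover have "d (t l) \<in> B" if "l < m" for l using dT tT(1)[OF that] by auto
      ultimately show ?thesis using biB(1) unfolding \<omega>_def by auto
    qed
    ultimately have "\<omega> ` {..<?n} = {..<?n}" by blast
    then have "bij_betw \<omega> {..<?n} {..<?n}" by (metis bij_betw_def eq_card_imp_inj_on finite_lessThan)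
    then have w: "\<omega> permutes {..<?n}" by (rule bij_imp_permutes) (auto simp: \<omega>_def)
    have "d (t l) = b (\<omega> l)" if "l < m" for l
      using biB(2)[of "d (t l)"] dT tT(1)[OF that] that by (auto simp: \<omega>_def)
    then show ?thesis using D_eq[OF w d] w by blast
  qed
  obtain v d0 where v: "harmonic \<delta> T B v" "d0 \<in> upward_matchings T B" "v d0 \<noteq> 0"
    using h by (auto simp: has_harmonic_def)
  define F where "F \<omega> = (if \<omega> permutes {..<?n} then v (D \<omega>) else 0)" for \<omega>
  let ?s = "transpose m (Suc m)"
  have tr: "\<omega> \<circ> transpose l k permutes {..<?n}" if "\<omega> permutes {..<?n}" "l < ?n" "k < ?n" for \<omega> l k
    using permutes_compose[OF transpose_permutes[OF that(2,3)] that(1)] .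
  have "supported ?n F" by (simp add: supported_def F_def)
  moreover have "F \<noteq> (\<lambda>_. 0)"
  proof -
    obtain \<omega> where "\<omega> permutes {..<?n}" "d0 = D \<omega>" using D_surj[OF v(2)] by auto
    then have "F \<omega> \<noteq> 0" using v(3) by (simp add: F_def)
    then show ?thesis by auto
  qed
  moreover have sF: "act ?s F = F"
  proof
    fix \<omega>
    have "v (D (\<omega> \<circ> ?s)) = v (D \<omega>)" if w: "\<omega> permutes {..<?n}"
    proof -
      have "D (\<omega> \<circ> ?s) = D \<omega>"
      proof (rule D_eq[OF w])
        have "\<omega> \<circ> ?s permutes {..<?n}" by (rule tr[OF w]) auto
        then show "D (\<omega> \<circ> ?s) \<in> upward_matchings T B" by (rule D_up)
        show "D (\<omega> \<circ> ?s) (t l) = b (\<omega> l)" if "l < m" for l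
          unfolding DT[OF that] using that by (simp add: transpose_def)
      qed
      then show ?thesis by simp
    qed
    then show "act ?s F \<omega> = F \<omega>"
      using permutes_comp_iff[OF transpose_permutes, of m ?n "Suc m" \<omega>] by (simp add: act_def F_def)
  qed
  moreover have "jucys_murphy m F \<omega> + jucys_murphy (Suc m) F \<omega> = (1 - \<delta>) * F \<omega>" for \<omega>
  proof (cases "\<omega> permutes {..<?n}")
    case w: True
    let ?i = "b (\<omega> m)" and ?j = "b (\<omega> (Suc m))"
    \<comment> \<open>\<open>D \<omega>\<close> without its cup; the cap on \<open>?i, ?j\<close> is
      evaluated at this diagram.\<close>
    let ?d = "(D \<omega>)(?i := ?i, ?j := ?j)"
    note up = D_up[OF w]
    note M = matchingsD[OF upward_matchingsD(1)[OF up]]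
    have ij: "?i \<in> B" "?j \<in> B" "?i \<noteq> ?j" "D \<omega> ?i = ?j" "D \<omega> ?j = ?i"
      using bB perm[OF w] DB[OF w, of m] DB[OF w, of "Suc m"] M(2)[of ?i] by auto
    have d: "?d \<in> upward_matchings T (B - {?i, ?j})"
      unfolding upward_matchings_def matchings_def
    proof (intro CollectI conjI ballI allI impI)
      fix x assume "x \<in> T \<union> (B - {?i, ?j})"
      then have x: "x \<in> T \<union> B" "x \<noteq> ?i" "x \<noteq> ?j" using TB ij by auto
      then have "D \<omega> x \<noteq> ?i" "D \<omega> x \<noteq> ?j" using ij M(3) by metis+
      then show "?d x \<in> T \<union> (B - {?i, ?j})" "?d x \<noteq> x" "?d (?d x) = x" using M(1-3)[of x] x by auto
    next
      fix x assume "x \<notin> T \<union> (B - {?i, ?j})"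
      then show "?d x = x" using M(4)[of x] by auto
    next
      fix x assume x: "x \<in> T"
      then have x: "x \<in> T" "x \<noteq> ?i" "x \<noteq> ?j" using TB ij by auto
      then have "D \<omega> x \<noteq> ?i" "D \<omega> x \<noteq> ?j" using ij M(3) by metis+
      then show "?d x \<in> B - {?i, ?j}" using upward_matchingsD(2)[OF up x(1)] x by auto
    qed
    have add: "add_pair ?i ?j ?d = D \<omega>" using ij by (auto simp: add_pair_def fun_eq_iff)
    have ne: "b (\<omega> l) \<noteq> ?i" "b (\<omega> l) \<noteq> ?j" "t l \<noteq> ?i" "t l \<noteq> ?j" if "l < m" for l
    proof -
      show "b (\<omega> l) \<noteq> ?i" "b (\<omega> l) \<noteq> ?j"
        using that bB(2) perm[OF w] by (metis less_SucI less_irrefl lessI not_less_eq)+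
      show "t l \<noteq> ?i" "t l \<noteq> ?j" using ij TB tT(1)[OF that] by auto
    qed
    have dt: "?d (t l) = b (\<omega> l)" "?d (b (\<omega> l)) = t l" if "l < m" for l
      using ne[OF that] DT[OF that] DB[OF w, of l] that by auto
    have tinj: "t k = t l \<longleftrightarrow> k = l" if "k < m" "l < m" for k l using tT(2) that by metis
    have binj: "b (\<omega> k) = b (\<omega> l) \<longleftrightarrow> k = l" if "k < m" "l < m" for k l
      using dt(2) tinj that by metis
    have bt: "b (\<omega> k) \<noteq> t l" if "k < m" "l < m" for k l using bB(1)[of "\<omega> k"] perm(1)[OF w, of k] tT(1)[of l] that TB by auto
    have r1: "reconnect ?i ?j (t l) ?d = D (\<omega> \<circ> transpose l m)" if l: "l < m" for l
    proof (rule D_eq)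
      show "\<omega> \<circ> transpose l (m) permutes {..<?n}" using l by (intro tr[OF w]) auto
      show "reconnect ?i ?j (t l) ?d \<in> upward_matchings T B"
        using l tT ne bB perm[OF w] by (intro upward_reconnect[OF d ij(1-3) TB]) auto
      show "reconnect ?i ?j (t l) ?d (t k) = b ((\<omega> \<circ> transpose l m) k)" if "k < m" for k
        unfolding reconnect_def dt[OF l]
        using ne[OF l] ne[OF that] dt[OF that] bt[OF l that] bt[OF l l] tinj[OF l that] that by (auto simp: transpose_def)
    qed
    have r2: "reconnect ?i ?j (b (\<omega> l)) ?d = D (\<omega> \<circ> transpose l (Suc m))" if l: "l < m" for l
    proof (rule D_eq)
      show "\<omega> \<circ> transpose l (Suc m) permutes {..<?n}" using l by (intro tr[OF w]) auto
      show "reconnect ?i ?j (b (\<omega> l)) ?d \<in> upward_matchings T B"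
        using l tT ne bB perm[OF w] by (intro upward_reconnect[OF d ij(1-3) TB]) auto
      show "reconnect ?i ?j (b (\<omega> l)) ?d (t k) = b ((\<omega> \<circ> transpose l (Suc m)) k)" if "k < m" for k
        unfolding reconnect_def dt[OF l]
        using ne[OF l] ne[OF that] dt[OF that] bt[OF l that] tinj[OF l that] that by (auto simp: transpose_def)
    qed
    have "T \<union> B - {?i, ?j} = t ` {..<m} \<union> (\<lambda>l. b (\<omega> l)) ` {..<m}"
    proof (intro equalityI subsetI)
      fix x assume x: "x \<in> T \<union> B - {?i, ?j}"
      show "x \<in> t ` {..<m} \<union> (\<lambda>l. b (\<omega> l)) ` {..<m}"
      proof (cases "x \<in> T")
        case True
        then obtain l where "l < m" "x = t l" using Tt by blast
        then show ?thesis by simp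
      next
        case False
        then obtain l where l: "l < ?n" "x = b (\<omega> l)" using Bbw[of x \<omega>] x w by auto
        then have "l \<noteq> m" "l \<noteq> Suc m" using x by auto
        then show ?thesis using l by simp
      qed
    next
      fix x assume "x \<in> t ` {..<m} \<union> (\<lambda>l. b (\<omega> l)) ` {..<m}"
      then obtain l where l: "l < m" "x = t l \<or> x = b (\<omega> l)" by auto
      then show "x \<in> T \<union> B - {?i, ?j}"
        using tT(1)[OF l(1)] bB(1)[OF perm(1)[OF w, of l]] ne[OF l(1)] by (elim disjE) simp_all
    qed
    then have "(\<Sum>a\<in>T \<union> B - {?i, ?j}. v (reconnect ?i ?j a ?d)) =
        (\<Sum>a\<in>t ` {..<m}. v (reconnect ?i ?j a ?d)) + (\<Sum>a\<in>(\<lambda>l. b (\<omega> l)) ` {..<m}. v (reconnect ?i ?j a ?d))"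
    proof (simp only:, intro sum.union_disjoint)
      show "t ` {..<m} \<inter> (\<lambda>l. b (\<omega> l)) ` {..<m} = {}" unfolding disjoint_iff using bt by (auto simp only: image_iff lessThan_iff) metis
    qed auto
    also have "\<dots> = (\<Sum>l<m. v (reconnect ?i ?j (t l) ?d)) + (\<Sum>l<m. v (reconnect ?i ?j (b (\<omega> l)) ?d))"
      by (subst (1 2) sum.reindex) (auto simp: inj_on_def tinj binj)
    also have "\<dots> = (\<Sum>l<m. F (\<omega> \<circ> transpose l m)) + (\<Sum>l<m. F (\<omega> \<circ> transpose l (Suc m)))"
      using r1 r2 tr[OF w] by (intro arg_cong2[of _ _ _ _ "(+)"] sum.cong) (auto simp: F_def)
    finally have sum: "(\<Sum>a\<in>T \<union> B - {?i, ?j}. v (reconnect ?i ?j a ?d)) =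
      (\<Sum>l<m. F (\<omega> \<circ> transpose l m)) + (\<Sum>l<m. F (\<omega> \<circ> transpose l (Suc m)))" .
    have "cap_coeff \<delta> (T \<union> B) ?i ?j v ?d = 0" using v(1) ij(1-3) d unfolding harmonic_def by blast
    moreover have "v (D \<omega>) = F \<omega>" using w by (simp add: F_def)
    ultimately have "\<delta> * F \<omega> + ((\<Sum>l<m. F (\<omega> \<circ> transpose l m)) + (\<Sum>l<m. F (\<omega> \<circ> transpose l (Suc m)))) = 0"
      unfolding cap_coeff_def add sum by simp
    then have "(\<Sum>l<m. F (\<omega> \<circ> transpose l m)) + ((\<Sum>l<m. F (\<omega> \<circ> transpose l (Suc m))) + F \<omega>) = (1 - \<delta>) * F \<omega>"
      by (rule shift_eigenvalue)
    moreover have "F (\<omega> \<circ> ?s) = F \<omega>" using fun_cong[OF sF, of \<omega>] by (simp add: act_def)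
    ultimately show ?thesis unfolding jucys_murphy_def by simp
  next
    case False
    then have "F \<omega> = 0" by (simp add: F_def)
    moreover have "jucys_murphy k F \<omega> = 0" if "k < ?n" for k
      using supported_jucys_murphy[OF that \<open>supported ?n F\<close>] False by (simp add: supported_def)
    ultimately show ?thesis by simp
  qed
  ultimately have "\<exists>z\<in>one_cup_values ?n. 1 - (1 - \<delta>) = of_int z"
    by (intro one_cup_spectrum[of m F]) auto
  then show ?thesis by (simp add: n)
qed

section \<open>Harmonic vectors at integer parameters\<close>

text \<open>\<open>f x i j y z\<close> is to be the coefficient of the diagram with the single top
  joined to \<open>x\<close> and the cups \<open>i j\<close> and \<open>y z\<close>;
  \<open>E\<close> is the cap on \<open>i, j\<close>. By \<open>E\<close>, the sum \<open>T\<close>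
  is \<open>2 f\<close> minus the sum of \<open>f\<close> over the three pairings of
  \<open>i, j, y, z\<close>. This makes \<open>T\<close> independent of the arrangement and then
  gives \<open>f = - T\<close>, while \<open>T\<close> is by definition a sum of three values of
  \<open>f\<close>; so all vanish.\<close>

lemma five_points:
  fixes B :: "'b set" and f :: "'b \<Rightarrow> 'b \<Rightarrow> 'b \<Rightarrow> 'b \<Rightarrow> 'b \<Rightarrow> real"
  assumes P_def: "\<And>x i j y z. P x i j y z \<longleftrightarrow> distinct [x, i, j, y, z] \<and> {x, i, j, y, z} = B"
    and s1: "\<And>x i j y z. P x i j y z \<Longrightarrow> f x i j y z = f x j i y z"
    and s2: "\<And>x i j y z. P x i j y z \<Longrightarrow> f x i j y z = f x y z i j"
    and E: "\<And>x i j y z. P x i j y z \<Longrightarrow> f i j x y z + f j i x y z + f x i y j z + f x i z j y = 0"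
    and P: "P x i j y z"
  shows "f x i j y z = 0"
proof -
  define T where "T x i j y z = f x i j y z + f i j x y z + f j i x y z" for x i j y z
  have sw: "P i x j y z" "P x j i y z" "P x i y j z" "P x i j z y" if "P x i j y z" for x i j y z
    using that by (auto simp: P_def)
  have s3: "f x i j y z = f x i j z y" if p: "P x i j y z" for x i j y z
  proof -
    have "P x y z i j" "P x z y i j" using p by (auto simp: P_def)
    then show ?thesis using s2[OF p] s1[of x y z i j] s2[of x z y i j] by simp
  qed
  have T1: "T x i j y z = T i x j y z" if p: "P x i j y z" for x i j y z
    using s1[OF p] s1[OF sw(1)[OF p]] s1[of j i x y z] sw(1,2)[OF sw(2)[OF p]] sw(2)[OF sw(1)[OF sw(2)[OF p]]]
    by (simp add: T_def)
  have T2: "T x i j y z = T x j i y z" if p: "P x i j y z" for x i j y z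
    using s1[OF p] by (simp add: T_def)
  have T3: "T x i j y z = T x i j z y" if p: "P x i j y z" for x i j y z
  proof -
    have "P i j x y z" "P j i x y z" using p by (auto simp: P_def)
    then show ?thesis using s3[OF p] s3[of i j x y z] s3[of j i x y z] by (simp add: T_def)
  qed
  have L1: "T x i j y z = T x y z i j" if p: "P x i j y z" for x i j y z
  proof -
    have q: "P x y z i j" "P x i y j z" "P x i z j y" "P x y j i z" "P x y i j z" "P x j y i z" using p by (auto simp: P_def)
    have "f x i y j z = f x y i z j" using s1[OF q(2)] s3[OF q(5)] by simp
    moreover have "f x i z j y = f x y j z i" using s2[OF q(3)] s1[OF q(6)] s3[OF q(4)] by simp
    ultimately show ?thesis using E[OF p] E[OF q(1)] s2[OF p] by (simp add: T_def)
  qed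
  \<comment> \<open>\<open>L1\<close> moves a point into or out of the distinguished pair; together
    with the symmetries \<open>T1\<close> and \<open>T2\<close> this suffices to exchange
    \<open>j\<close> and \<open>y\<close>.\<close>
  have L2: "T x i j y z = T x i y j z" if p: "P x i j y z" for x i j y z
  proof -
    have q: "P x i j y z" "P x j i y z" "P j x i y z" "P j y z x i" "P y j z x i" "P y x i j z" "P x y i j z" "P x i y j z"
      using p by (auto simp: P_def)
    have "T x i j y z = T j x i y z" using T2[OF q(1)] T1[OF q(2)] by simp
    also have "\<dots> = T y j z x i" using L1[OF q(3)] T1[OF q(4)] by simp
    also have "\<dots> = T x y i j z" using L1[OF q(5)] T1[OF q(6)] by simp
    also have "\<dots> = T x i y j z" using T2[OF q(7)] .
    finally show ?thesis .
  qed
  have L3: "f x i j y z = - T x i j y z" if p: "P x i j y z" for x i j y z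
  proof -
    have q: "P x i y j z" "P x i j z y" "P x i z j y" using p by (auto simp: P_def)
    have "f x i y z j = f x i y j z" "f x i z y j = f x i z j y" "f x i j z y = f x i j y z"
      using s3[OF q(1)] s3[OF q(3)] s3[OF p] by simp_all
    then have "2 * f x i j y z = T x i j y z + (f x i j y z + f x i y j z + f x i z j y)"
      "2 * f x i y j z = T x i y j z + (f x i j y z + f x i y j z + f x i z j y)"
      "2 * f x i z j y = T x i z j y + (f x i j y z + f x i y j z + f x i z j y)"
      using E[OF p] E[OF q(1)] E[OF q(3)] by (simp_all add: T_def)
    moreover have "T x i y j z = T x i j y z" "T x i z j y = T x i j y z"
      using L2[OF p] L2[OF q(2)] T3[OF p] T3[OF q(3)] L2[of x i z y j] by auto
    ultimately show ?thesis by linarith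
  qed
  have q: "P i j x y z" "P j i x y z" using P by (auto simp: P_def)
  have "T i j x y z = T x i j y z" "T j i x y z = T x i j y z"
    using T1 T2 P q by (metis, metis)
  then show ?thesis using L3[OF P] L3[OF q(1)] L3[OF q(2)] T_def[of x i j y z] by linarith
qed

text \<open>Each upward diagram has the form \<open>M x i j y z\<close>, and at parameter 0 the cap
  conditions are the four-term relations of \<open>five_points\<close>, which is applied to real and
  imaginary parts.\<close>

lemma no_harmonic_one_five:
  fixes T B :: "'a set"
  assumes fin: "finite T" "finite B" and TB: "T \<inter> B = {}" and c: "card T = 1" "card B = 5"
  shows "\<not> has_harmonic 0 T B"
proof
  assume "has_harmonic 0 T B"
  then obtain v d where v: "harmonic 0 T B v" and d: "d \<in> upward_matchings T B" "v d \<noteq> 0"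
    by (auto simp: has_harmonic_def)
  obtain t where t: "T = {t}" using c(1) by (auto simp: card_1_singleton_iff)
  define P where "P x i j y z \<longleftrightarrow> distinct [x, i, j, y, z] \<and> {x, i, j, y, z} = B" for x i j y z
  define M where "M x i j y z = (\<lambda>u. if u = t then x else if u = x then t else if u = i then j else if u = j then i
    else if u = y then z else if u = z then y else u)" for x i j y z
  define V where "V x i j y z = v (M x i j y z)" for x i j y z
  have s1: "V x i j y z = V x j i y z" if "P x i j y z" for x i j y z
  proof -
    have "M x i j y z = M x j i y z" using that by (auto simp: M_def P_def fun_eq_iff)
    then show ?thesis by (simp add: V_def)
  qed
  have s2: "V x i j y z = V x y z i j" if "P x i j y z" for x i j y z
  proof -
    have "M x i j y z = M x y z i j" using that by (auto simp: M_def P_def fun_eq_iff)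
    then show ?thesis by (simp add: V_def)
  qed
  have E: "V i j x y z + V j i x y z + V x i y j z + V x i z j y = 0" if p: "P x i j y z" for x i j y z
  proof -
    have tB: "t \<noteq> x" "t \<noteq> i" "t \<noteq> j" "t \<noteq> y" "t \<noteq> z" using p TB t by (auto simp: P_def)
    have dist: "x \<noteq> i" "x \<noteq> j" "x \<noteq> y" "x \<noteq> z" "i \<noteq> j" "i \<noteq> y" "i \<noteq> z" "j \<noteq> y" "j \<noteq> z" "y \<noteq> z"
      using p by (auto simp: P_def)
    let ?d = "\<lambda>u. if u = t then x else if u = x then t else if u = y then z else if u = z then y else u"
    have B: "B - {i, j} = {x, y, z}" "T \<union> B - {i, j} = {t, x, y, z}" using p tB by (auto simp: P_def t)
    have "?d \<in> upward_matchings T (B - {i, j})"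
      using tB dist by (auto simp: B t upward_matchings_def matchings_def)
    moreover have "i \<in> B" "j \<in> B" using p by (auto simp: P_def)
    ultimately have "(\<Sum>a\<in>{t, x, y, z}. v (reconnect i j a ?d)) = 0"
      using v dist(5) unfolding harmonic_def cap_coeff_def B(2)[symmetric] by fastforce
    moreover have "reconnect i j t ?d = M i j x y z" "reconnect i j x ?d = M j i x y z"
      "reconnect i j y ?d = M x i y j z" "reconnect i j z ?d = M x i z j y"
      using tB dist by (auto simp: reconnect_def M_def fun_eq_iff)
    ultimately show ?thesis using tB dist by (simp add: V_def add.assoc)
  qed
  have zero: "V x i j y z = 0" if p: "P x i j y z" for x i j y z
  proof -
    have "Re (V x i j y z) = 0"
    proof (rule five_points[OF P_def _ _ _ p, of "\<lambda>x i j y z. Re (V x i j y z)"])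
      fix x i j y z assume p: "P x i j y z"
      show "Re (V x i j y z) = Re (V x j i y z)" "Re (V x i j y z) = Re (V x y z i j)"
        using s1[OF p] s2[OF p] by simp_all
      show "Re (V i j x y z) + Re (V j i x y z) + Re (V x i y j z) + Re (V x i z j y) = 0"
        using arg_cong[OF E[OF p], of Re] by simp
    qed
    moreover have "Im (V x i j y z) = 0"
    proof (rule five_points[OF P_def _ _ _ p, of "\<lambda>x i j y z. Im (V x i j y z)"])
      fix x i j y z assume p: "P x i j y z"
      show "Im (V x i j y z) = Im (V x j i y z)" "Im (V x i j y z) = Im (V x y z i j)"
        using s1[OF p] s2[OF p] by simp_all
      show "Im (V i j x y z) + Im (V j i x y z) + Im (V x i y j z) + Im (V x i z j y) = 0"
        using arg_cong[OF E[OF p], of Im] by simp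
    qed
    ultimately show ?thesis by (simp add: complex_eq_iff)
  qed
  note D = matchingsD[OF upward_matchingsD(1)[OF d(1)]]
  define x where "x = d t"
  have x: "x \<in> B" "d x = t" using upward_matchingsD(2)[OF d(1), of t] D(3)[of t] by (auto simp: x_def t)
  have dB: "d u \<in> B" if "u \<in> B" "u \<noteq> x" for u
    using D(1)[of u] D(3)[of u] that by (auto simp: t x_def)
  have nx: "d u \<noteq> x" if "u \<in> B" for u
    using that x D(3)[of u] TB by (auto simp: t)
  have cx: "card (B - {x}) = 4" using x(1) c(2) fin(2) by simp
  then have "B - {x} \<noteq> {}" by (metis card.empty zero_neq_numeral)
  then obtain i where i: "i \<in> B" "i \<noteq> x" by auto
  define j where "j = d i"
  have j: "j \<in> B" "j \<noteq> x" "j \<noteq> i" "d j = i" using dB[OF i] nx[OF i(1)] D(2)[of i] D(3)[of i] i by (auto simp: j_def)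
  have c2: "card (B - {x} - {i} - {j}) = 2" using cx i j fin(2) by simp
  then have "B - {x} - {i} - {j} \<noteq> {}" by (metis card.empty zero_neq_numeral)
  then obtain y where y: "y \<in> B" "y \<noteq> x" "y \<noteq> i" "y \<noteq> j" by auto
  define z where "z = d y"
  have z: "z \<in> B" "z \<noteq> x" "z \<noteq> y" "d z = y" using dB[OF y(1,2)] nx[OF y(1)] D(2)[of y] D(3)[of y] y by (auto simp: z_def)
  have zij: "z \<noteq> i" "z \<noteq> j" using z(4) j y j_def by auto
  have "card (B - {x} - {i} - {j} - {y} - {z}) = 0" using c2 y z zij fin(2) by simp
  then have "B - {x} - {i} - {j} - {y} - {z} = {}" using fin(2) by simp
  then have "B = {x, i, j, y, z}" using x(1) i(1) j(1) y(1) z(1) by blast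
  then have p: "P x i j y z" using i j y z zij by (auto simp: P_def)
  have "d = M x i j y z"
  proof
    fix u
    show "d u = M x i j y z u"
      using D(4)[of u] x j z p TB unfolding M_def P_def t by (auto simp: x_def[symmetric] j_def[symmetric] z_def[symmetric])
  qed
  then show False using zero[OF p] d(2) by (simp add: V_def)
qed

section \<open>Existence of harmonic vectors\<close>

lemma ex_upward_matching:
  assumes "finite T" "finite B" "T \<inter> B = {}" "card T \<le> card B" "even (card T + card B)"
  shows "upward_matchings T B \<noteq> {}"
  using assms
proof (induction "card T + card B" arbitrary: T B rule: less_induct)
  case less
  consider "B = {}" | "T = {}" "B \<noteq> {}" | "T \<noteq> {}" by auto
  then show ?case
  proof cases
    case 1
    then have "T = {}" using less.prems by simp
    then have "id \<in> upward_matchings T B" using 1 by (simp add: upward_matchings_def matchings_def)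
    then show ?thesis by auto
  next
    case 2
    then have "card B \<noteq> 0" "card B \<noteq> 1" using less.prems by auto
    then have "2 \<le> card B" by linarith
    then obtain i j where ij: "i \<in> B" "j \<in> B" "i \<noteq> j" 
      by (metis card_2_iff obtain_subset_with_card_n insert_subset)
    have "card (B - {i, j}) = card B - 2" using ij less.prems(2) by (simp add: card_Diff_subset)
    then have "upward_matchings T (B - {i, j}) \<noteq> {}"
      using 2 less.prems \<open>2 \<le> card B\<close> by (intro less.hyps) auto
    then show ?thesis using upward_add_pair[of _ T B i j] ij less.prems(3) by blast
  next
    case 3
    then obtain t b where tb: "t \<in> T" "b \<in> B" using less.prems by (metis all_not_in_conv card.empty card_0_eq le_zero_eq)
    have "card (T - {t}) = card T - 1" "card (B - {b}) = card B - 1" "card T > 0" "card B > 0"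
      using tb less.prems by (auto simp: card_gt_0_iff)
    then have "upward_matchings (T - {t}) (B - {b}) \<noteq> {}"
      using less.prems by (intro less.hyps) auto
    then obtain d where d: "d \<in> upward_matchings (T - {t}) (B - {b})" by auto
    have eq: "T - {t} \<union> (B - {b}) = T \<union> B - {t, b}" using tb less.prems(3) by auto
    have "add_pair t b d \<in> matchings (T \<union> B)"
      using matchings_add_pair[of d "T \<union> B" t b] upward_matchingsD(1)[OF d] tb less.prems(3) unfolding eq by auto
    moreover have "add_pair t b d x \<in> B" if "x \<in> T" for x
      using that upward_matchingsD(2)[OF d, of x] tb less.prems(3) by (auto simp: add_pair_def)
    ultimately have "add_pair t b d \<in> upward_matchings T B" by (simp add: upward_matchings_def)
    then show ?thesis by auto
  qed
qed

text \<open>The constant vector works: on \<open>2 * a + 2\<close> points a cap contributes the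
  parameter once and each of the \<open>2 * a\<close> reconnections once.\<close>

lemma has_harmonic_even:
  assumes fin: "finite T" "finite B" and TB: "T \<inter> B = {}" and c: "card T \<le> card B" "card T + card B = 2 * a + 2"
  shows "has_harmonic (of_int (- 2 * int a)) T B"
proof -
  have "harmonic (of_int (- 2 * int a)) T B (\<lambda>_. 1)"
    unfolding harmonic_def cap_coeff_def
  proof (intro ballI impI)
    fix i j assume "i \<in> B" "j \<in> B" "i \<noteq> j"
    then have "card (T \<union> B - {i, j}) = 2 * a"
      using c fin TB by (simp add: card_Diff_subset card_Un_disjoint)
    then show "of_int (- 2 * int a) * 1 + (\<Sum>a\<in>T \<union> B - {i, j}. 1) = (0 :: complex)" by simp
  qed
  moreover have "upward_matchings T B \<noteq> {}" using ex_upward_matching[OF fin TB c(1)] c(2) by simp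
  ultimately show ?thesis unfolding has_harmonic_def by (intro exI[of _ "\<lambda>_. 1"]) auto
qed

lemma upward_square:
  assumes d: "d \<in> upward_matchings A A'" and fin: "finite A" "finite A'" and c: "card A = card A'" and AA': "A \<inter> A' = {}"
    and x: "x \<in> A'"
  shows "d x \<in> A"
proof -
  have "inj_on d A" using matchings_eq_iff[OF upward_matchingsD(1)[OF d]] by (auto simp: inj_on_def)
  moreover have "d ` A \<subseteq> A'" using upward_matchingsD(2)[OF d] by auto
  ultimately have "d ` A = A'" using fin c by (metis card_image card_subset_eq)
  then show ?thesis using x matchingsD(3)[OF upward_matchingsD(1)[OF d]] by auto
qed

text \<open>Supplies the upward diagram on which the vectors built from two halves are
  nonzero.\<close>

lemma ex_bipartite_upward:
  assumes "finite A" "finite A'" "A \<inter> A' = {}" "card A = card A'" "T \<subseteq> A" "B = (A - T) \<union> A'"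
  obtains d where "d \<in> upward_matchings T B" "\<And>x. x \<in> A \<Longrightarrow> d x \<in> A'" "\<And>x. x \<in> A' \<Longrightarrow> d x \<in> A"
proof -
  obtain d where d: "d \<in> upward_matchings A A'" using ex_upward_matching[OF assms(1-3)] assms(4) by auto
  have "T \<union> B = A \<union> A'" using assms by auto
  then have "d \<in> upward_matchings T B" using d assms by (auto simp: upward_matchings_def)
  then show ?thesis using that[of d] upward_matchingsD(2)[OF d] upward_square[OF d assms(1,2,4,3)] by auto
qed

lemma reconnect_other:
  assumes d: "d \<in> matchings (S - {i, j})" and "a \<in> S - {i, j}" "i \<noteq> j"
  shows "reconnect i j (d a) d = reconnect j i a d"
proof -
  have "d (d a) = a" "d a \<noteq> a" "d a \<noteq> i" "d a \<noteq> j" using matchingsD(1,2,3)[OF d] assms(2) by auto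
  then show ?thesis using assms(2,3) by (auto simp: reconnect_def fun_eq_iff)
qed

text \<open>Naming a cut pair by its other end \<open>d a\<close> exchanges the roles of
  \<open>i\<close> and \<open>j\<close>.\<close>

lemma sum_reconnect_other:
  assumes d: "d \<in> matchings (S - {i, j})" and "i \<noteq> j"
  shows "(\<Sum>a\<in>S - {i, j}. v (reconnect j i a d)) = (\<Sum>a\<in>S - {i, j}. v (reconnect i j a d))"
proof -
  have "(\<Sum>a\<in>S - {i, j}. v (reconnect i j a d)) = (\<Sum>a\<in>S - {i, j}. v (reconnect i j (d a) d))"
    using sum.permute[OF matchings_permutes[OF d], of "\<lambda>a. v (reconnect i j a d)"] by (simp add: comp_def)
  also have "\<dots> = (\<Sum>a\<in>S - {i, j}. v (reconnect j i a d))"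
    using reconnect_other[OF d] assms(2) by (intro sum.cong) auto
  finally show ?thesis by simp
qed

lemma cap_coeff_commute:
  assumes "d \<in> matchings (S - {i, j})" and "i \<noteq> j"
  shows "cap_coeff \<delta> S i j v d = cap_coeff \<delta> S j i v d"
proof -
  have "add_pair i j d = add_pair j i d" using assms(2) by (auto simp: add_pair_def)
  moreover have "S - {j, i} = S - {i, j}" by auto
  ultimately show ?thesis using sum_reconnect_other[OF assms, of v] by (simp add: cap_coeff_def)
qed

text \<open>All tops go into the half \<open>A\<close>, so that every matching of \<open>A\<close>
  with \<open>A'\<close> is upward.\<close>

lemma split_square:
  fixes T B :: "'a set"
  assumes "finite T" "finite B" and TB: "T \<inter> B = {}" and c: "card T \<le> N" "card T + card B = 2 * N"
  obtains A A' where "finite A" "finite A'" "A \<inter> A' = {}" "T \<union> B = A \<union> A'" "T \<subseteq> A" "B = (A - T) \<union> A'"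
    "card A = N" "card A' = N"
proof -
  have "N - card T \<le> card B" using c by simp
  then obtain A0 where A0: "A0 \<subseteq> B" "card A0 = N - card T" by (metis obtain_subset_with_card_n)
  have fin: "finite A0" using assms(2) A0 by (auto intro: finite_subset)
  have "T \<inter> A0 = {}" using A0 TB by auto
  then have "card (T \<union> A0) = N" using card_Un_disjoint[of T A0] fin A0 assms by simp
  moreover have "card (B - A0) = N" using A0 fin c by (simp add: card_Diff_subset)
  ultimately show ?thesis using that[of "T \<union> A0" "B - A0"] A0 TB assms fin by auto
qed

text \<open>An antisymmetrised product of \<open>m + 1\<close> strands, closed up once, picks up the factor \<open>\<delta> - m\<close>.\<close>

lemma has_harmonic_positive:
  fixes T B :: "'a set"
  assumes fin: "finite T" "finite B" and TB: "T \<inter> B = {}" and c: "card T \<le> m + 1" "card T + card B = 2 * m + 2"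
  shows "has_harmonic (of_nat m) T B"
proof -
  let ?S = "T \<union> B"
  have c': "card T + card B = 2 * (m + 1)" using c(2) by simp
  obtain A A' where finA: "finite A" "finite A'" and disj: "A \<inter> A' = {}" and un: "?S = A \<union> A'"
    and TA: "T \<subseteq> A" and B_eq: "B = (A - T) \<union> A'" and cA: "card A = m + 1" and cA': "card A' = m + 1"
    by (rule split_square[OF fin TB c(1) c'])
  obtain e where e: "bij_betw e A' A" using finite_same_card_bij[OF finA(2,1)] cA cA' by auto
  define bip where "bip d \<longleftrightarrow> (\<forall>x\<in>A. d x \<in> A') \<and> (\<forall>x\<in>A'. d x \<in> A)" for d :: "'a \<Rightarrow> 'a"
  \<comment> \<open>Identifying \<open>A'\<close> with \<open>A\<close> by \<open>e\<close> turns a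
    matching between the halves into a permutation of \<open>A\<close>, whose sign is the
    coefficient.\<close>
  define \<sigma> where "\<sigma> d = (\<lambda>x. if x \<in> A then e (d x) else x)" for d :: "'a \<Rightarrow> 'a"
  define v where "v d = (if bip d then of_int (sign (\<sigma> d)) else 0 :: complex)" for d
  have v0: "v d = 0" if "x \<in> A" "d x \<in> A" for d x
  proof -
    have "d x \<notin> A'" using that disj by blast
    then have "\<not> bip d" using that(1) unfolding bip_def by blast
    then show ?thesis by (simp add: v_def)
  qed
  have v0': "v d = 0" if "x \<in> A'" "d x \<in> A'" for d x
  proof -
    have "d x \<notin> A" using that disj by blast
    then have "\<not> bip d" using that(1) unfolding bip_def by blast
    then show ?thesis by (simp add: v_def)
  qed
  have perm: "\<sigma> d permutes A" if d: "d \<in> matchings ?S" "bip d" for d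
  proof (rule bij_imp_permutes)
    have "bij_betw d A A'"
    proof (rule bij_betw_imageI)
      show "inj_on d A" using matchings_eq_iff[OF d(1)] by (auto simp: inj_on_def)
      show "d ` A = A'"
      proof (intro equalityI subsetI)
        fix x assume "x \<in> A'"
        then have "d x \<in> A" "x = d (d x)" using d(2) matchingsD(3)[OF d(1)] by (auto simp: bip_def)
        then show "x \<in> d ` A" by blast
      qed (use d(2) in \<open>auto simp: bip_def\<close>)
    qed
    from bij_betw_trans[OF this e] show "bij_betw (\<sigma> d) A A"
      by (rule bij_betw_cong[THEN iffD1, rotated]) (simp add: \<sigma>_def)
  qed (simp add: \<sigma>_def)
  have sgn_transpose: "sign (transpose a b) = -1" if "a \<noteq> b" for a b :: 'a
    using that by (simp add: sign_swap_id)
  have flip_left: "v d' = - v d"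
    if d: "d \<in> matchings ?S" "d' \<in> matchings ?S" "bip d" "bip d'" and pq: "p \<in> A'" "q \<in> A'" "p \<noteq> q"
      and eq: "\<And>x. x \<in> A \<Longrightarrow> d' x = transpose p q (d x)" for d d' p q
  proof -
    have inj: "inj_on e A'" using e by (simp add: bij_betw_def)
    have epq: "e p \<noteq> e q" "e p \<in> A" "e q \<in> A" using inj pq e by (auto simp: inj_on_def bij_betw_def)
    have "\<sigma> d' x = transpose (e p) (e q) (\<sigma> d x)" if "x \<in> A" for x
    proof -
      have "d x \<in> A'" using that d(3) by (auto simp: bip_def)
      then have "e (d x) = e p \<longleftrightarrow> d x = p" "e (d x) = e q \<longleftrightarrow> d x = q" using inj pq by (auto simp: inj_on_def)
      then show ?thesis using that eq[OF that] by (auto simp: \<sigma>_def transpose_def)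
    qed
    moreover have "\<sigma> d' x = transpose (e p) (e q) (\<sigma> d x)" if "x \<notin> A" for x
      using that epq by (auto simp: \<sigma>_def transpose_def)
    ultimately have "\<sigma> d' = transpose (e p) (e q) \<circ> \<sigma> d" by (auto simp: fun_eq_iff)
    moreover have "sign (transpose (e p) (e q) \<circ> \<sigma> d) = - sign (\<sigma> d)"
      using sgn_transpose[OF epq(1)] perm[OF d(1,3)] finA
      by (subst sign_compose) (auto intro: permutation_permutes[THEN iffD2] permutation_swap_id)
    ultimately show ?thesis using d by (simp add: v_def)
  qed
  have flip_right: "v d' = - v d"
    if d: "d \<in> matchings ?S" "d' \<in> matchings ?S" "bip d" "bip d'" and pq: "p \<in> A" "q \<in> A" "p \<noteq> q"
      and eq: "\<And>x. x \<in> A \<Longrightarrow> d' x = d (transpose p q x)" for d d' p q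
  proof -
    have "\<sigma> d' = \<sigma> d \<circ> transpose p q"
      using pq eq by (auto simp: \<sigma>_def fun_eq_iff transpose_def)
    moreover have "sign (\<sigma> d \<circ> transpose p q) = - sign (\<sigma> d)"
      using sgn_transpose[OF pq(3)] perm[OF d(1,3)] finA
      by (subst sign_compose) (auto intro: permutation_permutes[THEN iffD2] permutation_swap_id)
    ultimately show ?thesis using d by (simp add: v_def)
  qed
  \<comment> \<open>The reconnections \<open>i j\<close> and \<open>j i\<close> are conjugate under
    the transposition of \<open>i\<close> and \<open>j\<close>, which reverses the sign. Their sums
    agree by \<open>sum_reconnect_other\<close>, so they are 0, and a pair inside one half has
    weight 0.\<close>
  have same_side: "cap_coeff (of_nat m) ?S i j v d = 0"
    if d: "d \<in> matchings (?S - {i, j})" and ij: "i \<in> A \<and> j \<in> A \<or> i \<in> A' \<and> j \<in> A'" "i \<noteq> j" for d i j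
  proof -
    have ijS: "i \<in> ?S" "j \<in> ?S" using ij un by auto
    have "\<not> bip (add_pair i j d)" using ij disj by (auto simp: bip_def add_pair_def)
    then have 1: "v (add_pair i j d) = 0" by (simp add: v_def)
    have 2: "v (reconnect j i a d) = - v (reconnect i j a d)" if a: "a \<in> ?S - {i, j}" for a
    proof -
      let ?r = "reconnect i j a d" and ?r' = "reconnect j i a d"
      have eqS: "?S - {j, i} = ?S - {i, j}" by auto
      have da: "d a \<in> ?S - {i, j}" "d a \<noteq> a" using matchingsD(1,2)[OF d a] by auto
      have m: "?r \<in> matchings ?S" "?r' \<in> matchings ?S"
        using matchings_reconnect[of d ?S i j a] matchings_reconnect[of d ?S j i a] d ij ijS a eqS by auto
      have conj: "?r' x = transpose i j (?r (transpose i j x))" for x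
        using ij(2) a da matchingsD(3)[OF d] matchingsD(4)[OF d, of i] matchingsD(4)[OF d, of j]
        by (auto simp: reconnect_def transpose_def)
      have side: "transpose i j x \<in> A \<longleftrightarrow> x \<in> A" "transpose i j x \<in> A' \<longleftrightarrow> x \<in> A'" for x
        using ij disj by (auto simp: transpose_def)
      have b: "bip ?r' \<longleftrightarrow> bip ?r"
      proof
        assume "bip ?r"
        then show "bip ?r'" unfolding bip_def conj side by (auto simp: side)
      next
        assume r': "bip ?r'"
        have "?r x = transpose i j (?r' (transpose i j x))" for x by (simp add: conj)
        then show "bip ?r" using r' unfolding bip_def by (auto simp: side)
      qed
      show ?thesis
      proof (cases "bip ?r")
        case True
        show ?thesis
        proof (cases "i \<in> A")
          case iA: True
          then have j: "j \<in> A" using ij disj by auto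
          show ?thesis
          proof (rule flip_right[OF m True _ iA j ij(2)])
            fix x assume "x \<in> A"
            then have "transpose i j x \<in> A" by (simp add: side)
            then have "?r (transpose i j x) \<in> A'" using True by (auto simp: bip_def)
            then have "?r (transpose i j x) \<noteq> i" "?r (transpose i j x) \<noteq> j" using iA j disj by auto
            then show "?r' x = ?r (transpose i j x)" by (simp add: conj)
          qed (use b True in auto)
        next
          case False
          then have ij': "i \<in> A'" "j \<in> A'" using ij by auto
          show ?thesis
          proof (rule flip_left[OF m True _ ij' ij(2)])
            fix x assume "x \<in> A"
            then have "x \<noteq> i" "x \<noteq> j" using ij' disj by auto
            then show "?r' x = transpose i j (?r x)" by (simp add: conj)
          qed (use b True in auto)
        qed
      qed (use b in \<open>simp add: v_def\<close>)
    qed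
    have "(\<Sum>a\<in>?S - {i, j}. v (reconnect i j a d)) = (\<Sum>a\<in>?S - {i, j}. v (reconnect j i a d))"
      using sum_reconnect_other[OF d ij(2), of v] by simp
    also have "\<dots> = - (\<Sum>a\<in>?S - {i, j}. v (reconnect i j a d))" using 2 by (simp add: sum_negf)
    finally show ?thesis using 1 by (simp add: cap_coeff_def)
  qed
  have opposite: "cap_coeff (of_nat m) ?S i j v d = 0"
    if d: "d \<in> matchings (?S - {i, j})" and ij: "i \<in> A" "j \<in> A'" for d i j
  proof -
    have ne: "i \<noteq> j" and ijS: "i \<in> ?S" "j \<in> ?S" using ij disj un by auto
    note D = matchingsD[OF d]
    have S: "?S - {i, j} = (A - {i}) \<union> (A' - {j})" using ij disj un by auto
    have cards: "card (A - {i}) = m" "card (A' - {j}) = m" using ij cA cA' finA by auto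
    have vals: "reconnect i j a d i = a" "reconnect i j a d a = i" "reconnect i j a d j = d a" "reconnect i j a d (d a) = j"
      "\<And>x. x \<notin> {i, j, a, d a} \<Longrightarrow> reconnect i j a d x = d x"
      if "a \<in> ?S - {i, j}" for a
      using D(1,2)[OF that] that ne by (auto simp: reconnect_def)
    show ?thesis
    proof (cases "\<exists>x\<in>A - {i}. d x \<in> A")
      case False
      have dA: "d x \<in> A' - {j}" if "x \<in> A - {i}" for x using D(1)[of x] that False S by auto
      have dA': "d x \<in> A - {i}" if "x \<in> A' - {j}" for x
      proof -
        have "d \<in> upward_matchings (A - {i}) (A' - {j})" using d dA unfolding S by (auto simp: upward_matchings_def)
        from upward_square[OF this] show ?thesis using finA disj that cards by auto
      qed
      let ?e = "add_pair i j d"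
      have e: "?e \<in> matchings ?S" using matchings_add_pair[OF d ijS ne] .
      have be: "bip ?e" using dA dA' ij ne disj by (auto simp: bip_def add_pair_def)
      have r0: "v (reconnect i j a d) = 0" if a: "a \<in> A - {i}" for a
      proof -
        have "reconnect i j a d i \<notin> A'" using vals(1)[of a] a S disj by auto
        then have "\<not> bip (reconnect i j a d)" using ij by (auto simp: bip_def)
        then show ?thesis by (simp add: v_def)
      qed
      \<comment> \<open>This diagram differs from \<open>?e\<close> by one transposition of
        partners. There are \<open>m\<close> such points \<open>a\<close>, which cancel the
        parameter \<open>m\<close> in front of \<open>v ?e\<close>.\<close>
      have r1: "v (reconnect i j a d) = - v ?e" if a: "a \<in> A' - {j}" for a
      proof -
        have a': "a \<in> ?S - {i, j}" using a S by auto
        have r: "reconnect i j a d \<in> matchings ?S" using matchings_reconnect[OF d ijS ne a'] .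
        have eq: "reconnect i j a d x = transpose j a (?e x)" if xA: "x \<in> A" for x
        proof -
          consider "x = i" | "x = d a" | "x \<in> A - {i}" "x \<noteq> d a" using xA by auto
          then show ?thesis
          proof cases
            case 1
            then show ?thesis using vals(1)[OF a'] ne by (simp add: add_pair_def)
          next
            case 2
            then show ?thesis using vals(4)[OF a'] dA'[OF a] D(3)[of a] ij disj by (auto simp: add_pair_def)
          next
            case 3
            then have "x \<noteq> a" "x \<noteq> j" "d x \<noteq> a" "d x \<noteq> j" using a ij disj dA[of x] D(3)[of x] by auto
            then show ?thesis using 3 vals(5)[OF a', of x] by (simp add: add_pair_def)
          qed
        qed
        have "bip (reconnect i j a d)"
          unfolding bip_def
        proof (intro conjI ballI)
          fix x assume x: "x \<in> A"
          then have "?e x \<in> A'" using be by (auto simp: bip_def)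
          then show "reconnect i j a d x \<in> A'" using eq[OF x] a ij by (auto simp: transpose_def)
        next
          fix x assume x: "x \<in> A'"
          show "reconnect i j a d x \<in> A"
          proof (cases "x \<in> {i, j, a, d a}")
            case True
            then show ?thesis using vals(1-4)[OF a'] x ij disj dA'[OF a] by auto
          next
            case False
            then show ?thesis using vals(5)[OF a', of x] dA'[of x] x by auto
          qed
        qed
        then show ?thesis using flip_left[OF e r be, of j a] eq ij a by auto
      qed
      have "(\<Sum>a\<in>?S - {i, j}. v (reconnect i j a d)) = (\<Sum>a\<in>A - {i}. v (reconnect i j a d)) + (\<Sum>a\<in>A' - {j}. v (reconnect i j a d))"
        unfolding S using finA disj by (intro sum.union_disjoint) auto
      also have "\<dots> = - (of_nat m * v ?e)" using r0 r1 cards by simp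
      finally show ?thesis by (simp add: cap_coeff_def)
    next
      case True
      then obtain x where x: "x \<in> A - {i}" "d x \<in> A" by auto
      have dx: "d x \<in> A - {i}" "d (d x) = x" using D(1)[of x] D(3)[of x] x S disj ij by auto
      \<comment> \<open>By counting, a pair inside \<open>A\<close> comes with a pair inside
        \<open>A'\<close>. A reconnection cuts only one pair, so one of the two survives and makes
        the weight 0.\<close>
      have "\<exists>y\<in>A' - {j}. d y \<in> A'"
      proof (rule ccontr)
        assume no: "\<not> ?thesis"
        have "d y \<in> A - {i}" if "y \<in> A' - {j}" for y using D(1)[of y] that no S by auto
        then have "d \<in> upward_matchings (A' - {j}) (A - {i})"
          using d unfolding S by (auto simp: upward_matchings_def Un_commute)
        from upward_square[OF this] have "d x \<in> A' - {j}" using finA disj cards x by auto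
        then show False using x disj by auto
      qed
      then obtain y where y: "y \<in> A' - {j}" "d y \<in> A'" by auto
      have dy: "d y \<in> A' - {j}" "d (d y) = y" using D(1)[of y] D(3)[of y] y S disj ij by auto
      have "add_pair i j d x = d x" using x ij disj by (auto simp: add_pair_def)
      then have 1: "v (add_pair i j d) = 0" using v0[of x] x by simp
      have "v (reconnect i j a d) = 0" if a: "a \<in> ?S - {i, j}" for a
      proof (cases "a = x \<or> a = d x")
        case True
        then have "a \<in> A" "d a \<in> A" using x dx by auto
        then have "y \<notin> {i, j, a, d a}" using y ij disj by auto
        then have "reconnect i j a d y = d y" using vals(5)[OF a] by simp
        then show ?thesis using v0'[of y] y by simp
      next
        case False
        then have "x \<noteq> a" "x \<noteq> d a" using D(3)[of a] by auto
        then have "x \<notin> {i, j, a, d a}" using x ij disj by auto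
        then have "reconnect i j a d x = d x" using vals(5)[OF a] by simp
        then show ?thesis using v0[of x] x by simp
      qed
      then show ?thesis using 1 by (simp add: cap_coeff_def)
    qed
  qed
  have "harmonic (of_nat m) T B v"
    unfolding harmonic_def
  proof (intro ballI impI)
    fix i j d assume ij: "i \<in> B" "j \<in> B" "i \<noteq> j" and d: "d \<in> upward_matchings T (B - {i, j})"
    have eq: "T \<union> (B - {i, j}) = ?S - {i, j}" using ij TB by auto
    have m: "d \<in> matchings (?S - {i, j})" using upward_matchingsD(1)[OF d] by (simp add: eq)
    have m': "d \<in> matchings (?S - {j, i})" using m by (simp add: insert_commute)
    consider "i \<in> A \<and> j \<in> A \<or> i \<in> A' \<and> j \<in> A'" | "i \<in> A" "j \<in> A'" | "j \<in> A" "i \<in> A'"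
      using ij un by auto
    then show "cap_coeff (of_nat m) ?S i j v d = 0"
    proof cases
      case 1
      then show ?thesis using same_side[OF m _ ij(3)] by auto
    next
      case 2
      then show ?thesis using opposite[OF m] by auto
    next
      case 3
      then show ?thesis using opposite[OF m'] cap_coeff_commute[OF m ij(3)] by auto
    qed
  qed
  moreover obtain d where d: "d \<in> upward_matchings T B" "\<And>x. x \<in> A \<Longrightarrow> d x \<in> A'" "\<And>x. x \<in> A' \<Longrightarrow> d x \<in> A"
    using ex_bipartite_upward[OF finA disj _ TA B_eq] cA cA' by auto
  moreover have "v d \<noteq> 0" using d(2,3) by (auto simp: v_def bip_def sign_def)
  ultimately show ?thesis unfolding has_harmonic_def by blast
qed

lemma even_card_involution:
  assumes "finite S" "\<And>x. x \<in> S \<Longrightarrow> d x \<in> S \<and> d x \<noteq> x \<and> d (d x) = x"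
  shows "even (card S)"
  using assms
proof (induction "card S" arbitrary: S rule: less_induct)
  case less
  show ?case
  proof (cases "S = {}")
    case False
    then obtain x where x: "x \<in> S" by auto
    let ?R = "S - {x, d x}"
    have dx: "d x \<in> S" "d x \<noteq> x" "d (d x) = x" using less.prems(2)[OF x] by auto
    have "card {x, d x} \<le> card S" using less.prems(1) x dx by (intro card_mono) auto
    then have c: "card ?R = card S - 2" "2 \<le> card S" using dx x by (simp_all add: card_Diff_subset)
    have "even (card ?R)"
    proof (rule less.hyps)
      fix y assume y: "y \<in> ?R"
      then have "d y \<in> S" "d y \<noteq> y" "d (d y) = y" using less.prems(2)[of y] by auto
      moreover from this(3) y dx(3) have "d y \<noteq> x" "d y \<noteq> d x" by auto
      ultimately show "d y \<in> ?R \<and> d y \<noteq> y \<and> d (d y) = y" by simp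
    qed (use c less.prems in auto)
    then show ?thesis using c by simp
  qed simp
qed

text \<open>The invariant behind this vector is the \<open>s\<close>-th power of the Gram determinant
  \<open>(x, x) (y, y) - (x, y)\<^sup>2\<close> of two vectors, which is harmonic in dimension \<open>3 - 2 s\<close>.\<close>

primrec gram_weight :: "nat \<Rightarrow> nat \<Rightarrow> complex" where
  "gram_weight s 0 = 1"
| "gram_weight s (Suc k) = - (2 * (of_nat k + 1) / (2 * of_nat s - 1 - 2 * of_nat k)) * gram_weight s k"

text \<open>All cap conditions reduce to this recursion. Its leading factor is odd and hence
  nonzero, so the division in \<open>gram_weight\<close> is sound.\<close>

lemma gram_weight_rec:
  "(2 * of_nat s - 1 - 2 * of_nat k) * gram_weight s (Suc k) + 2 * (of_nat k + 1) * gram_weight s k = 0"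
proof -
  have "2 * int s - 1 - 2 * int k \<noteq> 0" by presburger
  then have "(of_int (2 * int s - 1 - 2 * int k) :: complex) \<noteq> 0" by (metis of_int_eq_0_iff)
  then have "2 * of_nat s - 1 - 2 * of_nat k \<noteq> (0 :: complex)" by simp
  then show ?thesis by simp
qed

text \<open>In the diagram without \<open>i\<close> and \<open>j\<close>, \<open>k\<close> counts
  the pairs inside \<open>A\<close>, \<open>u\<close> the pairs between the halves and
  \<open>b\<close> the points of \<open>A'\<close> joined within \<open>A'\<close>. The four
  products are the reconnections at the four kinds of points. Here \<open>i\<close> and
  \<open>j\<close> both lie in \<open>A\<close>; in the next two identities both lie in
  \<open>A'\<close>, or one in each half.\<close>

lemma cap_identity_same:
  fixes k u b s x y :: complex
  assumes "2 * k + u + 2 = 2 * s" "u + b = 2 * s" "(2 * s - 1 - 2 * k) * y + 2 * (k + 1) * x = 0"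
  shows "(3 - 2 * s) * y + ((2 * k * y + u * y) + (u * y + b * x)) = 0"
proof -
  have u: "u = 2 * s - 2 * k - 2" using assms(1) by (simp add: algebra_simps)
  have b: "b = 2 * s - u" using assms(2) by (simp add: algebra_simps)
  have "(3 - 2 * s) * y + ((2 * k * y + u * y) + (u * y + b * x)) = (2 * s - 1 - 2 * k) * y + 2 * (k + 1) * x"
    unfolding b u by (simp add: algebra_simps)
  then show ?thesis unfolding assms(3) .
qed

lemma cap_identity_same':
  fixes k u b s x y :: complex
  assumes "2 * (k + 1) + u = 2 * s" "u + b + 2 = 2 * s" "(2 * s - 1 - 2 * k) * y + 2 * (k + 1) * x = 0"
  shows "(3 - 2 * s) * y + ((2 * (k + 1) * x + u * y) + (u * y + b * y)) = 0"
proof -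
  have u: "u = 2 * s - 2 * k - 2" using assms(1) by (simp add: algebra_simps)
  have b: "b = 2 * s - u - 2" using assms(2) by (simp add: algebra_simps)
  have "(3 - 2 * s) * y + ((2 * (k + 1) * x + u * y) + (u * y + b * y)) = (2 * s - 1 - 2 * k) * y + 2 * (k + 1) * x"
    unfolding b u by (simp add: algebra_simps)
  then show ?thesis unfolding assms(3) .
qed

lemma cap_identity_mixed:
  fixes k u b s x y :: complex
  assumes "2 * k + u + 1 = 2 * s" "u + b + 1 = 2 * s" "(2 * s - 1 - 2 * k) * y + 2 * (k + 1) * x = 0"
  shows "(3 - 2 * s) * x + ((2 * k * x + u * y) + (u * x + b * x)) = 0"
proof -
  have u: "u = 2 * s - 2 * k - 1" using assms(1) by (simp add: algebra_simps)
  have b: "b = 2 * s - u - 1" using assms(2) by (simp add: algebra_simps)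
  have "(3 - 2 * s) * x + ((2 * k * x + u * y) + (u * x + b * x)) = (2 * s - 1 - 2 * k) * y + 2 * (k + 1) * x"
    unfolding b u by (simp add: algebra_simps)
  then show ?thesis unfolding assms(3) .
qed

text \<open>The vector polarises the power of the Gram determinant, with one vector placed at the
  \<open>2 * s\<close> points of \<open>A\<close> and the other at those of \<open>A'\<close>. A
  matching is then weighted by its number \<open>k\<close> of pairs inside \<open>A\<close>: up to a
  common factor, \<open>gram_weight s k\<close> is the signed binomial coefficient of the power
  divided by the number of matchings with that \<open>k\<close>.\<close>

lemma has_harmonic_odd:
  fixes T B :: "'a set"
  assumes fin: "finite T" "finite B" and TB: "T \<inter> B = {}" and c: "card T \<le> 2 * s" "card T + card B = 4 * s"
  shows "has_harmonic (of_int (3 - 2 * int s)) T B"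
proof -
  obtain A A' where A: "finite A" "finite A'" "A \<inter> A' = {}" "T \<union> B = A \<union> A'" "T \<subseteq> A" "B = (A - T) \<union> A'"
    "card A = 2 * s" "card A' = 2 * s"
    by (rule split_square[OF fin TB, of "2 * s"]) (use c in auto)
  let ?S = "T \<union> B"
  define v where "v d = gram_weight s (card {x \<in> A. d x \<in> A} div 2)" for d :: "'a \<Rightarrow> 'a"
  let ?\<delta> = "of_int (3 - 2 * int s) :: complex"
  have cap: "cap_coeff ?\<delta> ?S i j v d = 0" if d: "d \<in> matchings (?S - {i, j})" and ij: "i \<in> ?S" "j \<in> ?S" "i \<noteq> j" for d i j
  proof -
    note D = matchingsD[OF d]
    let ?C = "\<lambda>X Y. {a \<in> ?S - {i, j}. a \<in> X \<and> d a \<in> Y}"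
    have finC: "finite (?C X Y)" for X Y using fin by auto
    have mem: "x \<in> A' \<longleftrightarrow> x \<notin> A" if "x \<in> ?S" for x using that A(3,4) by auto
    have "even (card (?C A A))"
      by (rule even_card_involution[of _ d]) (use finC D in auto)
    then obtain k where k: "card (?C A A) = 2 * k" by auto
    define u where "u = card (?C A A')"
    define b where "b = card (?C A' A')"
    have u': "card (?C A' A) = u"
      unfolding u_def using D by (intro bij_betw_same_card[of d] bij_betwI[of d _ _ d]) auto
    have card_rest: "card (X - {i, j}) = card X - of_bool (i \<in> X) - of_bool (j \<in> X)"
      "of_bool (i \<in> X) + of_bool (j \<in> X) \<le> card X" if "finite X" for X
    proof -
      have "card (X \<inter> {i, j}) = of_bool (i \<in> X) + of_bool (j \<in> X)" using ij(3) by auto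
      moreover have "card (X - {i, j}) = card X - card (X \<inter> {i, j})" using that by (simp add: card_Diff_subset_Int)
      moreover have "card (X \<inter> {i, j}) \<le> card X" using that by (intro card_mono) auto
      ultimately show "card (X - {i, j}) = card X - of_bool (i \<in> X) - of_bool (j \<in> X)"
        "of_bool (i \<in> X) + of_bool (j \<in> X) \<le> card X" by simp_all
    qed
    have split: "card (?C X A) + card (?C X A') = card (X - {i, j})" if X: "X \<subseteq> ?S" for X
    proof -
      have "?C X A \<union> ?C X A' = X - {i, j}"
      proof (intro equalityI subsetI)
        fix a assume a: "a \<in> X - {i, j}"
        then have "d a \<in> ?S" using D(1)[of a] X by auto
        then show "a \<in> ?C X A \<union> ?C X A'" using a X A(4) by auto
      qed auto
      moreover have "?C X A \<inter> ?C X A' = {}" using A(3) by auto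
      ultimately show ?thesis using card_Un_disjoint[OF finC finC, of X A X A'] by simp
    qed
    have "A \<subseteq> ?S" "A' \<subseteq> ?S" using A(4) by auto
    then have cnt: "2 * k + u + of_bool (i \<in> A) + of_bool (j \<in> A) = 2 * s" "u + b + of_bool (i \<in> A') + of_bool (j \<in> A') = 2 * s"
      using split[of A] split[of A'] card_rest[OF A(1)] card_rest[OF A(2)] A(7,8) k u' unfolding u_def[symmetric] b_def[symmetric] by auto
    have add: "v (add_pair i j d) = gram_weight s (k + of_bool (i \<in> A \<and> j \<in> A))"
    proof -
      have "{x \<in> A. add_pair i j d x \<in> A} = ?C A A \<union> (if i \<in> A \<and> j \<in> A then {i, j} else {})"
        using A(4) ij(3) by (auto simp: add_pair_def)
      moreover have "card \<dots> = 2 * (k + of_bool (i \<in> A \<and> j \<in> A))"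
        using k ij(3) finC by (subst card_Un_disjoint) auto
      ultimately show ?thesis by (simp add: v_def)
    qed
    have rec: "v (reconnect i j a d) = gram_weight s (k - of_bool (a \<in> A \<and> d a \<in> A) + of_bool (i \<in> A \<and> a \<in> A) + of_bool (j \<in> A \<and> d a \<in> A))"
      if a: "a \<in> ?S - {i, j}" for a
    proof -
      have da: "d a \<in> ?S - {i, j}" "d a \<noteq> a" "d (d a) = a" using D a by auto
      let ?R = "(?C A A - {a, d a}) \<union> (if i \<in> A \<and> a \<in> A then {i, a} else {}) \<union> (if j \<in> A \<and> d a \<in> A then {j, d a} else {})"
      have vals: "reconnect i j a d i = a" "reconnect i j a d a = i" "reconnect i j a d j = d a" "reconnect i j a d (d a) = j"
        "\<And>x. x \<notin> {i, j, a, d a} \<Longrightarrow> reconnect i j a d x = d x"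
        using a da ij(3) by (auto simp: reconnect_def)
      have "x \<in> {x \<in> A. reconnect i j a d x \<in> A} \<longleftrightarrow> x \<in> ?R" for x
      proof (cases "x \<in> {i, j, a, d a}")
        case True
        then show ?thesis using vals(1-4) a da ij(3) by auto
      next
        case False
        then show ?thesis using vals(5)[OF False] A(4) by auto
      qed
      then have 1: "{x \<in> A. reconnect i j a d x \<in> A} = ?R" by blast
      have 2: "card (?C A A - {a, d a}) = 2 * (k - of_bool (a \<in> A \<and> d a \<in> A))"
      proof (cases "a \<in> A \<and> d a \<in> A")
        case True
        then have "{a, d a} \<subseteq> ?C A A" using a da by auto
        then have "card (?C A A - {a, d a}) = card (?C A A) - card {a, d a}" by (intro card_Diff_subset) auto
        then show ?thesis using True k da(2) by simp
      next
        case False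
        then have "?C A A - {a, d a} = ?C A A" using da(3) by auto
        then show ?thesis by (simp only: False k of_bool_eq diff_zero)
      qed
      have "card ?R = 2 * (k - of_bool (a \<in> A \<and> d a \<in> A)) + 2 * of_bool (i \<in> A \<and> a \<in> A) + 2 * of_bool (j \<in> A \<and> d a \<in> A)"
      proof -
        have "card ?R = card ((?C A A - {a, d a}) \<union> (if i \<in> A \<and> a \<in> A then {i, a} else {})) + card (if j \<in> A \<and> d a \<in> A then {j, d a} else {})"
          using finC a da ij(3) by (intro card_Un_disjoint) auto
        also have "card ((?C A A - {a, d a}) \<union> (if i \<in> A \<and> a \<in> A then {i, a} else {})) =
            card (?C A A - {a, d a}) + card (if i \<in> A \<and> a \<in> A then {i, a} else {})"
          using finC a da ij(3) by (intro card_Un_disjoint) auto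
        finally show ?thesis unfolding 2 using a da ij(3) by auto
      qed
      then have "card ?R div 2 = k - of_bool (a \<in> A \<and> d a \<in> A) + of_bool (i \<in> A \<and> a \<in> A) + of_bool (j \<in> A \<and> d a \<in> A)"
        by simp
      then show ?thesis by (simp only: v_def 1)
    qed
    have dec: "?S - {i, j} = (?C A A \<union> ?C A A') \<union> (?C A' A \<union> ?C A' A')"
      using D(1) A(4) by blast
    have "(\<Sum>a\<in>?S - {i, j}. v (reconnect i j a d)) =
        ((\<Sum>a\<in>?C A A. v (reconnect i j a d)) + (\<Sum>a\<in>?C A A'. v (reconnect i j a d))) +
        ((\<Sum>a\<in>?C A' A. v (reconnect i j a d)) + (\<Sum>a\<in>?C A' A'. v (reconnect i j a d)))"
    proof -
      have "(\<Sum>a\<in>?S - {i, j}. v (reconnect i j a d)) = (\<Sum>a\<in>(?C A A \<union> ?C A A') \<union> (?C A' A \<union> ?C A' A'). v (reconnect i j a d))"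
        using dec by (rule arg_cong)
      also have "\<dots> = (\<Sum>a\<in>?C A A \<union> ?C A A'. v (reconnect i j a d)) + (\<Sum>a\<in>?C A' A \<union> ?C A' A'. v (reconnect i j a d))"
        using finC A(3) by (intro sum.union_disjoint) auto
      also have "(\<Sum>a\<in>?C A A \<union> ?C A A'. v (reconnect i j a d)) = (\<Sum>a\<in>?C A A. v (reconnect i j a d)) + (\<Sum>a\<in>?C A A'. v (reconnect i j a d))"
        using finC A(3) by (intro sum.union_disjoint) auto
      also have "(\<Sum>a\<in>?C A' A \<union> ?C A' A'. v (reconnect i j a d)) = (\<Sum>a\<in>?C A' A. v (reconnect i j a d)) + (\<Sum>a\<in>?C A' A'. v (reconnect i j a d))"
        using finC A(3) by (intro sum.union_disjoint) auto
      finally show ?thesis .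
    qed
    \<comment> \<open>For \<open>k = 0\<close> this sum is empty, so the truncated
      \<open>k - 1\<close> does no harm.\<close>
    also have "(\<Sum>a\<in>?C A A. v (reconnect i j a d)) = of_nat (2 * k) * gram_weight s (k - 1 + of_bool (i \<in> A) + of_bool (j \<in> A))"
      using rec k by simp
    also have "(\<Sum>a\<in>?C A A'. v (reconnect i j a d)) = of_nat u * gram_weight s (k + of_bool (i \<in> A))"
    proof -
      have "v (reconnect i j a d) = gram_weight s (k + of_bool (i \<in> A))" if "a \<in> ?C A A'" for a
      proof -
        have "d a \<notin> A" using that A(3) by auto
        then show ?thesis using rec[of a] that by simp
      qed
      then show ?thesis by (simp add: u_def)
    qed
    also have "(\<Sum>a\<in>?C A' A. v (reconnect i j a d)) = of_nat u * gram_weight s (k + of_bool (j \<in> A))"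
    proof -
      have "v (reconnect i j a d) = gram_weight s (k + of_bool (j \<in> A))" if "a \<in> ?C A' A" for a
      proof -
        have "a \<notin> A" using that A(3) by auto
        then show ?thesis using rec[of a] that by simp
      qed
      then show ?thesis by (simp add: u'[symmetric])
    qed
    also have "(\<Sum>a\<in>?C A' A'. v (reconnect i j a d)) = of_nat b * gram_weight s k"
    proof -
      have "v (reconnect i j a d) = gram_weight s k" if "a \<in> ?C A' A'" for a
      proof -
        have "a \<notin> A" "d a \<notin> A" using that A(3) by auto
        then show ?thesis using rec[of a] that by simp
      qed
      then show ?thesis by (simp add: b_def)
    qed
    finally have sum: "(\<Sum>a\<in>?S - {i, j}. v (reconnect i j a d)) =
      (of_nat (2 * k) * gram_weight s (k - 1 + of_bool (i \<in> A) + of_bool (j \<in> A)) + of_nat u * gram_weight s (k + of_bool (i \<in> A))) +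
      (of_nat u * gram_weight s (k + of_bool (j \<in> A)) + of_nat b * gram_weight s k)" .
    have cnt': "2 * of_nat k + of_nat u + of_bool (i \<in> A) + of_bool (j \<in> A) = (2 * of_nat s :: complex)"
      "of_nat u + of_nat b + of_bool (i \<in> A') + of_bool (j \<in> A') = (2 * of_nat s :: complex)"
      using arg_cong[OF cnt(1), of "of_nat :: nat \<Rightarrow> complex"] arg_cong[OF cnt(2), of "of_nat :: nat \<Rightarrow> complex"] by simp_all
    have \<delta>: "?\<delta> = 3 - 2 * of_nat s" by simp
    have in_A': "i \<in> A' \<longleftrightarrow> i \<notin> A" "j \<in> A' \<longleftrightarrow> j \<notin> A" using mem ij by auto
    have goal: "cap_coeff ?\<delta> ?S i j v d = (3 - 2 * of_nat s) * gram_weight s (k + of_bool (i \<in> A \<and> j \<in> A)) +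
      ((of_nat (2 * k) * gram_weight s (k - 1 + of_bool (i \<in> A) + of_bool (j \<in> A)) + of_nat u * gram_weight s (k + of_bool (i \<in> A))) +
      (of_nat u * gram_weight s (k + of_bool (j \<in> A)) + of_nat b * gram_weight s k))"
      unfolding cap_coeff_def sum add \<delta> ..
    consider "i \<in> A" "j \<in> A" | "i \<in> A" "j \<notin> A" | "i \<notin> A" "j \<in> A" | "i \<notin> A" "j \<notin> A" by blast
    then show ?thesis
    proof cases
      case 1
      have e: "2 * of_nat k + of_nat u + 2 = (2 * of_nat s :: complex)" "of_nat u + of_nat b = (2 * of_nat s :: complex)"
        using cnt' 1 in_A' by (simp_all add: add_ac)
      have "of_nat (2 * k) * gram_weight s (k - 1 + 1 + 1) = 2 * of_nat k * gram_weight s (Suc k)"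
        by (cases k) (simp_all del: gram_weight.simps)
      then show ?thesis using cap_identity_same[OF e gram_weight_rec] 1 unfolding goal by (simp only: of_bool_eq simp_thms add_0_right Suc_eq_plus1)
    next
      case 2
      have e: "2 * of_nat k + of_nat u + 1 = (2 * of_nat s :: complex)" "of_nat u + of_nat b + 1 = (2 * of_nat s :: complex)"
        using cnt' 2 in_A' by (simp_all add: add_ac)
      have "of_nat (2 * k) * gram_weight s (k - 1 + 1) = 2 * of_nat k * gram_weight s k"
        by (cases k) (simp_all del: gram_weight.simps)
      then show ?thesis using cap_identity_mixed[OF e gram_weight_rec] 2 unfolding goal by (simp only: of_bool_eq simp_thms add_0_right Suc_eq_plus1)
    next
      case 3
      have e: "2 * of_nat k + of_nat u + 1 = (2 * of_nat s :: complex)" "of_nat u + of_nat b + 1 = (2 * of_nat s :: complex)"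
        using cnt' 3 in_A' by (simp_all add: add_ac)
      have "of_nat (2 * k) * gram_weight s (k - 1 + 1) = 2 * of_nat k * gram_weight s k"
        by (cases k) (simp_all del: gram_weight.simps)
      then show ?thesis using cap_identity_mixed[OF e gram_weight_rec] 3 unfolding goal
        by (simp only: of_bool_eq simp_thms add_0_right add_0_left Suc_eq_plus1 add_ac)
    next
      case 4
      then have "u + b + 2 = 2 * s" "2 * k + u = 2 * s" using cnt in_A' by auto
      \<comment> \<open>\<open>A'\<close> has lost \<open>i\<close> and \<open>j\<close>, so the
        points of \<open>A\<close> cannot all find partners there.\<close>
      then have "k \<noteq> 0" by (intro notI) simp
      then obtain l where l: "k = Suc l" by (cases k) auto
      have e: "2 * (of_nat l + 1) + of_nat u = (2 * of_nat s :: complex)" "of_nat u + of_nat b + 2 = (2 * of_nat s :: complex)"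
        using cnt' 4 in_A' l by (simp_all add: algebra_simps)
      have "of_nat (2 * k) = 2 * (of_nat l + 1 :: complex)" by (simp add: l)
      then show ?thesis using cap_identity_same'[OF e gram_weight_rec] 4 unfolding goal
        by (simp only: of_bool_eq simp_thms add_0_right l diff_Suc_1)
    qed
  qed
  have "harmonic ?\<delta> T B v"
    unfolding harmonic_def
  proof (intro ballI impI)
    fix i j d assume ij: "i \<in> B" "j \<in> B" "i \<noteq> j" and d: "d \<in> upward_matchings T (B - {i, j})"
    have eq: "T \<union> (B - {i, j}) = ?S - {i, j}" using ij TB by auto
    have "d \<in> matchings (?S - {i, j})" using upward_matchingsD(1)[OF d] by (simp add: eq)
    then show "cap_coeff ?\<delta> ?S i j v d = 0" using cap ij by auto
  qed
  moreover obtain d where d: "d \<in> upward_matchings T B" "\<And>x. x \<in> A \<Longrightarrow> d x \<in> A'" "\<And>x. x \<in> A' \<Longrightarrow> d x \<in> A"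
    using ex_bipartite_upward[OF A(1-3) _ A(5,6)] A(7,8) by auto
  moreover have "v d \<noteq> 0"
  proof -
    have e: "{x \<in> A. d x \<in> A} = {}" using d(2) A(3) by blast
    show ?thesis unfolding v_def e by simp
  qed
  ultimately show ?thesis unfolding has_harmonic_def by blast
qed

text \<open>Twelve points in three rows of four: the square of the Gram determinant of three vectors is
  harmonic in dimension \<open>0\<close>. The weights are its coefficients when the third row and one further
  point are tops.\<close>

definition zero_weight :: "nat \<Rightarrow> nat \<Rightarrow> complex" where
  "zero_weight a k = (if a = 1 then (if k = 2 then 2 else - 3) else (if k = 2 then 2 else if k = 3 then - 3 else 12))"

text \<open>The factors \<open>k\<close> and \<open>4 - k\<close> are the numbers of tops of
  \<open>C\<close> joined to \<open>A\<close> and to the rest. Since \<open>a, i, j\<close>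
  determine \<open>k\<close>, eight numerical checks suffice.\<close>

lemma zero_weight_identity:
  assumes "a \<le> 1" "i \<le> 1" "j \<le> 1" "a + k + i + j = (4 :: nat)"
  shows "zero_weight i k + zero_weight j k +
    (of_nat k * (zero_weight a (k - 1 + i) + zero_weight a (k - 1 + j)) +
     of_nat (4 - k) * (zero_weight a (k + i) + zero_weight a (k + j))) = 0"
proof -
  have "a = 0 \<or> a = 1" "i = 0 \<or> i = 1" "j = 0 \<or> j = 1" using assms by linarith+
  moreover have "k = 4 - a - i - j" using assms by linarith
  ultimately show ?thesis by (elim disjE) (simp_all add: zero_weight_def)
qed

text \<open>The rows are \<open>A\<close>, the tops \<open>C\<close>, and \<open>t0\<close> with the
  three other bottoms. After a cap no cup is left, so the points to reconnect at come in pairs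
  \<open>t, d t\<close>, which send the top \<open>t\<close> to \<open>i\<close> or to
  \<open>j\<close>. The weight sees only whether \<open>t0\<close> is joined to \<open>A\<close> and
  how many tops of \<open>C\<close> are.\<close>

lemma has_harmonic_zero_seven:
  fixes T B :: "'a set"
  assumes fin: "finite T" "finite B" and TB: "T \<inter> B = {}" and c: "card T = 5" "card B = 7"
  shows "has_harmonic 0 T B"
proof -
  obtain t0 where t0: "t0 \<in> T" using c(1) by (metis card.empty ex_in_conv zero_neq_numeral)
  define C where "C = T - {t0}"
  have C: "T = insert t0 C" "t0 \<notin> C" "finite C" "card C = 4" using t0 c(1) fin by (auto simp: C_def)
  obtain A where A: "A \<subseteq> B" "card A = 4" by (rule obtain_subset_with_card_n[of 4 B]) (use c in auto)
  have finA: "finite A" using A fin by (auto intro: finite_subset)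
  let ?K = "\<lambda>d. card {c \<in> C. d c \<in> A}" and ?a = "\<lambda>x. of_bool (x \<in> A) :: nat"
  define v where "v d = zero_weight (?a (d t0)) (?K d)" for d :: "'a \<Rightarrow> 'a"
  have "harmonic 0 T B v"
    unfolding harmonic_def
  proof (intro ballI impI)
    fix i j d assume ij: "i \<in> B" "j \<in> B" "i \<noteq> j" and d: "d \<in> upward_matchings T (B - {i, j})"
    note D = matchingsD[OF upward_matchingsD(1)[OF d]]
    have dT: "d ` T \<subseteq> B - {i, j}" using upward_matchingsD(2)[OF d] by auto
    have inj: "inj_on d T" using matchings_eq_iff[OF upward_matchingsD(1)[OF d]] by (auto simp: inj_on_def)
    have dT_eq: "d ` T = B - {i, j}"
      using dT inj fin c ij by (intro card_subset_eq) (auto simp: card_image card_Diff_subset)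
    have S: "T \<union> B - {i, j} = T \<union> d ` T" using dT_eq TB ij by auto
    have disj: "T \<inter> d ` T = {}" using dT TB by auto
    have ijT: "i \<notin> T" "j \<notin> T" using ij TB by auto
    have vals: "reconnect i j t d t = i" "reconnect i j (d t) d t = j"
      "\<And>x. x \<in> T \<Longrightarrow> x \<noteq> t \<Longrightarrow> reconnect i j t d x = d x" "\<And>x. x \<in> T \<Longrightarrow> x \<noteq> t \<Longrightarrow> reconnect i j (d t) d x = d x"
      if t: "t \<in> T" for t
    proof -
      have "d t \<in> B" "d t \<notin> {i, j}" "d t \<notin> T" "d (d t) = t" using dT t TB D(3)[of t] by auto
      then show "reconnect i j t d t = i" "reconnect i j (d t) d t = j"
        "\<And>x. x \<in> T \<Longrightarrow> x \<noteq> t \<Longrightarrow> reconnect i j t d x = d x" "\<And>x. x \<in> T \<Longrightarrow> x \<noteq> t \<Longrightarrow> reconnect i j (d t) d x = d x"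
        using ijT t by (auto simp: reconnect_def)
    qed
    let ?k = "?K d"
    have upd_C: "?K e = ?k - ?a (d x) + ?a y" if x: "x \<in> C" and e: "e x = y" "\<And>z. z \<in> T \<Longrightarrow> z \<noteq> x \<Longrightarrow> e z = d z" for e x y
    proof -
      have "{c \<in> C. e c \<in> A} = ({c \<in> C. d c \<in> A} - {x}) \<union> (if y \<in> A then {x} else {})" (is "?L = ?R")
      proof (rule Set.set_eqI)
        fix z
        show "z \<in> {c \<in> C. e c \<in> A} \<longleftrightarrow> z \<in> ({c \<in> C. d c \<in> A} - {x}) \<union> (if y \<in> A then {x} else {})"
          using x e(1) e(2)[of z] C(1) by (cases "z = x") auto
      qed
      also have "card \<dots> = card ({c \<in> C. d c \<in> A} - {x}) + ?a y" using C(3) by (subst card_Un_disjoint) auto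
      also have "card ({c \<in> C. d c \<in> A} - {x}) = ?k - ?a (d x)"
        using x C(3) by (auto simp: card_Diff_singleton_if)
      finally show ?thesis .
    qed
    have upd_t0: "?K e = ?k" if e: "\<And>z. z \<in> T \<Longrightarrow> z \<noteq> t0 \<Longrightarrow> e z = d z" for e
    proof -
      have "e c = d c" if "c \<in> C" for c using e[of c] that C(1,2) by auto
      then have "{c \<in> C. e c \<in> A} = {c \<in> C. d c \<in> A}" by auto
      then show ?thesis by simp
    qed
    have t0_sum: "v (reconnect i j t0 d) + v (reconnect i j (d t0) d) = zero_weight (?a i) ?k + zero_weight (?a j) ?k"
      using vals[OF t0] upd_t0[of "reconnect i j t0 d"] upd_t0[of "reconnect i j (d t0) d"] by (simp add: v_def)
    have C_sum: "v (reconnect i j x d) + v (reconnect i j (d x) d) =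
        zero_weight (?a (d t0)) (?k - ?a (d x) + ?a i) + zero_weight (?a (d t0)) (?k - ?a (d x) + ?a j)" if x: "x \<in> C" for x
    proof -
      have xT: "x \<in> T" "t0 \<noteq> x" using x C by auto
      show ?thesis
        using upd_C[OF x vals(1)[OF xT(1)] vals(3)[OF xT(1)]] upd_C[OF x vals(2)[OF xT(1)] vals(4)[OF xT(1)]]
          vals(3,4)[OF xT(1) t0 xT(2)] by (simp add: v_def)
    qed
    \<comment> \<open>Each of the four points of \<open>A\<close> is joined to a top or is one of
      \<open>i, j\<close>.\<close>
    have cnt: "?a (d t0) + ?k + ?a i + ?a j = 4"
    proof -
      have "A \<subseteq> d ` T \<union> {i, j}" unfolding dT_eq using A(1) by blast
      then have "A = d ` {x \<in> T. d x \<in> A} \<union> (A \<inter> {i, j})" by auto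
      moreover have "d ` {x \<in> T. d x \<in> A} \<inter> (A \<inter> {i, j}) = {}" using dT by auto
      ultimately have "4 = card (d ` {x \<in> T. d x \<in> A}) + card (A \<inter> {i, j})"
        using A(2) finA fin by (metis (no_types, lifting) card_Un_disjoint finite_Int finite_Un)
      also have "card (A \<inter> {i, j}) = ?a i + ?a j" using ij(3) by auto
      also have "card (d ` {x \<in> T. d x \<in> A}) = card {x \<in> T. d x \<in> A}"
        using inj by (intro card_image) (auto simp: inj_on_def)
      also have "{x \<in> T. d x \<in> A} = {c \<in> C. d c \<in> A} \<union> (if d t0 \<in> A then {t0} else {})" using C by auto
      also have "card \<dots> = ?k + ?a (d t0)" using C by (subst card_Un_disjoint) auto
      finally show ?thesis by simp
    qed
    have "(\<Sum>a\<in>T \<union> B - {i, j}. v (reconnect i j a d)) = (\<Sum>x\<in>T. v (reconnect i j x d)) + (\<Sum>x\<in>d ` T. v (reconnect i j x d))"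
      unfolding S using disj fin by (intro sum.union_disjoint) auto
    also have "\<dots> = (\<Sum>x\<in>T. v (reconnect i j x d) + v (reconnect i j (d x) d))"
      using inj by (simp add: sum.reindex sum.distrib)
    also have "\<dots> = zero_weight (?a i) ?k + zero_weight (?a j) ?k + (\<Sum>x\<in>C. v (reconnect i j x d) + v (reconnect i j (d x) d))"
      unfolding C(1) using C(2,3) t0_sum by simp
    also have "(\<Sum>x\<in>C. v (reconnect i j x d) + v (reconnect i j (d x) d)) =
       (\<Sum>x\<in>C. zero_weight (?a (d t0)) (?k - ?a (d x) + ?a i) + zero_weight (?a (d t0)) (?k - ?a (d x) + ?a j))"
      using C_sum by simp
    also have "\<dots> = of_nat ?k * (zero_weight (?a (d t0)) (?k - 1 + ?a i) + zero_weight (?a (d t0)) (?k - 1 + ?a j)) +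
      of_nat (4 - ?k) * (zero_weight (?a (d t0)) (?k + ?a i) + zero_weight (?a (d t0)) (?k + ?a j))"
    proof -
      have "C = {c \<in> C. d c \<in> A} \<union> {c \<in> C. d c \<notin> A}" "{c \<in> C. d c \<in> A} \<inter> {c \<in> C. d c \<notin> A} = {}" by auto
      moreover from this C have "card {c \<in> C. d c \<notin> A} = 4 - ?k"
        by (metis (no_types, lifting) add_diff_cancel_left' card_Un_disjoint finite_Un)
      ultimately show ?thesis
        using sum.union_disjoint[of "{c \<in> C. d c \<in> A}" "{c \<in> C. d c \<notin> A}"
          "\<lambda>x. zero_weight (?a (d t0)) (?k - ?a (d x) + ?a i) + zero_weight (?a (d t0)) (?k - ?a (d x) + ?a j)"] C(3) by simp
    qed
    finally show "cap_coeff 0 (T \<union> B) i j v d = 0"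
      using zero_weight_identity[OF _ _ _ cnt] by (simp add: cap_coeff_def)
  qed
  moreover obtain d where d: "d \<in> upward_matchings T B" using ex_upward_matching[OF fin TB] c by auto
  moreover have "v d \<noteq> 0" by (simp add: v_def zero_weight_def)
  ultimately show ?thesis unfolding has_harmonic_def by blast
qed

section \<open>Stacked diagrams\<close>

definition adjacent :: "'a set set \<Rightarrow> ('a \<times> 'a) set" where
  "adjacent E = {(u, v). \<exists>e\<in>E. u \<in> e \<and> v \<in> e}"

lemma components_adjacent: "components E = \<Union>E // (adjacent E)\<^sup>*"
  by (simp add: components_def adjacent_def)

lemma sym_adjacent_rtrancl: "(u, v) \<in> (adjacent E)\<^sup>* \<Longrightarrow> (v, u) \<in> (adjacent E)\<^sup>*"
proof -
  have "sym (adjacent E)" by (auto simp: adjacent_def sym_def)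
  then show "(u, v) \<in> (adjacent E)\<^sup>* \<Longrightarrow> (v, u) \<in> (adjacent E)\<^sup>*"
    using sym_rtrancl by (metis symD)
qed

lemma adjacentI: "e \<in> E \<Longrightarrow> u \<in> e \<Longrightarrow> v \<in> e \<Longrightarrow> (u, v) \<in> (adjacent E)\<^sup>*"
  by (auto simp: adjacent_def)

lemma components_image: "components E = (\<lambda>u. (adjacent E)\<^sup>* `` {u}) ` \<Union>E"
  by (auto simp: components_adjacent quotient_def)

lemma component_connected:
  assumes "C \<in> components E" "u \<in> C" "v \<in> C"
  shows "(u, v) \<in> (adjacent E)\<^sup>*"
proof -
  obtain r where "C = (adjacent E)\<^sup>* `` {r}" using assms(1) by (auto simp: components_image)
  then have "(r, u) \<in> (adjacent E)\<^sup>*" "(r, v) \<in> (adjacent E)\<^sup>*" using assms by auto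
  then show ?thesis using sym_adjacent_rtrancl by (metis rtrancl_trans)
qed

lemma component_closed:
  assumes "C \<in> components E" "u \<in> C" "(u, v) \<in> (adjacent E)\<^sup>*"
  shows "v \<in> C"
proof -
  obtain r where "C = (adjacent E)\<^sup>* `` {r}" using assms(1) by (auto simp: components_image)
  then show ?thesis using assms(2,3) by (auto intro: rtrancl_trans)
qed

lemma component_disjoint:
  assumes "C \<in> components E" "D \<in> components E" "u \<in> C" "u \<in> D"
  shows "C = D"
  using assms component_connected component_closed by (metis subsetI subset_antisym)

lemma component_nonempty: "C \<in> components E \<Longrightarrow> C \<noteq> {}"
  by (auto simp: components_image)

lemma Union_components: "\<Union>(components E) = \<Union>E"
proof -
  have "v \<in> \<Union>E" if "(u, v) \<in> (adjacent E)\<^sup>*" "u \<in> \<Union>E" for u v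
    using that by (induction rule: rtrancl_induct) (auto simp: adjacent_def)
  then show ?thesis by (fastforce simp: components_image)
qed

lemma edge_in_component:
  assumes "C \<in> components E" "e \<in> E" "u \<in> e" "u \<in> C"
  shows "e \<subseteq> C"
  using component_closed[OF assms(1,4)] adjacentI[OF assms(2,3)] by blast

lemma finite_components: "finite (\<Union>E) \<Longrightarrow> finite (components E)"
  by (simp add: components_image)

text \<open>A partition into connected sets that no edge crosses is the partition into components.
  All component computations below produce such a partition explicitly.\<close>

lemma components_eqI:
  assumes un: "\<Union>P = \<Union>E" and disj: "\<And>C D u. C \<in> P \<Longrightarrow> D \<in> P \<Longrightarrow> u \<in> C \<Longrightarrow> u \<in> D \<Longrightarrow> C = D"
    and ne: "\<And>C. C \<in> P \<Longrightarrow> C \<noteq> {}"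
    and edge: "\<And>e. e \<in> E \<Longrightarrow> e \<noteq> {} \<Longrightarrow> \<exists>C\<in>P. e \<subseteq> C"
    and conn: "\<And>C u v. C \<in> P \<Longrightarrow> u \<in> C \<Longrightarrow> v \<in> C \<Longrightarrow> (u, v) \<in> (adjacent E)\<^sup>*"
  shows "components E = P"
proof -
  have cl: "v \<in> C" if "(u, v) \<in> (adjacent E)\<^sup>*" "C \<in> P" "u \<in> C" for u v C
    using that
  proof (induction rule: rtrancl_induct)
    case (step y z)
    then obtain e where e: "e \<in> E" "y \<in> e" "z \<in> e" by (auto simp: adjacent_def)
    then obtain D where "D \<in> P" "e \<subseteq> D" using edge[of e] by blast
    then show ?case using disj[of C D y] step e by auto
  qed
  have eq: "(adjacent E)\<^sup>* `` {u} = C" if "C \<in> P" "u \<in> C" for C u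
    using cl[of u _ C] conn[of C u] that by blast
  show ?thesis
  proof (intro equalityI subsetI)
    fix C assume "C \<in> components E"
    then obtain u where u: "u \<in> \<Union>E" "C = (adjacent E)\<^sup>* `` {u}" by (auto simp: components_image)
    then obtain D where "D \<in> P" "u \<in> D" using un by blast
    then show "C \<in> P" using eq u by simp
  next
    fix C assume C: "C \<in> P"
    then obtain u where "u \<in> C" using ne by blast
    then have "u \<in> \<Union>E" "C = (adjacent E)\<^sup>* `` {u}" using un eq C by auto
    then show "C \<in> components E" by (auto simp: components_image)
  qed
qed

lemma components_insert_isolated:
  assumes "x \<notin> \<Union>E" "y \<notin> \<Union>E"
  shows "components (insert {x, y} E) = insert {x, y} (components E)"
proof (rule components_eqI)
  have sub: "(adjacent E)\<^sup>* \<subseteq> (adjacent (insert {x, y} E))\<^sup>*" by (rule rtrancl_mono) (auto simp: adjacent_def)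
  show "\<Union>(insert {x, y} (components E)) = \<Union>(insert {x, y} E)" using Union_components[of E] by simp
  have notin: "x \<notin> C" "y \<notin> C" if "C \<in> components E" for C using Union_components[of E] assms that by auto
  show "C = D" if "C \<in> insert {x, y} (components E)" "D \<in> insert {x, y} (components E)" "u \<in> C" "u \<in> D" for C D u
    using that notin component_disjoint[of C E D u] by auto
  show "C \<noteq> {}" if "C \<in> insert {x, y} (components E)" for C using that component_nonempty by auto
  show "\<exists>C\<in>insert {x, y} (components E). e \<subseteq> C" if "e \<in> insert {x, y} E" for e
  proof (cases "e = {x, y} \<or> e = {}")
    case False
    then have "e \<in> E" "e \<noteq> {}" using that by auto
    then obtain u where u: "u \<in> e" "e \<in> E" by auto
    then obtain C where "C \<in> components E" "u \<in> C" using Union_components[of E] by blast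
    then show ?thesis using edge_in_component[of C E e u] u by auto
  qed auto
  show "(u, v) \<in> (adjacent (insert {x, y} E))\<^sup>*" if "C \<in> insert {x, y} (components E)" "u \<in> C" "v \<in> C" for C u v
    using that component_connected[of C E u v] sub adjacentI[of "{x, y}" "insert {x, y} E" u v] by auto
qed

text \<open>The path \<open>a, x, y, b\<close> is replaced by the edge \<open>a, b\<close>.\<close>

lemma components_contract:
  fixes x y a b :: 'a
  assumes xy: "x \<notin> \<Union>E" "y \<notin> \<Union>E" "a \<notin> {x, y}" "b \<notin> {x, y}"
  defines "E1 \<equiv> E \<union> {{x, y}, {x, a}, {y, b}}" and "E2 \<equiv> insert {a, b} E"
  shows "components E1 = (\<lambda>C. if a \<in> C then C \<union> {x, y} else C) ` components E2"
proof (rule components_eqI)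
  let ?f = "\<lambda>C. if a \<in> C then C \<union> {x, y} else C"
  have notin: "x \<notin> C" "y \<notin> C" if "C \<in> components E2" for C
    using Union_components[of E2] xy that unfolding E2_def by auto
  obtain A where A: "A \<in> components E2" "a \<in> A" using Union_components[of E2] by (auto simp: E2_def)
  have bA: "b \<in> A" using edge_in_component[OF A(1), of "{a, b}" a] A(2) by (auto simp: E2_def)
  have only: "C = A" if "C \<in> components E2" "a \<in> C" for C using component_disjoint[OF that(1) A(1) that(2) A(2)] .
  have path: "(a, x) \<in> (adjacent E1)\<^sup>*" "(x, y) \<in> (adjacent E1)\<^sup>*" "(y, b) \<in> (adjacent E1)\<^sup>*"
    using adjacentI[of "{x, a}" E1 a x] adjacentI[of "{x, y}" E1 x y] adjacentI[of "{y, b}" E1 y b] by (auto simp: E1_def)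
  have ab: "(a, b) \<in> (adjacent E1)\<^sup>*" using path by (meson rtrancl_trans)
  have sub: "(adjacent E2)\<^sup>* \<subseteq> (adjacent E1)\<^sup>*"
  proof -
    have "adjacent E2 \<subseteq> (adjacent E1)\<^sup>*"
    proof
      fix q assume "q \<in> adjacent E2"
      then obtain u v e where q: "q = (u, v)" "e \<in> E2" "u \<in> e" "v \<in> e" by (auto simp: adjacent_def)
      show "q \<in> (adjacent E1)\<^sup>*"
      proof (cases "e = {a, b}")
        case True
        then show ?thesis using q ab sym_adjacent_rtrancl[OF ab] by auto
      next
        case False
        then show ?thesis using q adjacentI[of e E1 u v] by (auto simp: E1_def E2_def)
      qed
    qed
    then show ?thesis by (metis rtrancl_idemp rtrancl_mono)
  qed
  show "\<Union>(?f ` components E2) = \<Union>E1"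
  proof -
    have "\<Union>(?f ` components E2) = \<Union>(components E2) \<union> {x, y}" using A by auto
    also have "\<dots> = \<Union>E1" unfolding Union_components by (auto simp: E1_def E2_def)
    finally show ?thesis .
  qed
  show "C = D" if CD: "C \<in> ?f ` components E2" "D \<in> ?f ` components E2" "u \<in> C" "u \<in> D" for C D u
  proof -
    obtain C' D' where C': "C' \<in> components E2" "C = ?f C'" and D': "D' \<in> components E2" "D = ?f D'" using CD by auto
    show ?thesis
    proof (cases "u \<in> {x, y}")
      case True
      then have "a \<in> C'" "a \<in> D'" using C' D' CD(3,4) notin by (auto split: if_splits)
      then show ?thesis using only C' D' by metis
    next
      case False
      then have "u \<in> C'" "u \<in> D'" using C' D' CD(3,4) by (auto split: if_splits)
      then show ?thesis using component_disjoint[OF C'(1) D'(1)] C' D' by auto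
    qed
  qed
  show "C \<noteq> {}" if "C \<in> ?f ` components E2" for C using that component_nonempty by auto
  show "\<exists>C\<in>?f ` components E2. e \<subseteq> C" if "e \<in> E1" for e
  proof (cases "e \<in> E \<and> e \<noteq> {}")
    case True
    then obtain u where u: "u \<in> e" by auto
    then obtain C where "C \<in> components E2" "u \<in> C" using Union_components[of E2] True by (auto simp: E2_def)
    then have "e \<subseteq> C" "C \<in> components E2" using edge_in_component[of C E2 e u] u True by (auto simp: E2_def)
    then show ?thesis by (intro bexI[of _ "?f C"]) auto
  next
    case False
    then have "e \<subseteq> ?f A" using that A bA by (auto simp: E1_def)
    then show ?thesis using A(1) by blast
  qed
  show "(u, v) \<in> (adjacent E1)\<^sup>*" if C: "C \<in> ?f ` components E2" "u \<in> C" "v \<in> C" for C u v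
  proof -
    obtain C' where C': "C' \<in> components E2" "C = ?f C'" using C by auto
    have in_C': "(p, q) \<in> (adjacent E1)\<^sup>*" if "p \<in> C'" "q \<in> C'" for p q
      using component_connected[OF C'(1) that] sub by auto
    show ?thesis
    proof (cases "a \<in> C'")
      case False
      then show ?thesis using C C' in_C' by simp
    next
      case True
      have to_a: "(a, q) \<in> (adjacent E1)\<^sup>*" if "q \<in> C" for q
        using that C' True in_C'[of a q] path by (auto intro: rtrancl_trans)
      show ?thesis using to_a[OF C(2)] to_a[OF C(3)] sym_adjacent_rtrancl by (metis rtrancl_trans)
    qed
  qed
qed

definition tops :: "nat \<Rightarrow> point set" where
  "tops p = Top ` {1..p}"

definition edges :: "'a set \<Rightarrow> ('a \<Rightarrow> 'a) \<Rightarrow> 'a set set" where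
  "edges S u = (\<lambda>x. {x, u x}) ` S"

fun in_flipped :: "point \<Rightarrow> stacked_point" where
  "in_flipped (Top i) = Lower i"
| "in_flipped (Bot i) = Middle i"

text \<open>\<open>u\<close> lies above the mirror image of \<open>w\<close>. Mirroring and placing
  are merged in \<open>in_flipped\<close>, so that both diagrams are matchings of the same set
  \<open>S\<close>.\<close>

definition stack :: "point set \<Rightarrow> (point \<Rightarrow> point) \<Rightarrow> (point \<Rightarrow> point) \<Rightarrow> stacked_point set set" where
  "stack S w u = (`) in_upper ` edges S u \<union> (`) in_flipped ` edges S w"

definition trace :: "stacked_point set \<Rightarrow> point set" where
  "trace C = {Top i |i. Upper i \<in> C} \<union> {Bot i |i. Lower i \<in> C}"

definition loops :: "stacked_point set set \<Rightarrow> stacked_point set set" where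
  "loops E = {C \<in> components E. C \<subseteq> range Middle}"

definition traces :: "stacked_point set set \<Rightarrow> point set set" where
  "traces E = trace ` (components E - loops E)"

lemma stacked_edges_flip: "stacked_edges (flip (edges S w)) (edges S u) = stack S w u"
proof -
  have "in_lower \<circ> flip_point = in_flipped"
  proof
    show "(in_lower \<circ> flip_point) x = in_flipped x" for x by (cases x) auto
  qed
  then have "in_lower ` flip_point ` e = in_flipped ` e" for e by (metis image_comp)
  then show ?thesis by (auto simp: stacked_edges_def flip_def stack_def image_image)
qed

lemma closed_loops_flip: "closed_loops (flip (edges S w)) (edges S u) = loops (stack S w u)"
  by (simp add: closed_loops_def stacked_edges_flip loops_def)

lemma compose_flip: "compose_diagram (flip (edges S w)) (edges S u) = traces (stack S w u)"
  by (simp add: compose_diagram_def closed_loops_flip stacked_edges_flip traces_def trace_def[abs_def])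

lemma in_upper_eq_Middle: "in_upper x = Middle i \<longleftrightarrow> x = Bot i"
  by (cases x) auto

lemma in_flipped_eq_Middle: "in_flipped x = Middle i \<longleftrightarrow> x = Bot i"
  by (cases x) auto

lemma loops_insert_isolated:
  assumes "Middle i \<notin> \<Union>E" "Middle j \<notin> \<Union>E" "finite (\<Union>E)"
  shows "card (loops (insert {Middle i, Middle j} E)) = Suc (card (loops E))"
    "traces (insert {Middle i, Middle j} E) = traces E"
proof -
  have c: "components (insert {Middle i, Middle j} E) = insert {Middle i, Middle j} (components E)"
    by (rule components_insert_isolated[OF assms(1,2)])
  have l: "loops (insert {Middle i, Middle j} E) = insert {Middle i, Middle j} (loops E)"
    unfolding loops_def c by auto
  have notin: "{Middle i, Middle j} \<notin> components E" using Union_components[of E] assms by auto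
  then have "{Middle i, Middle j} \<notin> loops E" by (auto simp: loops_def)
  moreover have "finite (loops E)" using finite_components[OF assms(3)] by (simp add: loops_def)
  ultimately show "card (loops (insert {Middle i, Middle j} E)) = Suc (card (loops E))" by (simp add: l)
  show "traces (insert {Middle i, Middle j} E) = traces E"
    unfolding traces_def c l using notin by (metis (no_types, opaque_lifting) Diff_insert2 Diff_insert_absorb insert_Diff1 insertI1)
qed

lemma loops_contract:
  assumes "Middle i \<notin> \<Union>E" "Middle j \<notin> \<Union>E" "a \<notin> {Middle i, Middle j}" "b \<notin> {Middle i, Middle j}"
  shows "card (loops (E \<union> {{Middle i, Middle j}, {Middle i, a}, {Middle j, b}})) = card (loops (insert {a, b} E))"
    "traces (E \<union> {{Middle i, Middle j}, {Middle i, a}, {Middle j, b}}) = traces (insert {a, b} E)"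
proof -
  let ?E1 = "E \<union> {{Middle i, Middle j}, {Middle i, a}, {Middle j, b}}" and ?E2 = "insert {a, b} E"
  let ?f = "\<lambda>C. if a \<in> C then C \<union> {Middle i, Middle j} else C"
  have c: "components ?E1 = ?f ` components ?E2" by (rule components_contract[OF assms])
  have notin: "Middle i \<notin> C" "Middle j \<notin> C" if "C \<in> components ?E2" for C
    using Union_components[of ?E2] assms that by auto
  have "?f C - {Middle i, Middle j} = C" if "C \<in> components ?E2" for C using notin[OF that] by auto
  then have inj: "inj_on ?f (components ?E2)" by (rule inj_on_inverseI)
  have mid: "?f C \<subseteq> range Middle \<longleftrightarrow> C \<subseteq> range Middle" for C by auto
  have image_Collect: "{C \<in> g ` A. P C} = g ` {C \<in> A. P (g C)}" for g :: "stacked_point set \<Rightarrow> stacked_point set" and A P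
    by auto
  have l: "loops ?E1 = ?f ` loops ?E2" unfolding loops_def c image_Collect mid ..
  have sub: "loops ?E2 \<subseteq> components ?E2" unfolding loops_def by (rule Collect_subset)
  show "card (loops ?E1) = card (loops ?E2)" unfolding l by (rule card_image[OF inj_on_subset[OF inj sub]])
  have e: "components ?E1 - loops ?E1 = ?f ` (components ?E2 - loops ?E2)"
    unfolding l c using inj_on_image_set_diff[OF inj _ sub] by simp
  have tr: "trace (?f C) = trace C" for C by (auto simp: trace_def)
  show "traces ?E1 = traces ?E2" unfolding traces_def e image_image tr ..
qed

section \<open>Removing a cup of the lower diagram\<close>

definition unpair :: "'a \<Rightarrow> 'a \<Rightarrow> ('a \<Rightarrow> 'a) \<Rightarrow> 'a \<Rightarrow> 'a" where
  "unpair i j u = u(i := i, j := j)"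

text \<open>The effect on \<open>u\<close> of a cap on \<open>i, j\<close> that closes no loop:
  their partners become joined. \<open>reconnect\<close> undoes it once the partner of
  \<open>i\<close> is known.\<close>

definition contract :: "'a \<Rightarrow> 'a \<Rightarrow> ('a \<Rightarrow> 'a) \<Rightarrow> 'a \<Rightarrow> 'a" where
  "contract i j u = u(i := i, j := j, u i := u j, u j := u i)"

lemma matchings_unpair:
  assumes u: "u \<in> matchings S" and "u i = j"
  shows "unpair i j u \<in> matchings (S - {i, j})"
proof -
  note U = matchingsD[OF u]
  have ji: "u j = i" using U(3)[of i] assms(2) by simp
  have "u x \<noteq> i" "u x \<noteq> j" if "x \<noteq> i" "x \<noteq> j" for x using U(3)[of x] that ji assms(2) by auto
  then show ?thesis using U by (auto simp: matchings_def unpair_def)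
qed

lemma matchings_contract:
  assumes u: "u \<in> matchings S" and ij: "i \<in> S" "j \<in> S" "i \<noteq> j" "u i \<noteq> j"
  shows "contract i j u \<in> matchings (S - {i, j})"
proof -
  note U = matchingsD[OF u]
  let ?a = "u i" and ?b = "u j"
  have ab: "?a \<in> S" "?b \<in> S" "?a \<noteq> i" "?b \<noteq> j" "u ?a = i" "u ?b = j" "?b \<noteq> i" "?a \<noteq> ?b"
    using U ij by metis+
  have vals: "contract i j u i = i" "contract i j u j = j" "contract i j u ?a = ?b" "contract i j u ?b = ?a"
    "\<And>x. x \<notin> {i, j, ?a, ?b} \<Longrightarrow> contract i j u x = u x"
    using ab ij by (auto simp: contract_def)
  have "contract i j u x \<in> S - {i, j} \<and> contract i j u x \<noteq> x \<and> contract i j u (contract i j u x) = x" if x: "x \<in> S - {i, j}" for x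
  proof (cases "x = ?a \<or> x = ?b")
    case True
    then show ?thesis using vals(3,4) ab ij by auto
  next
    case False
    then have n: "x \<notin> {i, j, ?a, ?b}" using x by auto
    then have "u x \<notin> {i, j, ?a, ?b}" using U(3)[of x] U(3)[of i] U(3)[of j] by auto
    then show ?thesis using vals(5)[OF n] vals(5)[of "u x"] U(1,2,3)[of x] x by auto
  qed
  moreover have "contract i j u x = x" if "x \<notin> S - {i, j}" for x
  proof (cases "x \<in> {i, j}")
    case False
    then have "x \<notin> S" using that by auto
    then have "x \<notin> {i, j, ?a, ?b}" using ab ij by auto
    then show ?thesis using vals(5) U(4) \<open>x \<notin> S\<close> by auto
  qed (use vals in auto)
  ultimately show ?thesis by (simp add: matchings_def)
qed

lemma Union_edges:
  assumes "u \<in> matchings S"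
  shows "\<Union>(edges S u) = S"
  using matchingsD(1)[OF assms] by (auto simp: edges_def)

lemma edges_cong: "(\<And>x. x \<in> S \<Longrightarrow> u x = u' x) \<Longrightarrow> edges S u = edges S u'"
  by (auto simp: edges_def)

lemma edges_unpair:
  assumes u: "u \<in> matchings S" and ij: "i \<in> S" "u i = j"
  shows "edges S u = insert {i, j} (edges (S - {i, j}) (unpair i j u))"
proof -
  have ji: "u j = i" "j \<in> S" using matchingsD(1,3)[OF u, of i] ij by auto
  then have S: "S = {i, j} \<union> (S - {i, j})" using ij by auto
  have "edges S u = edges {i, j} u \<union> edges (S - {i, j}) u" using S by (metis edges_def image_Un)
  also have "edges {i, j} u = {{i, j}}" using ij ji by (auto simp: edges_def)
  also have "edges (S - {i, j}) u = edges (S - {i, j}) (unpair i j u)" by (rule edges_cong) (auto simp: unpair_def)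
  finally show ?thesis by simp
qed

lemma edges_contract:
  assumes u: "u \<in> matchings S" and ij: "i \<in> S" "j \<in> S" "i \<noteq> j" "u i \<noteq> j"
  defines "F \<equiv> edges (S - {i, j, u i, u j}) u"
  shows "edges S u = F \<union> {{i, u i}, {j, u j}}" "edges (S - {i, j}) (contract i j u) = insert {u i, u j} F"
    "i \<notin> \<Union>F" "j \<notin> \<Union>F"
proof -
  note U = matchingsD[OF u]
  let ?a = "u i" and ?b = "u j"
  have ab: "?a \<in> S" "?b \<in> S" "?a \<noteq> i" "?b \<noteq> j" "u ?a = i" "u ?b = j" "?b \<noteq> i" "?a \<noteq> ?b"
    using U ij by metis+
  have "S = {i, j, ?a, ?b} \<union> (S - {i, j, ?a, ?b})" using ab ij by auto
  then have "edges S u = edges {i, j, ?a, ?b} u \<union> F" unfolding F_def by (metis edges_def image_Un)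
  also have "edges {i, j, ?a, ?b} u = {{i, ?a}, {j, ?b}}" using ab by (auto simp: edges_def)
  finally show "edges S u = F \<union> {{i, u i}, {j, u j}}" by auto
  have "S - {i, j} = {?a, ?b} \<union> (S - {i, j, ?a, ?b})" using ab ij by auto
  then have "edges (S - {i, j}) (contract i j u) = edges {?a, ?b} (contract i j u) \<union> edges (S - {i, j, ?a, ?b}) (contract i j u)"
    by (metis edges_def image_Un)
  also have "edges {?a, ?b} (contract i j u) = {{?a, ?b}}" using ab ij by (auto simp: edges_def contract_def)
  also have "edges (S - {i, j, ?a, ?b}) (contract i j u) = F"
    unfolding F_def by (rule edges_cong) (auto simp: contract_def)
  finally show "edges (S - {i, j}) (contract i j u) = insert {u i, u j} F" by simp
  have "u x \<noteq> i" "u x \<noteq> j" if "x \<notin> {?a, ?b}" for x using U(3)[of x] that by auto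
  then show "i \<notin> \<Union>F" "j \<notin> \<Union>F" by (auto simp: F_def edges_def)
qed

lemma Middle_stack:
  assumes "u \<in> matchings S" "w \<in> matchings S" "Bot i \<notin> S"
  shows "Middle i \<notin> \<Union>(stack S w u)"
proof
  assume "Middle i \<in> \<Union>(stack S w u)"
  then have "Bot i \<in> \<Union>(edges S u) \<or> Bot i \<in> \<Union>(edges S w)"
    unfolding stack_def using in_upper_eq_Middle in_flipped_eq_Middle by (auto dest!: sym[of "Middle i"])
  then show False using Union_edges assms by metis
qed

lemma finite_stack: "finite S \<Longrightarrow> finite (\<Union>(stack S w u))"
  by (auto simp: stack_def edges_def)

text \<open>Both halves contribute the same edge between two middle points, which touches nothing
  else: one closed loop.\<close>

lemma stack_loop:
  assumes u: "u \<in> matchings S" and w: "w \<in> matchings S" and ij: "Bot i \<in> S" "u (Bot i) = Bot j" "w (Bot i) = Bot j" and fin: "finite S"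
  defines "S' \<equiv> S - {Bot i, Bot j}"
  shows "card (loops (stack S w u)) = Suc (card (loops (stack S' (unpair (Bot i) (Bot j) w) (unpair (Bot i) (Bot j) u))))"
    "traces (stack S w u) = traces (stack S' (unpair (Bot i) (Bot j) w) (unpair (Bot i) (Bot j) u))"
proof -
  let ?w = "unpair (Bot i) (Bot j) w" and ?u = "unpair (Bot i) (Bot j) u"
  have m: "?u \<in> matchings S'" "?w \<in> matchings S'" using matchings_unpair[OF u ij(2)] matchings_unpair[OF w ij(3)] by (simp_all add: S'_def)
  have st: "stack S w u = insert {Middle i, Middle j} (stack S' ?w ?u)"
    unfolding stack_def edges_unpair[OF u ij(1,2)] edges_unpair[OF w ij(1,3)] S'_def by auto
  have "Middle i \<notin> \<Union>(stack S' ?w ?u)" "Middle j \<notin> \<Union>(stack S' ?w ?u)" using Middle_stack[OF m] by (auto simp: S'_def)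
  from loops_insert_isolated[OF this finite_stack] fin
  show "card (loops (stack S w u)) = Suc (card (loops (stack S' ?w ?u)))" "traces (stack S w u) = traces (stack S' ?w ?u)"
    unfolding st by (auto simp: S'_def)
qed

text \<open>The pair \<open>i, j\<close> of \<open>w\<close> connects the partners of
  \<open>i\<close> and \<open>j\<close> in \<open>u\<close> by a path through two middle points;
  shortening this path to an edge is what \<open>contract\<close> does to \<open>u\<close>.\<close>

lemma stack_contract:
  assumes u: "u \<in> matchings S" and w: "w \<in> matchings S" and ij: "Bot i \<in> S" "i \<noteq> j" "u (Bot i) \<noteq> Bot j" "w (Bot i) = Bot j"
  defines "S' \<equiv> S - {Bot i, Bot j}"
  shows "card (loops (stack S w u)) = card (loops (stack S' (unpair (Bot i) (Bot j) w) (contract (Bot i) (Bot j) u)))"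
    "traces (stack S w u) = traces (stack S' (unpair (Bot i) (Bot j) w) (contract (Bot i) (Bot j) u))"
proof -
  let ?w = "unpair (Bot i) (Bot j) w" and ?u = "contract (Bot i) (Bot j) u"
  let ?a = "u (Bot i)" and ?b = "u (Bot j)"
  have jS: "Bot j \<in> S" using matchingsD(1)[OF w ij(1)] ij(4) by simp
  have ijB: "Bot i \<noteq> Bot j" using ij(2) by simp
  have m: "?w \<in> matchings S'" using matchings_unpair[OF w ij(4)] by (simp add: S'_def)
  have ab: "?a \<noteq> Bot i" "?a \<noteq> Bot j" "?b \<noteq> Bot i" "?b \<noteq> Bot j"
    using matchingsD[OF u] ij jS by metis+
  define F where "F = edges (S - {Bot i, Bot j, ?a, ?b}) u"
  note c = edges_contract[OF u ij(1) jS ijB ij(3), folded F_def S'_def]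
  let ?E = "(`) in_upper ` F \<union> (`) in_flipped ` edges S' ?w"
  have s1: "stack S w u = ?E \<union> {{Middle i, Middle j}, {Middle i, in_upper ?a}, {Middle j, in_upper ?b}}"
    unfolding stack_def c(1) edges_unpair[OF w ij(1,4), folded S'_def] by auto
  have s2: "stack S' ?w ?u = insert {in_upper ?a, in_upper ?b} ?E"
    unfolding stack_def c(2) by auto
  have notw: "Bot i \<notin> \<Union>(edges S' ?w)" "Bot j \<notin> \<Union>(edges S' ?w)" unfolding Union_edges[OF m] by (auto simp: S'_def)
  have not_in: "Middle l \<notin> \<Union>?E" if "Bot l \<notin> \<Union>F" "Bot l \<notin> \<Union>(edges S' ?w)" for l
  proof
    assume "Middle l \<in> \<Union>?E"
    then have "Bot l \<in> \<Union>F \<or> Bot l \<in> \<Union>(edges S' ?w)"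
      using in_upper_eq_Middle in_flipped_eq_Middle by (auto dest!: sym[of "Middle l"])
    then show False using that by blast
  qed
  have na: "in_upper ?a \<notin> {Middle i, Middle j}" "in_upper ?b \<notin> {Middle i, Middle j}"
    using ab in_upper_eq_Middle by auto
  from loops_contract[OF not_in[OF c(3) notw(1)] not_in[OF c(4) notw(2)] na]
  show "card (loops (stack S w u)) = card (loops (stack S' ?w ?u))" "traces (stack S w u) = traces (stack S' ?w ?u)"
    unfolding s1 s2 by auto
qed

text \<open>Upper points meet no edge of the lower diagram, so a pair of tops of \<open>u\<close> is
  a component of its own and the composite is not level.\<close>

lemma traces_top_top:
  assumes u: "u \<in> matchings S" and w: "w \<in> matchings S" and "Top i \<in> S" "u (Top i) = Top k"
  shows "{Top i, Top k} \<in> traces (stack S w u)"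
proof -
  let ?E = "(`) in_upper ` edges (S - {Top i, Top k}) (unpair (Top i) (Top k) u) \<union> (`) in_flipped ` edges S w"
  have m: "unpair (Top i) (Top k) u \<in> matchings (S - {Top i, Top k})" by (rule matchings_unpair[OF u assms(4)])
  have st: "stack S w u = insert {Upper i, Upper k} ?E"
    unfolding stack_def edges_unpair[OF u assms(3,4)] by auto
  have "Upper l \<notin> \<Union>?E" if "l = i \<or> l = k" for l
  proof
    assume "Upper l \<in> \<Union>?E"
    moreover have "in_flipped x \<noteq> Upper l" for x by (cases x) auto
    moreover have "in_upper x = Upper l \<longleftrightarrow> x = Top l" for x by (cases x) auto
    ultimately have "Top l \<in> \<Union>(edges (S - {Top i, Top k}) (unpair (Top i) (Top k) u))"
      by (auto dest!: sym[of "Upper l"])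
    then show False unfolding Union_edges[OF m] using that by auto
  qed
  then have "components (stack S w u) = insert {Upper i, Upper k} (components ?E)"
    unfolding st by (intro components_insert_isolated) auto
  moreover have "{Upper i, Upper k} \<notin> loops (stack S w u)" by (auto simp: loops_def)
  ultimately have "trace {Upper i, Upper k} \<in> traces (stack S w u)" by (simp add: traces_def)
  moreover have "trace {Upper i, Upper k} = {Top i, Top k}" by (auto simp: trace_def)
  ultimately show ?thesis by simp
qed

text \<open>Only the identity permutation is tested: other permutations are absorbed into a
  relabelling of the tops, and thereby the regular representation disappears from the
  matrix.\<close>

definition straight :: "nat \<Rightarrow> stacked_point set set \<Rightarrow> bool" where
  "straight p E \<longleftrightarrow> traces E = diagram_of_perm p id"

lemma not_straight_top_top:
  assumes "u \<in> matchings S" "w \<in> matchings S" "Top i \<in> S" "u (Top i) = Top k"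
  shows "\<not> straight p (stack S w u)"
  using traces_top_top[OF assms] by (auto simp: straight_def diagram_of_perm_def doubleton_eq_iff)

section \<open>The Gram matrix\<close>

lemma disjoint_tops: "tops p \<inter> Bot ` Q = {}"
  by (auto simp: tops_def)

lemma finite_tops [simp]: "finite (tops p)"
  by (simp add: tops_def)

lemma card_tops [simp]: "card (tops p) = p"
  by (simp add: tops_def card_image inj_on_def)

lemma card_Bot [simp]: "card (Bot ` Q) = card Q"
  by (simp add: card_image inj_on_def)

lemma upward_unpair:
  assumes w: "w \<in> upward_matchings T B" and "w i = j" "i \<in> B" "j \<in> B" and TB: "T \<inter> B = {}"
  shows "unpair i j w \<in> upward_matchings T (B - {i, j})"
proof -
  note W = matchingsD[OF upward_matchingsD(1)[OF w]]
  have eq: "T \<union> (B - {i, j}) = T \<union> B - {i, j}" using assms by auto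
  have "unpair i j w x \<in> B - {i, j}" if "x \<in> T" for x
  proof -
    have "x \<noteq> i" "x \<noteq> j" using that assms by auto
    moreover from this have "w x \<noteq> i" "w x \<noteq> j" using W(3)[of x] W(3)[of i] assms(2) by auto
    ultimately show ?thesis using upward_matchingsD(2)[OF w that] by (simp add: unpair_def)
  qed
  then show ?thesis using matchings_unpair[OF upward_matchingsD(1)[OF w] assms(2)]
    by (simp add: upward_matchings_def eq)
qed

lemma upward_contract:
  assumes u: "u \<in> upward_matchings T B" and ij: "i \<in> B" "j \<in> B" "i \<noteq> j" "u i \<noteq> j" and TB: "T \<inter> B = {}"
    and nt: "\<not> (u i \<in> T \<and> u j \<in> T)"
  shows "contract i j u \<in> upward_matchings T (B - {i, j})"
proof -
  have uS: "u \<in> matchings (T \<union> B)" using upward_matchingsD(1)[OF u] .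
  have m: "contract i j u \<in> matchings (T \<union> B - {i, j})" using matchings_contract[OF uS] ij by auto
  note U = matchingsD[OF uS] and M = matchingsD[OF m]
  have eq: "T \<union> (B - {i, j}) = T \<union> B - {i, j}" using assms by auto
  have "contract i j u x \<in> B - {i, j}" if x: "x \<in> T" for x
  proof -
    have x': "x \<in> T \<union> B - {i, j}" using x ij TB by auto
    have "contract i j u x \<notin> T"
    proof (cases "x \<in> {u i, u j}")
      case True
      have "u i \<noteq> u j" using U(3)[of i] U(3)[of j] ij(3) by metis
      moreover have "u i \<noteq> i" "u j \<noteq> j" "u j \<noteq> i" using U(2)[of i] U(2)[of j] U(3)[of j] ij by auto
      ultimately have "contract i j u (u i) = u j" "contract i j u (u j) = u i" using ij by (auto simp: contract_def)
      then show ?thesis using True x nt by auto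
    next
      case False
      then have "contract i j u x = u x" using x' by (auto simp: contract_def)
      then show ?thesis using upward_matchingsD(2)[OF u x] TB by auto
    qed
    then show ?thesis using M(1)[OF x'] by auto
  qed
  then show ?thesis using m by (simp add: upward_matchings_def eq)
qed

text \<open>With as many bottoms as tops there are no cups, and the components are the
  \<open>p\<close> paths \<open>C i\<close> from an upper point through one middle point to a lower
  point.\<close>

lemma stack_level:
  assumes u: "u \<in> upward_matchings (tops p) (Bot ` Q)" and w: "w \<in> upward_matchings (tops p) (Bot ` Q)"
    and fin: "finite Q" and c: "card Q = p"
  defines "S \<equiv> tops p \<union> Bot ` Q"
  shows "loops (stack S w u) = {}" "straight p (stack S w u) \<longleftrightarrow> u = w"
proof -
  let ?T = "tops p" and ?B = "Bot ` Q" and ?E = "stack S w u"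
  note U = matchingsD[OF upward_matchingsD(1)[OF u]] and W = matchingsD[OF upward_matchingsD(1)[OF w]]
  have uT: "u x \<in> ?B" "w x \<in> ?B" if "x \<in> ?T" for x using that upward_matchingsD(2)[OF u] upward_matchingsD(2)[OF w] by auto
  have uB: "u x \<in> ?T" "w x \<in> ?T" if "x \<in> ?B" for x
    using upward_square[OF u _ _ _ disjoint_tops that] upward_square[OF w _ _ _ disjoint_tops that] fin c by auto
  define C where "C i = {Upper i, in_upper (u (Top i)), in_flipped (w (u (Top i)))}" for i
  have top: "Top i \<in> ?T \<longleftrightarrow> i \<in> {1..p}" for i by (auto simp: tops_def)
  have mid: "\<exists>b. u (Top i) = Bot b \<and> Bot b \<in> ?B" if "i \<in> {1..p}" for i using uT(1)[of "Top i"] that top by auto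
  have low: "\<exists>k. w (u (Top i)) = Top k \<and> k \<in> {1..p}" if "i \<in> {1..p}" for i
    using uB(2)[OF uT(1)[of "Top i"]] that top by (auto simp: tops_def)
  have e1: "in_upper ` {x, u x} \<subseteq> C i \<and> i \<in> {1..p}" if "x = Top i \<or> u x = Top i" "x \<in> S" for x i
  proof -
    have "u (Top i) = x \<or> x = Top i" using that U(3)[of x] by auto
    moreover have "Top i \<in> S" using that U(1)[of x] by (auto simp: S_def)
    ultimately show ?thesis using that(1) top by (auto simp: C_def S_def)
  qed
  have e1': "\<exists>i. x = Top i \<or> u x = Top i" if "x \<in> S" for x
    using that uB(1)[of x] by (auto simp: S_def tops_def)
  have e3: "\<exists>i\<in>{1..p}. in_upper ` {x, u x} \<subseteq> C i" if x: "x \<in> S" for x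
  proof -
    obtain i where "x = Top i \<or> u x = Top i" using e1'[OF x] by auto
    from e1[OF this x] show ?thesis by (intro bexI[of _ i]) simp_all
  qed
  have e2: "\<exists>i\<in>{1..p}. in_flipped ` {x, w x} \<subseteq> C i" if x: "x \<in> S" for x
  proof -
    obtain b where b: "Bot b \<in> ?B" "in_flipped ` {x, w x} = {Middle b, in_flipped (w (Bot b))}"
    proof (cases "x \<in> ?T")
      case True
      then obtain b where "w x = Bot b" "Bot b \<in> ?B" using uT(2) by blast
      then show ?thesis using that[of b] W(3)[of x] by auto
    next
      case False
      then obtain b where "x = Bot b" "Bot b \<in> ?B" using x by (auto simp: S_def)
      then show ?thesis using that[of b] by auto
    qed
    obtain i where i: "u (Bot b) = Top i" "i \<in> {1..p}" using uB(1)[OF b(1)] by (auto simp: tops_def)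
    then have "u (Top i) = Bot b" using U(3)[of "Bot b"] by simp
    then have "in_flipped ` {x, w x} \<subseteq> C i" unfolding b(2) C_def by simp
    then show ?thesis using i(2) by blast
  qed
  have in_E: "in_upper ` {Top i, u (Top i)} \<in> ?E" "in_flipped ` {u (Top i), w (u (Top i))} \<in> ?E" if "i \<in> {1..p}" for i
  proof -
    have "Top i \<in> S" "u (Top i) \<in> S" using that top uT by (auto simp: S_def)
    then show "in_upper ` {Top i, u (Top i)} \<in> ?E" "in_flipped ` {u (Top i), w (u (Top i))} \<in> ?E"
      unfolding stack_def edges_def by blast+
  qed
  have mid_eq: "in_flipped (u (Top i)) = in_upper (u (Top i))" if "i \<in> {1..p}" for i using mid[OF that] by auto
  have comps: "components ?E = C ` {1..p}"
  proof (rule components_eqI)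
    show "\<Union>(C ` {1..p}) = \<Union>?E"
    proof (intro equalityI subsetI)
      fix v assume "v \<in> \<Union>(C ` {1..p})"
      then obtain i where i: "i \<in> {1..p}" "v \<in> C i" by auto
      then have "v \<in> in_upper ` {Top i, u (Top i)} \<union> in_flipped ` {u (Top i), w (u (Top i))}"
        by (auto simp: C_def)
      then show "v \<in> \<Union>?E" using in_E[OF i(1)] by blast
    next
      fix v assume "v \<in> \<Union>?E"
      then obtain x where x: "x \<in> S" "v \<in> in_upper ` {x, u x} \<or> v \<in> in_flipped ` {x, w x}"
        unfolding stack_def edges_def by blast
      from x(2) show "v \<in> \<Union>(C ` {1..p})"
      proof
        assume v: "v \<in> in_upper ` {x, u x}"
        obtain i where "i \<in> {1..p}" "in_upper ` {x, u x} \<subseteq> C i" using e3[OF x(1)] by (rule bexE)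
        then show ?thesis using subsetD[OF _ v] by (intro UN_I)
      next
        assume v: "v \<in> in_flipped ` {x, w x}"
        obtain i where "i \<in> {1..p}" "in_flipped ` {x, w x} \<subseteq> C i" using e2[OF x(1)] by (rule bexE)
        then show ?thesis using subsetD[OF _ v] by (intro UN_I)
      qed
    qed
    show "D = D'" if D: "D \<in> C ` {1..p}" "D' \<in> C ` {1..p}" "v \<in> D" "v \<in> D'" for D D' v
    proof -
      obtain i i' where i: "i \<in> {1..p}" "D = C i" "i' \<in> {1..p}" "D' = C i'" using D by auto
      obtain b k where bk: "u (Top i) = Bot b" "w (Bot b) = Top k" using mid[OF i(1)] low[OF i(1)] by auto
      obtain b' k' where bk': "u (Top i') = Bot b'" "w (Bot b') = Top k'" using mid[OF i(3)] low[OF i(3)] by auto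
      have "i = i' \<or> b = b' \<or> k = k'" using D(3,4) bk bk' unfolding i(2,4) C_def by auto
      moreover have "b = b'" if "k = k'" using bk(2) bk'(2) W(3) that by (metis point.inject(2))
      moreover have "i = i'" if "b = b'" using bk(1) bk'(1) U(3) that by (metis point.inject(1))
      ultimately show ?thesis using i by auto
    qed
    show "D \<noteq> {}" if "D \<in> C ` {1..p}" for D using that by (auto simp: C_def)
    show "\<exists>D\<in>C ` {1..p}. e \<subseteq> D" if eE: "e \<in> ?E" for e
    proof -
      obtain x where x: "x \<in> S" "e = in_upper ` {x, u x} \<or> e = in_flipped ` {x, w x}"
        using eE unfolding stack_def edges_def by blast
      from x(2) show ?thesis
      proof
        assume "e = in_upper ` {x, u x}"
        then show ?thesis using e3[OF x(1)] by simp
      next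
        assume "e = in_flipped ` {x, w x}"
        then show ?thesis using e2[OF x(1)] by simp
      qed
    qed
    show "(v, v') \<in> (adjacent ?E)\<^sup>*" if D: "D \<in> C ` {1..p}" "v \<in> D" "v' \<in> D" for D v v'
    proof -
      obtain i where i: "i \<in> {1..p}" "D = C i" using D by auto
      have a1: "(q, in_upper (u (Top i))) \<in> (adjacent ?E)\<^sup>*" if "q \<in> C i" for q
      proof -
        have "q = Upper i \<or> q = in_upper (u (Top i)) \<or> q = in_flipped (w (u (Top i)))" using that by (auto simp: C_def)
        then show ?thesis
          using adjacentI[OF in_E(1)[OF i(1)], of q "in_upper (u (Top i))"]
            adjacentI[OF in_E(2)[OF i(1)], of q "in_upper (u (Top i))"] mid_eq[OF i(1)] by auto
      qed
      show ?thesis using a1[of v] a1[of v'] D i sym_adjacent_rtrancl by (metis rtrancl_trans)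
    qed
  qed
  show loops: "loops ?E = {}" by (auto simp: loops_def comps C_def)
  have tr: "trace (C i) = {Top i, Bot k}" if "i \<in> {1..p}" "w (u (Top i)) = Top k" for i k
    using mid[OF that(1)] that(2) by (auto simp: trace_def C_def)
  have traces: "traces ?E = (\<lambda>i. trace (C i)) ` {1..p}" by (simp add: traces_def loops comps image_image)
  show "straight p ?E \<longleftrightarrow> u = w"
  proof
    assume st: "straight p ?E"
    have eq: "u (Top i) = w (Top i)" if i: "i \<in> {1..p}" for i
    proof -
      obtain k where k: "w (u (Top i)) = Top k" using low[OF i] by auto
      have "{Top i, Bot k} \<in> diagram_of_perm p id" using st tr[OF i k] i unfolding straight_def traces by force
      then have "k = i" by (auto simp: diagram_of_perm_def doubleton_eq_iff)
      then show ?thesis using k W(3) by metis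
    qed
    show "u = w"
    proof
      fix x
      consider "x \<in> ?T" | "x \<in> ?B" | "x \<notin> ?T \<union> ?B" by auto
      then show "u x = w x"
      proof cases
        case 1
        then show ?thesis using eq by (auto simp: tops_def)
      next
        case 2
        then obtain i where i: "u x = Top i" "i \<in> {1..p}" using uB(1)[OF 2] by (auto simp: tops_def)
        then have "w (Top i) = x" using eq U(3)[of x] by simp
        then show ?thesis using i W(3) by metis
      next
        case 3
        then show ?thesis using U(4) W(4) by simp
      qed
    qed
  next
    assume "u = w"
    then have "w (u (Top i)) = Top i" for i using W(3) by simp
    then have "trace (C i) = {Top i, Bot i}" if "i \<in> {1..p}" for i using tr[OF that] by simp
    then show "straight p ?E" unfolding straight_def traces diagram_of_perm_def by (auto intro!: image_cong)
  qed
qed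

lemma stack_ground: "tops p \<union> Bot ` Q - {Bot i, Bot j} = tops p \<union> Bot ` (Q - {i, j})"
  by (auto simp: tops_def)

lemma Bot_Diff: "Bot ` Q - {Bot i, Bot j} = Bot ` (Q - {i, j})"
  by auto

lemma unpair_inj:
  assumes "u \<in> matchings S" "w \<in> matchings S" "u i = j" "w i = j" "unpair i j u = unpair i j w"
  shows "u = w"
proof
  fix x
  have "u j = i" "w j = i" using matchingsD(3)[OF assms(1), of i] matchingsD(3)[OF assms(2), of i] assms(3,4) by auto
  then show "u x = w x" using fun_cong[OF assms(5), of x] assms(3,4) by (auto simp: unpair_def split: if_splits)
qed

lemma obtain_cup:
  assumes "w \<in> upward_matchings (tops p) (Bot ` Q)" "p < card Q"
  obtains i j where "i \<in> Q" "j \<in> Q" "i \<noteq> j" "w (Bot i) = Bot j"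
proof -
  have "\<exists>x\<in>Bot ` Q. w x \<in> Bot ` Q" using upward_ex_cup[OF assms(1) _ _ disjoint_tops] assms(2) by simp
  then obtain i j where "i \<in> Q" "j \<in> Q" "w (Bot i) = Bot j" by auto
  moreover from this have "i \<noteq> j" using matchingsD(2)[OF upward_matchingsD(1)[OF assms(1)], of "Bot i"] by auto
  ultimately show ?thesis using that by auto
qed

text \<open>Induction removes the cups of \<open>w\<close>: one shared with \<open>u\<close> closes
  a loop, any other is contracted without a loop. So \<open>k\<close> loops require all cups to be
  shared, and straightness then fixes the rest. This places the highest powers of the variable on
  the diagonal.\<close>

lemma straight_loops:
  assumes "u \<in> upward_matchings (tops p) (Bot ` Q)" "w \<in> upward_matchings (tops p) (Bot ` Q)"
    "finite Q" "card Q = p + 2 * k"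
  defines "E \<equiv> stack (tops p \<union> Bot ` Q) w u"
  shows "straight p E \<Longrightarrow> card (loops E) \<le> k \<and> (card (loops E) = k \<longrightarrow> u = w)"
    "u = w \<Longrightarrow> straight p E \<and> card (loops E) = k"
proof -
  have "(straight p (stack (tops p \<union> Bot ` Q) w u) \<longrightarrow> card (loops (stack (tops p \<union> Bot ` Q) w u)) \<le> k \<and>
      (card (loops (stack (tops p \<union> Bot ` Q) w u)) = k \<longrightarrow> u = w)) \<and>
    (u = w \<longrightarrow> straight p (stack (tops p \<union> Bot ` Q) w u) \<and> card (loops (stack (tops p \<union> Bot ` Q) w u)) = k)"
    using assms(1-4)
  proof (induction k arbitrary: Q u w)
    case 0
    then show ?case using stack_level[OF 0(1,2,3)] by auto
  next
    case (Suc k)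
    obtain i j where ij: "i \<in> Q" "j \<in> Q" "i \<noteq> j" "w (Bot i) = Bot j" using obtain_cup[OF Suc.prems(2)] Suc.prems by auto
    let ?S = "tops p \<union> Bot ` Q" and ?S' = "tops p \<union> Bot ` (Q - {i, j})"
    have m: "u \<in> matchings ?S" "w \<in> matchings ?S" using Suc.prems upward_matchingsD(1) by auto
    have fin: "finite ?S" using Suc.prems by simp
    have w': "unpair (Bot i) (Bot j) w \<in> upward_matchings (tops p) (Bot ` (Q - {i, j}))"
      using upward_unpair[OF Suc.prems(2) ij(4) _ _ disjoint_tops] ij by (simp add: Bot_Diff)
    have c: "finite (Q - {i, j})" "card (Q - {i, j}) = p + 2 * k" using Suc.prems ij by (auto simp: card_Diff_subset)
    show ?case
    proof (cases "u (Bot i) = Bot j")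
      case True
      have u': "unpair (Bot i) (Bot j) u \<in> upward_matchings (tops p) (Bot ` (Q - {i, j}))"
        using upward_unpair[OF Suc.prems(1) True _ _ disjoint_tops] ij by (simp add: Bot_Diff)
      note st = stack_loop[OF m(1,2) _ True ij(4) fin, unfolded stack_ground]
      have "Bot i \<in> ?S" using ij by auto
      note st = st[OF this]
      have "unpair (Bot i) (Bot j) u = unpair (Bot i) (Bot j) w \<longleftrightarrow> u = w" using unpair_inj[OF m True ij(4)] by auto
      then show ?thesis using Suc.IH[OF u' w' c] st by (auto simp: straight_def)
    next
      case False
      have iS: "Bot i \<in> ?S" using ij by auto
      note st = stack_contract[OF m(1,2) iS ij(3) False ij(4), unfolded stack_ground]
      have ne: "u \<noteq> w" using False ij by auto
      \<comment> \<open>Contracting leaves the upward diagrams only if it joins two tops, and then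
        the stack is not straight.\<close>
      show ?thesis
      proof (cases "u (Bot i) \<in> tops p \<and> u (Bot j) \<in> tops p")
        case True
        then obtain a b where ab: "u (Bot i) = Top a" "u (Bot j) = Top b" "Top a \<in> ?S" "Top a \<in> tops p" by (auto simp: tops_def)
        have "contract (Bot i) (Bot j) u (Top a) = Top b"
          using ab ij matchingsD(3)[OF m(1), of "Bot i"] matchingsD(3)[OF m(1), of "Bot j"] by (auto simp: contract_def)
        moreover have "contract (Bot i) (Bot j) u \<in> matchings ?S'"
          using matchings_contract[OF m(1), of "Bot i" "Bot j"] ij False by (auto simp: stack_ground)
        ultimately have "\<not> straight p (stack ?S' (unpair (Bot i) (Bot j) w) (contract (Bot i) (Bot j) u))"
          using not_straight_top_top[OF _ upward_matchingsD(1)[OF w'], of _ a b p] ab by auto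
        then show ?thesis using st ne by (auto simp: straight_def)
      next
        case nt: False
        have u': "contract (Bot i) (Bot j) u \<in> upward_matchings (tops p) (Bot ` (Q - {i, j}))"
          using upward_contract[OF Suc.prems(1), of "Bot i" "Bot j"] ij False nt disjoint_tops by (auto simp: Bot_Diff)
        show ?thesis using Suc.IH[OF u' w' c] st ne by (auto simp: straight_def)
      qed
    qed
  qed
  then show "straight p E \<Longrightarrow> card (loops E) \<le> k \<and> (card (loops E) = k \<longrightarrow> u = w)"
    "u = w \<Longrightarrow> straight p E \<and> card (loops E) = k" by (auto simp: E_def)
qed

definition gram :: "complex \<Rightarrow> nat \<Rightarrow> nat set \<Rightarrow> (point \<Rightarrow> point) \<Rightarrow> (point \<Rightarrow> point) \<Rightarrow> complex" where
  "gram \<delta> p Q w u = (if straight p (stack (tops p \<union> Bot ` Q) w u)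
     then \<delta> ^ card (loops (stack (tops p \<union> Bot ` Q) w u)) else 0)"

text \<open>The row of \<open>w\<close> factors through the cap on any of its cups. The diagrams
  \<open>u\<close> fall into three classes: those with the same cup give a loop and the factor
  \<open>\<delta>\<close>; those that contract to an upward \<open>d\<close> are
  \<open>reconnect\<close> of \<open>d\<close> at the former partner of \<open>i\<close>; those that
  contract to a pair of tops have entry 0.\<close>

lemma gram_sum:
  assumes w: "w \<in> upward_matchings (tops p) (Bot ` Q)" and fin: "finite Q"
    and ij: "i \<in> Q" "j \<in> Q" "i \<noteq> j" "w (Bot i) = Bot j"
  shows "(\<Sum>u\<in>upward_matchings (tops p) (Bot ` Q). gram \<delta> p Q w u * v u) =
    (\<Sum>d\<in>upward_matchings (tops p) (Bot ` (Q - {i, j})). gram \<delta> p (Q - {i, j}) (unpair (Bot i) (Bot j) w) d *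
       cap_coeff \<delta> (tops p \<union> Bot ` Q) (Bot i) (Bot j) v d)"
proof -
  let ?S = "tops p \<union> Bot ` Q" and ?S' = "tops p \<union> Bot ` (Q - {i, j})"
  let ?U = "upward_matchings (tops p) (Bot ` Q)" and ?U' = "upward_matchings (tops p) (Bot ` (Q - {i, j}))"
  let ?i = "Bot i" and ?j = "Bot j"
  let ?w = "unpair ?i ?j w" and ?g = "\<lambda>d. gram \<delta> p (Q - {i, j}) (unpair ?i ?j w) d"
  have S': "?S - {?i, ?j} = ?S'" by (rule stack_ground)
  have ijB: "?i \<in> Bot ` Q" "?j \<in> Bot ` Q" "?i \<noteq> ?j" "?i \<in> ?S" using ij by auto
  have finU: "finite ?U" "finite ?U'" using fin by (auto intro!: finite_upward_matchings)
  have mw: "w \<in> matchings ?S" using upward_matchingsD(1)[OF w] .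
  have w': "?w \<in> ?U'" using upward_unpair[OF w ij(4) ijB(1,2) disjoint_tops] by (simp add: Bot_Diff)
  define U1 where "U1 = {u \<in> ?U. u ?i = ?j}"
  define U2 where "U2 = {u \<in> ?U. u ?i \<noteq> ?j \<and> \<not> (u ?i \<in> tops p \<and> u ?j \<in> tops p)}"
  define U3 where "U3 = {u \<in> ?U. u ?i \<noteq> ?j \<and> u ?i \<in> tops p \<and> u ?j \<in> tops p}"
  have g1: "gram \<delta> p Q w u = \<delta> * ?g (unpair ?i ?j u)" if "u \<in> U1" for u
  proof -
    have u: "u \<in> ?U" "u ?i = ?j" using that by (auto simp: U1_def)
    show ?thesis
      using stack_loop[OF upward_matchingsD(1)[OF u(1)] mw ijB(4) u(2) ij(4), unfolded S'] fin
      by (simp add: gram_def straight_def)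
  qed
  have g23: "gram \<delta> p Q w u = ?g (contract ?i ?j u)" if u: "u \<in> ?U" "u ?i \<noteq> ?j" for u
    using stack_contract[OF upward_matchingsD(1)[OF u(1)] mw ijB(4) ij(3) u(2) ij(4), unfolded S']
    by (simp add: gram_def straight_def)
  have g3: "gram \<delta> p Q w u = 0" if "u \<in> U3" for u
  proof -
    have u: "u \<in> ?U" "u ?i \<noteq> ?j" "u ?i \<in> tops p" "u ?j \<in> tops p" using that by (auto simp: U3_def)
    have mu: "u \<in> matchings ?S" using upward_matchingsD(1)[OF u(1)] .
    obtain a b where ab: "u ?i = Top a" "u ?j = Top b" "Top a \<in> tops p" using u by (auto simp: tops_def)
    have "contract ?i ?j u (Top a) = Top b"
      using ab ij matchingsD(3)[OF mu, of ?i] matchingsD(3)[OF mu, of ?j] by (auto simp: contract_def)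
    moreover have "contract ?i ?j u \<in> matchings ?S'"
      using matchings_contract[OF mu, of ?i ?j] ijB u(2) by (auto simp: S')
    ultimately have "\<not> straight p (stack ?S' ?w (contract ?i ?j u))"
      using not_straight_top_top[OF _ upward_matchingsD(1)[OF w'], of _ a b p] ab by auto
    then show ?thesis using g23[OF u(1,2)] by (simp add: gram_def)
  qed
  have "(\<Sum>u\<in>?U. gram \<delta> p Q w u * v u) = (\<Sum>u\<in>U1 \<union> (U2 \<union> U3). gram \<delta> p Q w u * v u)"
    by (rule sum.cong) (auto simp: U1_def U2_def U3_def)
  also have "\<dots> = (\<Sum>u\<in>U1. gram \<delta> p Q w u * v u) + ((\<Sum>u\<in>U2. gram \<delta> p Q w u * v u) + (\<Sum>u\<in>U3. gram \<delta> p Q w u * v u))"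
    using finU by (subst sum.union_disjoint, auto simp: U1_def U2_def U3_def)+
  also have "(\<Sum>u\<in>U3. gram \<delta> p Q w u * v u) = 0" using g3 by simp
  also have "(\<Sum>u\<in>U1. gram \<delta> p Q w u * v u) = (\<Sum>d\<in>?U'. ?g d * (\<delta> * v (add_pair ?i ?j d)))"
  proof (rule sum.reindex_bij_witness[of _ "add_pair ?i ?j" "unpair ?i ?j"])
    fix u assume "u \<in> U1"
    then have u: "u \<in> ?U" "u ?i = ?j" by (auto simp: U1_def)
    have "u ?j = ?i" using matchingsD(3)[OF upward_matchingsD(1)[OF u(1)], of ?i] u(2) by simp
    then show "add_pair ?i ?j (unpair ?i ?j u) = u" using u(2) by (auto simp: add_pair_def unpair_def)
    then show "?g (unpair ?i ?j u) * (\<delta> * v (add_pair ?i ?j (unpair ?i ?j u))) = gram \<delta> p Q w u * v u"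
      using g1[OF \<open>u \<in> U1\<close>] by simp
    show "unpair ?i ?j u \<in> ?U'" using upward_unpair[OF u ijB(1,2) disjoint_tops] by (simp add: Bot_Diff)
  next
    fix d assume d: "d \<in> ?U'"
    have "d ?i = ?i" "d ?j = ?j" using matchingsD(4)[OF upward_matchingsD(1)[OF d]] by (auto simp: tops_def)
    then show "unpair ?i ?j (add_pair ?i ?j d) = d" by (auto simp: add_pair_def unpair_def)
    show "add_pair ?i ?j d \<in> U1"
      using upward_add_pair[of d "tops p" "Bot ` Q" ?i ?j] d ijB disjoint_tops by (auto simp: U1_def add_pair_def Bot_Diff)
  qed
  also have "(\<Sum>u\<in>U2. gram \<delta> p Q w u * v u) = (\<Sum>(d, a)\<in>?U' \<times> ?S'. ?g d * v (reconnect ?i ?j a d))"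
  proof (rule sum.reindex_bij_witness[of _ "\<lambda>(d, a). reconnect ?i ?j a d" "\<lambda>u. (contract ?i ?j u, u ?i)"])
    fix u assume "u \<in> U2"
    then have u: "u \<in> ?U" "u ?i \<noteq> ?j" "\<not> (u ?i \<in> tops p \<and> u ?j \<in> tops p)" by (auto simp: U2_def)
    note M = matchingsD[OF upward_matchingsD(1)[OF u(1)]]
    have ab: "u ?i \<noteq> ?i" "u ?i \<noteq> ?j" "u ?j \<noteq> ?i" "u ?j \<noteq> ?j" "u (u ?i) = ?i" "u (u ?j) = ?j" "u ?i \<noteq> u ?j"
      using M ijB u(2) by (metis UnI2)+
    have "contract ?i ?j u (u ?i) = u ?j" using ab by (simp add: contract_def)
    then have eq: "reconnect ?i ?j (u ?i) (contract ?i ?j u) = u"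
      using ab by (auto simp: reconnect_def contract_def fun_eq_iff)
    then show "(case (contract ?i ?j u, u ?i) of (d, a) \<Rightarrow> reconnect ?i ?j a d) = u" by simp
    have "contract ?i ?j u \<in> ?U'" using upward_contract[OF u(1) ijB(1-3) u(2) disjoint_tops u(3)] by (simp add: Bot_Diff)
    moreover have "u ?i \<in> ?S'" using M(1)[of ?i] ijB ab unfolding S'[symmetric] by auto
    ultimately show "(contract ?i ?j u, u ?i) \<in> ?U' \<times> ?S'" by simp
    show "(case (contract ?i ?j u, u ?i) of (d, a) \<Rightarrow> ?g d * v (reconnect ?i ?j a d)) = gram \<delta> p Q w u * v u"
      using eq g23[OF u(1,2)] by simp
  next
    fix q assume "q \<in> ?U' \<times> ?S'"
    then obtain d a where q: "q = (d, a)" "d \<in> ?U'" "a \<in> ?S'" by auto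
    note M = matchingsD[OF upward_matchingsD(1)[OF q(2)]]
    have d: "d ?i = ?i" "d ?j = ?j" using M(4) by (auto simp: tops_def)
    have a: "a \<noteq> ?i" "a \<noteq> ?j" "a \<in> ?S - {?i, ?j}" using q(3) unfolding S'[symmetric] by auto
    have da: "d a \<noteq> a" "d (d a) = a" "d a \<in> ?S'" using M q(3) by auto
    then have da': "d a \<noteq> ?i" "d a \<noteq> ?j" unfolding S'[symmetric] by auto
    let ?r = "reconnect ?i ?j a d"
    have vals: "?r ?i = a" "?r ?j = d a" using a da da' ijB by (auto simp: reconnect_def)
    have "contract ?i ?j ?r = d"
      unfolding contract_def vals using a da da' d ijB by (auto simp: reconnect_def fun_eq_iff)
    then show "(\<lambda>u. (contract ?i ?j u, u ?i)) (case q of (d, a) \<Rightarrow> reconnect ?i ?j a d) = q" using vals q by simp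
    have "?r \<in> ?U" using upward_reconnect[OF q(2)[unfolded Bot_Diff[symmetric]] ijB(1-3) disjoint_tops a(3)] .
    moreover have "\<not> (a \<in> tops p \<and> d a \<in> tops p)" using upward_matchingsD(2)[OF q(2), of a] disjoint_tops by auto
    ultimately show "(case q of (d, a) \<Rightarrow> reconnect ?i ?j a d) \<in> U2" using vals a q by (simp add: U2_def)
  qed
  also have "\<dots> = (\<Sum>d\<in>?U'. \<Sum>a\<in>?S'. ?g d * v (reconnect ?i ?j a d))" by (simp add: sum.cartesian_product)
  finally show ?thesis
    by (simp add: cap_coeff_def S' sum.distrib distrib_left sum_distrib_left)
qed

definition singular :: "complex \<Rightarrow> nat \<Rightarrow> nat set \<Rightarrow> bool" where
  "singular \<delta> p Q \<longleftrightarrow> (\<exists>v. (\<exists>u\<in>upward_matchings (tops p) (Bot ` Q). v u \<noteq> 0) \<and>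
     (\<forall>w\<in>upward_matchings (tops p) (Bot ` Q). (\<Sum>u\<in>upward_matchings (tops p) (Bot ` Q). gram \<delta> p Q w u * v u) = 0))"

text \<open>For \<open>p < card Q\<close> every \<open>w\<close> has a cup, so by
  \<open>gram_sum\<close> every row kills a harmonic vector.\<close>

lemma singular_if_harmonic:
  assumes "has_harmonic \<delta> (tops p) (Bot ` Q)" "finite Q" "p < card Q"
  shows "singular \<delta> p Q"
proof -
  obtain v u0 where v: "harmonic \<delta> (tops p) (Bot ` Q) v" "u0 \<in> upward_matchings (tops p) (Bot ` Q)" "v u0 \<noteq> 0"
    using assms(1) by (auto simp: has_harmonic_def)
  have "(\<Sum>u\<in>upward_matchings (tops p) (Bot ` Q). gram \<delta> p Q w u * v u) = 0"
    if w: "w \<in> upward_matchings (tops p) (Bot ` Q)" for w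
  proof -
    obtain i j where ij: "i \<in> Q" "j \<in> Q" "i \<noteq> j" "w (Bot i) = Bot j" using obtain_cup[OF w assms(3)] by auto
    have "cap_coeff \<delta> (tops p \<union> Bot ` Q) (Bot i) (Bot j) v d = 0" if "d \<in> upward_matchings (tops p) (Bot ` (Q - {i, j}))" for d
      using v(1) ij that by (auto simp: harmonic_def Bot_Diff)
    then show ?thesis unfolding gram_sum[OF w assms(2) ij] by simp
  qed
  then show ?thesis using v(2,3) by (auto simp: singular_def)
qed

text \<open>If a kernel vector is not harmonic, some cap does not kill it, and the image is in the
  kernel of a smaller Gram matrix. The descent must end in a harmonic vector, since for
  \<open>k = 0\<close> the Gram matrix is the identity.\<close>

lemma harmonic_if_singular:
  assumes "singular \<delta> p Q" "finite Q" "card Q = p + 2 * k"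
  shows "\<exists>Q' l. Q' \<subseteq> Q \<and> card Q' = p + 2 * Suc l \<and> Suc l \<le> k \<and> has_harmonic \<delta> (tops p) (Bot ` Q')"
  using assms
proof (induction k arbitrary: Q)
  case 0
  let ?U = "upward_matchings (tops p) (Bot ` Q)"
  obtain v u0 where v: "u0 \<in> ?U" "v u0 \<noteq> 0" "\<And>w. w \<in> ?U \<Longrightarrow> (\<Sum>u\<in>?U. gram \<delta> p Q w u * v u) = 0"
    using 0 by (auto simp: singular_def)
  have fin: "finite ?U" using 0 by (auto intro!: finite_upward_matchings)
  have "gram \<delta> p Q u0 u = (if u = u0 then 1 else 0)" if "u \<in> ?U" for u
    using stack_level[OF that v(1)] 0(2,3) by (cases "u = u0") (simp_all add: gram_def)
  then have "(\<Sum>u\<in>?U. gram \<delta> p Q u0 u * v u) = (\<Sum>u\<in>?U. if u = u0 then v u else 0)" by (intro sum.cong) auto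
  also have "\<dots> = v u0" using v(1) fin by simp
  finally show ?case using v by simp
next
  case (Suc k)
  let ?U = "upward_matchings (tops p) (Bot ` Q)"
  obtain v u0 where v: "u0 \<in> ?U" "v u0 \<noteq> 0" "\<And>w. w \<in> ?U \<Longrightarrow> (\<Sum>u\<in>?U. gram \<delta> p Q w u * v u) = 0"
    using Suc.prems(1) by (auto simp: singular_def)
  show ?case
  proof (cases "harmonic \<delta> (tops p) (Bot ` Q) v")
    case True
    then have "has_harmonic \<delta> (tops p) (Bot ` Q)" using v by (auto simp: has_harmonic_def)
    then show ?thesis using Suc.prems(3) by (intro exI[of _ Q] exI[of _ k]) auto
  next
    case False
    then obtain i j d0 where ij: "i \<in> Q" "j \<in> Q" "i \<noteq> j"
      and d0: "d0 \<in> upward_matchings (tops p) (Bot ` (Q - {i, j}))" "cap_coeff \<delta> (tops p \<union> Bot ` Q) (Bot i) (Bot j) v d0 \<noteq> 0"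
      by (auto simp: harmonic_def Bot_Diff)
    let ?U' = "upward_matchings (tops p) (Bot ` (Q - {i, j}))"
    have "(\<Sum>d\<in>?U'. gram \<delta> p (Q - {i, j}) w d * cap_coeff \<delta> (tops p \<union> Bot ` Q) (Bot i) (Bot j) v d) = 0" if w: "w \<in> ?U'" for w
    proof -
      have up: "add_pair (Bot i) (Bot j) w \<in> ?U"
        using upward_add_pair[of w "tops p" "Bot ` Q" "Bot i" "Bot j"] w ij disjoint_tops by (auto simp: Bot_Diff)
      have "w (Bot i) = Bot i" "w (Bot j) = Bot j" using matchingsD(4)[OF upward_matchingsD(1)[OF w]] by (auto simp: tops_def)
      then have "unpair (Bot i) (Bot j) (add_pair (Bot i) (Bot j) w) = w" "add_pair (Bot i) (Bot j) w (Bot i) = Bot j"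
        using ij by (auto simp: add_pair_def unpair_def)
      then show ?thesis using gram_sum[OF up Suc.prems(2) ij, of \<delta> v] v(3)[OF up] by simp
    qed
    then have "singular \<delta> p (Q - {i, j})" unfolding singular_def
      by (intro exI[of _ "cap_coeff \<delta> (tops p \<union> Bot ` Q) (Bot i) (Bot j) v"] conjI bexI[of _ d0] ballI d0)
    moreover have "finite (Q - {i, j})" "card (Q - {i, j}) = p + 2 * k"
      using Suc.prems(2,3) ij by (auto simp: card_Diff_subset)
    ultimately have "\<exists>Q' l. Q' \<subseteq> Q - {i, j} \<and> card Q' = p + 2 * Suc l \<and> Suc l \<le> k \<and>
      has_harmonic \<delta> (tops p) (Bot ` Q')" by (rule Suc.IH)
    then obtain Q' l where "Q' \<subseteq> Q - {i, j}" "card Q' = p + 2 * Suc l" "Suc l \<le> k" "has_harmonic \<delta> (tops p) (Bot ` Q')"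
      by (elim exE conjE)
    then show ?thesis by (intro exI[of _ Q'] exI[of _ l]) auto
  qed
qed

section \<open>Relabelling the tops\<close>

lemma adjacent_image_rtrancl:
  assumes "(u, v) \<in> (adjacent E)\<^sup>*"
  shows "(f u, f v) \<in> (adjacent ((`) f ` E))\<^sup>*"
  using assms
proof (induction rule: rtrancl_induct)
  case (step y z)
  then have "(f y, f z) \<in> adjacent ((`) f ` E)" by (auto simp: adjacent_def)
  then show ?case using step by auto
qed auto

lemma components_bij_image:
  assumes "bij f"
  shows "components ((`) f ` E) = (`) f ` components E"
proof (rule components_eqI)
  have inj: "inj f" using assms by (rule bij_is_inj)
  have un: "\<Union>((`) f ` P) = f ` \<Union>P" for P by auto
  show "\<Union>((`) f ` components E) = \<Union>((`) f ` E)" unfolding un Union_components ..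
  show "C = D" if CD: "C \<in> (`) f ` components E" "D \<in> (`) f ` components E" "u \<in> C" "u \<in> D" for C D u
  proof -
    obtain C' D' where C': "C' \<in> components E" "C = f ` C'" and D': "D' \<in> components E" "D = f ` D'" using CD by auto
    then obtain x where "x \<in> C'" "x \<in> D'" using CD inj by (auto simp: inj_eq)
    then show ?thesis using component_disjoint[OF C'(1) D'(1)] C' D' by auto
  qed
  show "C \<noteq> {}" if "C \<in> (`) f ` components E" for C using that component_nonempty by auto
  show "\<exists>C\<in>(`) f ` components E. e \<subseteq> C" if e: "e \<in> (`) f ` E" and ne: "e \<noteq> {}" for e
  proof -
    obtain e' where e': "e' \<in> E" "e = f ` e'" using e by auto
    then obtain u where u: "u \<in> e'" using ne by auto
    then obtain C where C: "C \<in> components E" "u \<in> C" using Union_components[of E] e' by blast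
    have "e' \<subseteq> C" by (rule edge_in_component[OF C(1) e'(1) u C(2)])
    then show ?thesis using C(1) e'(2) by blast
  qed
  show "(u, v) \<in> (adjacent ((`) f ` E))\<^sup>*" if uv: "C \<in> (`) f ` components E" "u \<in> C" "v \<in> C" for C u v
  proof -
    obtain C' u' v' where C': "C' \<in> components E" "u = f u'" "v = f v'" "u' \<in> C'" "v' \<in> C'" using uv by auto
    show ?thesis unfolding C'(2,3) by (rule adjacent_image_rtrancl[OF component_connected[OF C'(1,4,5)]])
  qed
qed

definition relabel :: "(nat \<Rightarrow> nat) \<Rightarrow> point \<Rightarrow> point" where
  "relabel t x = (case x of Top i \<Rightarrow> Top (t i) | Bot j \<Rightarrow> Bot j)"

definition relabel_ends :: "(nat \<Rightarrow> nat) \<Rightarrow> (nat \<Rightarrow> nat) \<Rightarrow> point \<Rightarrow> point" where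
  "relabel_ends t s x = (case x of Top i \<Rightarrow> Top (t i) | Bot j \<Rightarrow> Bot (s j))"

definition relabel_stack :: "(nat \<Rightarrow> nat) \<Rightarrow> (nat \<Rightarrow> nat) \<Rightarrow> stacked_point \<Rightarrow> stacked_point" where
  "relabel_stack t s x = (case x of Upper i \<Rightarrow> Upper (t i) | Middle j \<Rightarrow> Middle j | Lower i \<Rightarrow> Lower (s i))"

lemma relabel_simps [simp]: "relabel t (Top i) = Top (t i)" "relabel t (Bot j) = Bot j"
  by (auto simp: relabel_def)

lemma relabel_ends_simps [simp]: "relabel_ends t s (Top i) = Top (t i)" "relabel_ends t s (Bot j) = Bot (s j)"
  by (auto simp: relabel_ends_def)

lemma relabel_stack_simps [simp]: "relabel_stack t s (Upper i) = Upper (t i)" "relabel_stack t s (Middle j) = Middle j"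
  "relabel_stack t s (Lower i) = Lower (s i)"
  by (auto simp: relabel_stack_def)

lemma bij_relabel_stack:
  assumes "bij t" "bij s"
  shows "bij (relabel_stack t s)"
proof (rule o_bij)
  show "relabel_stack (inv_into UNIV t) (inv_into UNIV s) \<circ> relabel_stack t s = id"
    using assms by (auto simp: fun_eq_iff relabel_stack_def bij_is_inj split: stacked_point.split)
  show "relabel_stack t s \<circ> relabel_stack (inv_into UNIV t) (inv_into UNIV s) = id"
    using assms by (auto simp: fun_eq_iff relabel_stack_def surj_f_inv_f bij_is_surj split: stacked_point.split)
qed

lemma trace_relabel:
  assumes "bij t" "bij s"
  shows "trace (relabel_stack t s ` C) = relabel_ends t s ` trace C"
proof -
  have eq: "Upper i = relabel_stack t s x \<longleftrightarrow> (\<exists>k. x = Upper k \<and> i = t k)"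
    "Lower i = relabel_stack t s x \<longleftrightarrow> (\<exists>k. x = Lower k \<and> i = s k)" for x i
    by (cases x; auto)+
  have "Upper i \<in> relabel_stack t s ` C \<longleftrightarrow> (\<exists>k. i = t k \<and> Upper k \<in> C)" for i
    unfolding image_iff eq by auto
  moreover have "Lower i \<in> relabel_stack t s ` C \<longleftrightarrow> (\<exists>k. i = s k \<and> Lower k \<in> C)" for i
    unfolding image_iff eq by auto
  moreover have eq': "Top i = relabel_ends t s y \<longleftrightarrow> (\<exists>k. y = Top k \<and> i = t k)"
    "Bot i = relabel_ends t s y \<longleftrightarrow> (\<exists>k. y = Bot k \<and> i = s k)" for y i
    by (cases y; auto)+
  have "Top i \<in> relabel_ends t s ` P \<longleftrightarrow> (\<exists>k. i = t k \<and> Top k \<in> P)"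
    "Bot i \<in> relabel_ends t s ` P \<longleftrightarrow> (\<exists>k. i = s k \<and> Bot k \<in> P)" for i P
    unfolding image_iff eq' by auto
  moreover have "Top i \<in> trace D \<longleftrightarrow> Upper i \<in> D" "Bot i \<in> trace D \<longleftrightarrow> Lower i \<in> D" for i D
    by (auto simp: trace_def)
  ultimately have "x \<in> trace (relabel_stack t s ` C) \<longleftrightarrow> x \<in> relabel_ends t s ` trace C" for x
    by (cases x) simp_all
  then show ?thesis by blast
qed

lemma loops_relabel:
  assumes "bij t" "bij s"
  shows "card (loops ((`) (relabel_stack t s) ` E)) = card (loops E)"
    "traces ((`) (relabel_stack t s) ` E) = (`) (relabel_ends t s) ` traces E"
proof -
  let ?f = "relabel_stack t s"
  have b: "bij ?f" using bij_relabel_stack[OF assms] .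
  have inj: "inj ((`) ?f)" using bij_is_inj[OF b] by (simp add: inj_image_eq_iff inj_def)
  have mid: "?f ` C \<subseteq> range Middle \<longleftrightarrow> C \<subseteq> range Middle" for C
  proof -
    have "?f x \<in> range Middle \<longleftrightarrow> x \<in> range Middle" for x by (auto simp: relabel_stack_def split: stacked_point.splits)
    then show ?thesis unfolding image_subset_iff subset_eq by simp
  qed
  have image_Collect: "{C \<in> g ` A. P C} = g ` {C \<in> A. P (g C)}" for g :: "stacked_point set \<Rightarrow> stacked_point set" and A P
    by auto
  have l: "loops ((`) ?f ` E) = (`) ?f ` loops E"
    unfolding loops_def components_bij_image[OF b] image_Collect mid ..
  show "card (loops ((`) ?f ` E)) = card (loops E)" unfolding l by (rule card_image[OF inj_on_subset[OF inj subset_UNIV]])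
  have "components ((`) ?f ` E) - loops ((`) ?f ` E) = (`) ?f ` (components E - loops E)"
    unfolding l components_bij_image[OF b] using image_set_diff[OF inj] by simp
  then show "traces ((`) ?f ` E) = (`) (relabel_ends t s) ` traces E"
    unfolding traces_def by (simp only: image_image trace_relabel[OF assms])
qed

section \<open>Pair partitions as involutions\<close>

definition partner :: "'a set \<Rightarrow> 'a set set \<Rightarrow> 'a \<Rightarrow> 'a" where
  "partner S d = (THE u. u \<in> matchings S \<and> edges S u = d)"

lemma edges_inject:
  assumes "u \<in> matchings S" "u' \<in> matchings S" "edges S u = edges S u'"
  shows "u = u'"
proof
  fix x
  show "u x = u' x"
  proof (cases "x \<in> S")
    case True
    then have "{x, u x} \<in> edges S u'" using assms(3) by (auto simp: edges_def)
    then obtain y where "y \<in> S" "{x, u x} = {y, u' y}" by (auto simp: edges_def)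
    then show ?thesis using matchingsD(3)[OF assms(2)] by (auto simp: doubleton_eq_iff)
  next
    case False
    then show ?thesis using assms(1,2) matchingsD(4) by metis
  qed
qed

lemma partner_edges: "u \<in> matchings S \<Longrightarrow> partner S (edges S u) = u"
  unfolding partner_def using edges_inject by (intro the_equality) auto

lemma brauer_diagram_iff:
  "brauer_diagram p q d \<longleftrightarrow> (\<exists>u\<in>matchings (points p q). d = edges (points p q) u)"
proof
  assume d: "brauer_diagram p q d"
  let ?S = "points p q"
  have un: "\<Union>d = ?S" and dis: "disjoint d" and two: "\<And>e. e \<in> d \<Longrightarrow> card e = 2"
    using d by (auto simp: brauer_diagram_def partition_on_def)
  have uniq: "e = e'" if "e \<in> d" "e' \<in> d" "x \<in> e" "x \<in> e'" for e e' x
    using dis that by (auto simp: disjoint_def)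
  have ex: "\<exists>y. {x, y} \<in> d \<and> y \<noteq> x" if x: "x \<in> ?S" for x
  proof -
    obtain e where e: "e \<in> d" "x \<in> e" using un x by blast
    then obtain a b where "e = {a, b}" "a \<noteq> b" using two[of e] by (auto simp: card_2_iff)
    then show ?thesis using e by (auto simp: insert_commute)
  qed
  define u where "u x = (if x \<in> ?S then (SOME y. {x, y} \<in> d \<and> y \<noteq> x) else x)" for x
  have u: "{x, u x} \<in> d" "u x \<noteq> x" if "x \<in> ?S" for x
    using someI_ex[OF ex[OF that]] that by (auto simp: u_def)
  have uS: "u x \<in> ?S" if "x \<in> ?S" for x using u[OF that] un by blast
  have uu: "u (u x) = x" if x: "x \<in> ?S" for x
  proof -
    have "{x, u x} = {u x, u (u x)}" using uniq[OF u(1)[OF x] u(1)[OF uS[OF x]], of "u x"] by auto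
    then show ?thesis using u(2)[OF x] by (auto simp: doubleton_eq_iff)
  qed
  have "u \<in> matchings ?S" using u uS uu by (auto simp: matchings_def u_def)
  moreover have "d = edges ?S u"
  proof (intro equalityI subsetI)
    fix e assume e: "e \<in> d"
    then obtain x where x: "x \<in> e" using two[OF e] by fastforce
    then have "x \<in> ?S" using e un by blast
    then have "e = {x, u x}" using uniq[OF e u(1), of x x] x by auto
    then show "e \<in> edges ?S u" using \<open>x \<in> ?S\<close> by (auto simp: edges_def)
  qed (use u in \<open>auto simp: edges_def\<close>)
  ultimately show "\<exists>u\<in>matchings ?S. d = edges ?S u" by blast
next
  assume "\<exists>u\<in>matchings (points p q). d = edges (points p q) u"
  then obtain u where u: "u \<in> matchings (points p q)" "d = edges (points p q) u" by auto
  note U = matchingsD[OF u(1)]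
  have "e = e'" if e: "e \<in> d" "e' \<in> d" "z \<in> e" "z \<in> e'" for e e' z
  proof -
    obtain x y where xy: "e = {x, u x}" "e' = {y, u y}" using e u(2) by (auto simp: edges_def)
    have "e = {z, u z}" using xy(1) e(3) U(3)[of x] by auto
    moreover have "e' = {z, u z}" using xy(2) e(4) U(3)[of y] by auto
    ultimately show ?thesis by simp
  qed
  then have "disjoint d" by (auto simp: disjoint_def)
  moreover have "card e = 2" if e: "e \<in> d" for e
  proof -
    obtain x where "x \<in> points p q" "e = {x, u x}" using e u(2) by (auto simp: edges_def)
    then show ?thesis using U(2)[of x] by auto
  qed
  moreover from this have "{} \<notin> d" by fastforce
  moreover have "\<Union>d = points p q" using Union_edges[OF u(1)] u(2) by simp
  ultimately show "brauer_diagram p q d" by (auto simp: brauer_diagram_def partition_on_def)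
qed

lemma points_eq: "points p q = tops p \<union> Bot ` {1..q}"
  by (simp add: points_def tops_def)

lemma upward_edges_iff:
  assumes "u \<in> matchings (points p q)"
  shows "upward (edges (points p q) u) \<longleftrightarrow> u \<in> upward_matchings (tops p) (Bot ` {1..q})"
proof -
  note U = matchingsD[OF assms]
  have "upward (edges (points p q) u) \<longleftrightarrow> (\<forall>x\<in>tops p. u x \<notin> tops p)"
  proof
    assume up: "upward (edges (points p q) u)"
    show "\<forall>x\<in>tops p. u x \<notin> tops p"
    proof
      fix x assume x: "x \<in> tops p"
      then have "{x, u x} \<in> edges (points p q) u" by (auto simp: edges_def points_eq)
      then show "u x \<notin> tops p" using up x by (auto simp: upward_def tops_def)
    qed
  next
    assume nt: "\<forall>x\<in>tops p. u x \<notin> tops p"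
    show "upward (edges (points p q) u)" unfolding upward_def
    proof
      assume "\<exists>i k. {Top i, Top k} \<in> edges (points p q) u"
      then obtain i k x where x: "{Top i, Top k} = {x, u x}" "x \<in> points p q" by (auto simp: edges_def)
      then have "x \<in> points p q" "u x \<in> points p q" using U(1) by auto
      moreover have "\<exists>i. x = Top i" "\<exists>i. u x = Top i" using x(1) by (metis doubleton_eq_iff)+
      ultimately show False using nt by (auto simp: points_eq)
    qed
  qed
  also have "\<dots> \<longleftrightarrow> (\<forall>x\<in>tops p. u x \<in> Bot ` {1..q})" using U(1) by (auto simp: points_eq tops_def)
  finally show ?thesis using assms by (simp add: upward_matchings_def points_eq)
qed

text \<open>Conjugation keeps the map an involution. On an upward matching the effect is that
  \<open>Top i\<close> receives the partner of \<open>Top (t i)\<close>.\<close>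

definition relabel_matching :: "(nat \<Rightarrow> nat) \<Rightarrow> (point \<Rightarrow> point) \<Rightarrow> point \<Rightarrow> point" where
  "relabel_matching t u = relabel (inv_into UNIV t) \<circ> u \<circ> relabel t"

lemma relabel_inverse:
  assumes "t permutes S"
  shows "relabel (inv_into UNIV t) (relabel t x) = x" "relabel t (relabel (inv_into UNIV t) x) = x"
  using permutes_inverses[OF assms] by (cases x; simp)+

lemma relabel_points: 
  assumes "t permutes {1..p}"
  shows "relabel t x \<in> points p q \<longleftrightarrow> x \<in> points p q" "relabel t x \<in> tops p \<longleftrightarrow> x \<in> tops p"
    "relabel t x \<in> Bot ` Q \<longleftrightarrow> x \<in> Bot ` Q"
  using permutes_in_image[OF assms] by (cases x; auto simp: points_eq tops_def)+

lemma relabel_matching_upward: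
  assumes t: "t permutes {1..p}" and u: "u \<in> upward_matchings (tops p) (Bot ` {1..q})"
  shows "relabel_matching t u \<in> upward_matchings (tops p) (Bot ` {1..q})"
proof -
  note i = relabel_inverse[OF t]
  have ti: "inv_into UNIV t permutes {1..p}" by (rule permutes_inv[OF t])
  note U = matchingsD[OF upward_matchingsD(1)[OF u], folded points_eq]
  note P = relabel_points[OF t] relabel_points[OF ti]
  have "relabel_matching t u x \<in> points p q \<and> relabel_matching t u x \<noteq> x \<and> relabel_matching t u (relabel_matching t u x) = x"
    if "x \<in> points p q" for x
  proof -
    have "relabel (inv_into UNIV t) y = x \<longleftrightarrow> y = relabel t x" for y using i by metis
    then show ?thesis using that U(1,2)[of "relabel t x"] U(3) P i by (simp add: relabel_matching_def)
  qed
  moreover have "relabel_matching t u x = x" if "x \<notin> points p q" for x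
    using that U(4)[of "relabel t x"] P i by (auto simp: relabel_matching_def)
  moreover have "relabel_matching t u x \<in> Bot ` {1..q}" if "x \<in> tops p" for x
    using that upward_matchingsD(2)[OF u, of "relabel t x"] P by (simp add: relabel_matching_def)
  ultimately show ?thesis by (auto simp: upward_matchings_def matchings_def points_eq)
qed

lemma edges_relabel_matching:
  assumes t: "t permutes {1..p}"
  shows "edges (points p q) (relabel_matching t u) = (`) (relabel (inv_into UNIV t)) ` edges (points p q) u"
proof -
  have ti: "inv_into UNIV t permutes {1..p}" by (rule permutes_inv[OF t])
  have S: "points p q = relabel (inv_into UNIV t) ` points p q"
  proof (intro equalityI subsetI)
    fix x assume "x \<in> points p q"
    then have "relabel t x \<in> points p q" "x = relabel (inv_into UNIV t) (relabel t x)"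
      using relabel_points(1)[OF t] relabel_inverse[OF t] by auto
    then show "x \<in> relabel (inv_into UNIV t) ` points p q" by blast
  qed (use relabel_points(1)[OF ti] in auto)
  have "edges (points p q) (relabel_matching t u) = (\<lambda>x. {x, relabel_matching t u x}) ` relabel (inv_into UNIV t) ` points p q"
    unfolding edges_def by (subst S) simp
  also have "\<dots> = (`) (relabel (inv_into UNIV t)) ` edges (points p q) u"
    by (simp add: edges_def image_image relabel_matching_def relabel_inverse[OF t])
  finally show ?thesis .
qed

lemma stack_relabel:
  assumes "t permutes {1..p}" "s permutes {1..p}"
  shows "stack (points p q) (relabel_matching s w) (relabel_matching t u) =
    (`) (relabel_stack (inv_into UNIV t) (inv_into UNIV s)) ` stack (points p q) w u"
proof -
  let ?f = "relabel_stack (inv_into UNIV t) (inv_into UNIV s)"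
  have "in_upper (relabel (inv_into UNIV t) x) = ?f (in_upper x)" for x by (cases x) auto
  then have 1: "in_upper ` relabel (inv_into UNIV t) ` e = ?f ` in_upper ` e" for e by (simp add: image_image)
  have "in_flipped (relabel (inv_into UNIV s) x) = ?f (in_flipped x)" for x by (cases x) auto
  then have 2: "in_flipped ` relabel (inv_into UNIV s) ` e = ?f ` in_flipped ` e" for e by (simp add: image_image)
  show ?thesis
    unfolding stack_def edges_relabel_matching[OF assms(1)] edges_relabel_matching[OF assms(2)] image_Un
    by (simp only: image_image[where f = "(`) in_upper"] image_image[where f = "(`) in_flipped"] image_image[where f = "(`) ?f"] 1 2)
qed

lemma diagram_of_perm_relabel:
  assumes t: "t permutes {1..p}" and s: "s permutes {1..p}"
  shows "(`) (relabel_ends t s) ` diagram_of_perm p id = diagram_of_perm p (s \<circ> inv_into UNIV t)"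
proof -
  have "(`) (relabel_ends t s) ` diagram_of_perm p id = (\<lambda>i. {Top (t i), Bot (s i)}) ` {1..p}"
    by (simp add: diagram_of_perm_def image_image)
  also have "\<dots> = (\<lambda>i. {Top i, Bot (s (inv_into UNIV t i))}) ` t ` {1..p}"
    by (simp add: image_image permutes_inverses(2)[OF t])
  also have "t ` {1..p} = {1..p}" by (rule permutes_image[OF t])
  finally show ?thesis by (simp add: diagram_of_perm_def)
qed

text \<open>The relabelled composite is the identity iff the original permutation is
  \<open>s\<close> after the inverse of \<open>t\<close>, which is the group element that the left
  regular representation reads off in row \<open>s\<close> and column \<open>t\<close>.\<close>

lemma straight_relabel:
  assumes t: "t permutes {1..p}" and s: "s permutes {1..p}"
  shows "straight p (stack (points p q) (relabel_matching s w) (relabel_matching t u)) \<longleftrightarrow>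
      traces (stack (points p q) w u) = diagram_of_perm p (s \<circ> inv_into UNIV t)"
    "card (loops (stack (points p q) (relabel_matching s w) (relabel_matching t u))) = card (loops (stack (points p q) w u))"
proof -
  have ti: "inv_into UNIV t permutes {1..p}" and si: "inv_into UNIV s permutes {1..p}" using t s permutes_inv by auto
  have b: "bij (inv_into UNIV t)" "bij (inv_into UNIV s)" using ti si permutes_bij by auto
  let ?E = "stack (points p q) w u"
  let ?h = "relabel_ends (inv_into UNIV t) (inv_into UNIV s)" and ?k = "relabel_ends t s"
  have hk: "?h (?k x) = x" "?k (?h x) = x" for x
    using permutes_inverses[OF t] permutes_inverses[OF s] by (cases x; simp)+
  have hk': "(`) ?h ` (`) ?k ` P = P" "(`) ?k ` (`) ?h ` P = P" for P by (simp_all add: image_image hk)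
  show "card (loops (stack (points p q) (relabel_matching s w) (relabel_matching t u))) = card (loops ?E)"
    unfolding stack_relabel[OF assms] by (rule loops_relabel(1)[OF b])
  have "straight p (stack (points p q) (relabel_matching s w) (relabel_matching t u)) \<longleftrightarrow> (`) ?h ` traces ?E = diagram_of_perm p id"
    unfolding straight_def stack_relabel[OF assms] loops_relabel(2)[OF b] ..
  also have "\<dots> \<longleftrightarrow> traces ?E = (`) ?k ` diagram_of_perm p id" using hk' by metis
  finally show "straight p (stack (points p q) (relabel_matching s w) (relabel_matching t u)) \<longleftrightarrow>
      traces ?E = diagram_of_perm p (s \<circ> inv_into UNIV t)"
    unfolding diagram_of_perm_relabel[OF assms] .
qed

text \<open>Monotonicity gives \<open>i \<le> \<pi> i\<close> for all \<open>i\<close>, and both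
  sides have the same sum.\<close>

lemma strict_mono_permutes_id:
  assumes p: "\<pi> permutes {1..n::nat}" and mono: "\<And>i k. i \<in> {1..n} \<Longrightarrow> k \<in> {1..n} \<Longrightarrow> i < k \<Longrightarrow> \<pi> i < \<pi> k"
  shows "\<pi> = id"
proof (rule ccontr)
  assume "\<pi> \<noteq> id"
  have ge: "i \<le> \<pi> i" if "i \<in> {1..n}" for i
    using that
  proof (induction i)
    case (Suc i)
    show ?case
    proof (cases "i = 0")
      case True
      then show ?thesis using permutes_in_image[OF p, of 1] Suc.prems by auto
    next
      case False
      then have "i \<in> {1..n}" using Suc.prems by auto
      then show ?thesis using Suc.IH mono[of i "Suc i"] Suc.prems by force
    qed
  qed auto
  obtain i where i: "\<pi> i \<noteq> i" using \<open>\<pi> \<noteq> id\<close> by (auto simp: fun_eq_iff)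
  then have "i \<in> {1..n}" using permutes_not_in[OF p] by blast
  then have "(\<Sum>i\<in>{1..n}. i) < (\<Sum>i\<in>{1..n}. \<pi> i)"
    using ge i by (intro sum_strict_mono_ex1) (auto intro!: bexI[of _ i] simp: less_le)
  moreover have "(\<Sum>i\<in>{1..n}. \<pi> i) = (\<Sum>i\<in>{1..n}. i)"
    using sum.permute[OF p, of "\<lambda>i. i"] by (simp add: comp_def)
  ultimately show False by simp
qed

lemma Top_Bot_edge:
  assumes "u \<in> upward_matchings (tops p) (Bot ` {1..q})"
  shows "{Top i, Bot j} \<in> edges (points p q) u \<longleftrightarrow> i \<in> {1..p} \<and> u (Top i) = Bot j"
proof
  note U = matchingsD[OF upward_matchingsD(1)[OF assms], folded points_eq]
  assume "{Top i, Bot j} \<in> edges (points p q) u"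
  then obtain x where x: "x \<in> points p q" "{Top i, Bot j} = {x, u x}" by (auto simp: edges_def)
  then have "u (Top i) = Bot j" "Top i \<in> points p q" using U(1,3)[of x] by (auto simp: doubleton_eq_iff)
  then show "i \<in> {1..p} \<and> u (Top i) = Bot j" by (auto simp: points_eq tops_def)
next
  assume "i \<in> {1..p} \<and> u (Top i) = Bot j"
  then show "{Top i, Bot j} \<in> edges (points p q) u"
    by (auto simp: edges_def points_eq tops_def image_iff intro!: bexI[of _ "Top i"])
qed

section \<open>Upward diagrams as monotone diagrams with permuted tops\<close>

definition increasing :: "nat \<Rightarrow> (point \<Rightarrow> point) \<Rightarrow> bool" where
  "increasing p u \<longleftrightarrow> (\<forall>i\<in>{1..p}. \<forall>k\<in>{1..p}. \<forall>j l. u (Top i) = Bot j \<longrightarrow> u (Top k) = Bot l \<longrightarrow> i < k \<longrightarrow> j < l)"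

lemma monotone_edges_iff:
  assumes u: "u \<in> upward_matchings (tops p) (Bot ` {1..q})"
  shows "monotone_diagram (edges (points p q) u) \<longleftrightarrow> increasing p u"
proof
  assume m: "monotone_diagram (edges (points p q) u)"
  show "increasing p u" unfolding increasing_def
  proof (intro ballI allI impI)
    fix i k j l assume a: "i \<in> {1..p}" "k \<in> {1..p}" "u (Top i) = Bot j" "u (Top k) = Bot l" "i < k"
    then have "(int i - int k) * (int j - int l) > 0"
      using m unfolding monotone_diagram_def Top_Bot_edge[OF u] by (auto simp: doubleton_eq_iff)
    then show "j < l" using a(5) by (auto simp: zero_less_mult_iff)
  qed
next
  assume inc: "increasing p u"
  note U = matchingsD[OF upward_matchingsD(1)[OF u]]
  show "monotone_diagram (edges (points p q) u)"
    unfolding monotone_diagram_def Top_Bot_edge[OF u]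
  proof (intro allI impI)
    fix i j k l assume a: "i \<in> {1..p} \<and> u (Top i) = Bot j" "k \<in> {1..p} \<and> u (Top k) = Bot l" "{Top i, Bot j} \<noteq> {Top k, Bot l}"
    have "i \<noteq> k" using a by auto
    then consider "i < k" | "k < i" by linarith
    then show "(int i - int k) * (int j - int l) > 0"
    proof cases
      case 1
      then have "j < l" using inc a unfolding increasing_def by blast
      then show ?thesis using 1 by (simp add: zero_less_mult_iff)
    next
      case 2
      then have "l < j" using inc a unfolding increasing_def by blast
      then show ?thesis using 2 by (simp add: zero_less_mult_iff)
    qed
  qed
qed

lemma upward_monotone_eq:
  "upward_monotone p q = edges (points p q) ` {u \<in> upward_matchings (tops p) (Bot ` {1..q}). increasing p u}"
proof (intro equalityI subsetI)
  fix d assume "d \<in> upward_monotone p q"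
  then obtain u where u: "u \<in> matchings (points p q)" "d = edges (points p q) u" "upward d" "monotone_diagram d"
    by (auto simp: upward_monotone_def brauer_diagram_iff)
  then have "u \<in> upward_matchings (tops p) (Bot ` {1..q})" using upward_edges_iff by simp
  then show "d \<in> edges (points p q) ` {u \<in> upward_matchings (tops p) (Bot ` {1..q}). increasing p u}"
    using monotone_edges_iff u by blast
next
  fix d assume "d \<in> edges (points p q) ` {u \<in> upward_matchings (tops p) (Bot ` {1..q}). increasing p u}"
  then obtain u where u: "u \<in> upward_matchings (tops p) (Bot ` {1..q})" "increasing p u" "d = edges (points p q) u" by auto
  have m: "u \<in> matchings (points p q)" using upward_matchingsD(1)[OF u(1)] by (simp add: points_eq)
  then show "d \<in> upward_monotone p q"
    using u upward_edges_iff[OF m] monotone_edges_iff[OF u(1)] by (auto simp: upward_monotone_def brauer_diagram_iff)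
qed

lemma relabel_matching_comp:
  assumes "s permutes S" "t permutes S"
  shows "relabel_matching s (relabel_matching t u) = relabel_matching (t \<circ> s) u"
proof
  fix x
  have "inv_into UNIV (t \<circ> s) = inv_into UNIV s \<circ> inv_into UNIV t"
    using assms permutes_bij by (intro o_inv_distrib) auto
  then have 1: "relabel (inv_into UNIV (t \<circ> s)) y = relabel (inv_into UNIV s) (relabel (inv_into UNIV t) y)" for y
    by (cases y) auto
  have 2: "relabel (t \<circ> s) y = relabel t (relabel s y)" for y by (cases y) auto
  show "relabel_matching s (relabel_matching t u) x = relabel_matching (t \<circ> s) u x"
    by (simp add: relabel_matching_def 1 2)
qed

lemma relabel_matching_id [simp]: "relabel_matching id u = u"
proof
  fix x
  have "relabel id y = y" for y by (cases y) auto
  then show "relabel_matching id u x = u x" by (simp add: relabel_matching_def)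
qed

lemma upward_Top:
  assumes "u \<in> upward_matchings (tops p) (Bot ` Q)" "i \<in> {1..p}"
  obtains j where "u (Top i) = Bot j" "j \<in> Q"
  using upward_matchingsD(2)[OF assms(1), of "Top i"] assms(2) by (auto simp: tops_def)

text \<open>The permutation \<open>\<pi>\<close> that carries \<open>u'\<close> to \<open>u\<close>
  relates two increasing assignments, so it is increasing and hence the identity.\<close>

lemma relabel_matching_inject:
  assumes u: "u \<in> upward_matchings (tops p) (Bot ` {1..q})" "increasing p u"
    and u': "u' \<in> upward_matchings (tops p) (Bot ` {1..q})" "increasing p u'"
    and t: "t permutes {1..p}" "t' permutes {1..p}" and eq: "relabel_matching t u = relabel_matching t' u'"
  shows "u = u' \<and> t = t'"
proof -
  define \<pi> where "\<pi> = t' \<circ> inv_into UNIV t"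
  have ti: "inv_into UNIV t permutes {1..p}" by (rule permutes_inv[OF t(1)])
  have p: "\<pi> permutes {1..p}" unfolding \<pi>_def by (rule permutes_compose[OF ti t(2)])
  have "relabel_matching (inv_into UNIV t) (relabel_matching t u) = u"
    using relabel_matching_comp[OF ti t(1)] permutes_inv_o(1)[OF t(1)] by simp
  then have u_eq: "u = relabel_matching \<pi> u'"
    using eq relabel_matching_comp[OF ti t(2)] by (simp add: \<pi>_def)
  have pos: "u' (Top (\<pi> i)) = Bot j" if "u (Top i) = Bot j" for i j
  proof -
    have "relabel (inv_into UNIV \<pi>) (u' (Top (\<pi> i))) = Bot j" using that unfolding u_eq relabel_matching_def by simp
    then show ?thesis by (cases "u' (Top (\<pi> i))") auto
  qed
  have "\<pi> = id"
  proof (rule strict_mono_permutes_id[OF p])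
    fix i k assume ik: "i \<in> {1..p}" "k \<in> {1..p}" "i < k"
    obtain j l where jl: "u (Top i) = Bot j" "u (Top k) = Bot l" using upward_Top[OF u(1)] ik by metis
    have "j < l" using u(2) ik jl unfolding increasing_def by blast
    moreover have "l < j" if "\<pi> k < \<pi> i"
      using u'(2) pos[OF jl(1)] pos[OF jl(2)] that permutes_in_image[OF p] ik unfolding increasing_def by blast
    moreover have "\<pi> i \<noteq> \<pi> k" using ik(3) permutes_inj[OF p] by (auto simp: inj_eq)
    ultimately show "\<pi> i < \<pi> k" by (meson less_asym linorder_neqE_nat)
  qed
  then have "u = u'" using u_eq by simp
  moreover have "t' = t"
  proof -
    have "t' = \<pi> \<circ> t" unfolding \<pi>_def by (simp add: comp_assoc permutes_inv_o(2)[OF t(1)])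
    then show ?thesis using \<open>\<pi> = id\<close> by simp
  qed
  ultimately show ?thesis by simp
qed

text \<open>Sorting: \<open>t i\<close> is the rank of the partner of \<open>Top i\<close> among the
  partners of all tops.\<close>

lemma relabel_matching_surj:
  assumes d: "d \<in> upward_matchings (tops p) (Bot ` {1..q})"
  obtains u t where "u \<in> upward_matchings (tops p) (Bot ` {1..q})" "increasing p u" "t permutes {1..p}" "d = relabel_matching t u"
proof -
  note D = matchingsD[OF upward_matchingsD(1)[OF d]]
  have "\<forall>i\<in>{1..p}. \<exists>j. d (Top i) = Bot j" using upward_Top[OF d] by metis
  then obtain pos where pos: "\<And>i. i \<in> {1..p} \<Longrightarrow> d (Top i) = Bot (pos i)" by metis
  have pos_inj: "pos i \<noteq> pos k" if "i \<in> {1..p}" "k \<in> {1..p}" "i \<noteq> k" for i k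
    using pos[OF that(1)] pos[OF that(2)] D(3)[of "Top i"] D(3)[of "Top k"] that(3) by auto
  define t where "t i = (if i \<in> {1..p} then card {k \<in> {1..p}. pos k \<le> pos i} else i)" for i
  have less: "t i < t k" if "i \<in> {1..p}" "k \<in> {1..p}" "pos i < pos k" for i k
  proof -
    have "k \<in> {l \<in> {1..p}. pos l \<le> pos k}" "k \<notin> {l \<in> {1..p}. pos l \<le> pos i}" using that by auto
    moreover have "{l \<in> {1..p}. pos l \<le> pos i} \<subseteq> {l \<in> {1..p}. pos l \<le> pos k}" using that by auto
    ultimately have "{l \<in> {1..p}. pos l \<le> pos i} \<subset> {l \<in> {1..p}. pos l \<le> pos k}" by blast
    then have "card {l \<in> {1..p}. pos l \<le> pos i} < card {l \<in> {1..p}. pos l \<le> pos k}" by (intro psubset_card_mono) auto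
    then show ?thesis using that(1,2) by (simp only: t_def if_True)
  qed
  have t_inj: "inj_on t {1..p}"
  proof (rule inj_onI, rule ccontr)
    fix i k assume "i \<in> {1..p}" "k \<in> {1..p}" "t i = t k" "i \<noteq> k"
    then show False using pos_inj[of i k] less[of i k] less[of k i] by (metis less_irrefl linorder_neqE_nat)
  qed
  have "t i \<in> {1..p}" if i: "i \<in> {1..p}" for i
  proof -
    have "card {i} \<le> card {k \<in> {1..p}. pos k \<le> pos i}" using i by (intro card_mono) auto
    moreover have "card {k \<in> {1..p}. pos k \<le> pos i} \<le> card {1..p}" by (intro card_mono) auto
    ultimately show ?thesis using i by (simp add: t_def)
  qed
  then have "t ` {1..p} \<subseteq> {1..p}" by auto
  then have "t ` {1..p} = {1..p}" using t_inj by (metis card_image card_subset_eq finite_atLeastAtMost)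
  then have "bij_betw t {1..p} {1..p}" using t_inj by (simp add: bij_betw_def)
  then have t: "t permutes {1..p}" by (rule bij_imp_permutes) (simp only: t_def if_False)
  have ti: "inv_into UNIV t permutes {1..p}" by (rule permutes_inv[OF t])
  define u where "u = relabel_matching (inv_into UNIV t) d"
  have u: "u \<in> upward_matchings (tops p) (Bot ` {1..q})" unfolding u_def by (rule relabel_matching_upward[OF ti d])
  have d_eq: "d = relabel_matching t u"
    unfolding u_def using relabel_matching_comp[OF t ti, of d] permutes_inv_o(2)[OF t] by simp
  have u_pos: "u (Top (t i)) = Bot (pos i)" if "i \<in> {1..p}" for i
    using pos[OF that] permutes_inverses(2)[OF t] by (simp add: u_def relabel_matching_def)
  have "increasing p u" unfolding increasing_def
  proof (intro ballI allI impI)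
    fix a b j l assume a: "a \<in> {1..p}" "b \<in> {1..p}" "u (Top a) = Bot j" "u (Top b) = Bot l" "a < b"
    have "a \<in> t ` {1..p}" "b \<in> t ` {1..p}" using a(1,2) unfolding permutes_image[OF t] .
    then obtain i k where ik: "i \<in> {1..p}" "k \<in> {1..p}" "a = t i" "b = t k" by (elim imageE)
    have jl: "j = pos i" "l = pos k" using u_pos[OF ik(1)] u_pos[OF ik(2)] a(3,4) unfolding ik(3,4) by simp_all
    have "i \<noteq> k" using ik(3,4) a(5) by blast
    then have "pos i \<noteq> pos k" by (rule pos_inj[OF ik(1,2)])
    moreover have "\<not> pos k < pos i"
    proof
      assume "pos k < pos i"
      then have "t k < t i" by (rule less[OF ik(2,1)])
      then show False using a(5) ik(3,4) by simp
    qed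
    ultimately show "j < l" unfolding jl by simp
  qed
  then show ?thesis using that u t d_eq by blast
qed

definition index_matching :: "nat \<Rightarrow> nat \<Rightarrow> diagram \<times> (nat \<Rightarrow> nat) \<Rightarrow> point \<Rightarrow> point" where
  "index_matching p q = (\<lambda>(g, t). relabel_matching t (partner (points p q) g))"

abbreviation gram_index :: "nat \<Rightarrow> nat \<Rightarrow> (diagram \<times> (nat \<Rightarrow> nat)) set" where
  "gram_index p q \<equiv> upward_monotone p q \<times> carrier (sym_group p)"

lemma carrier_sym_group: "t \<in> carrier (sym_group p) \<longleftrightarrow> t permutes {1..p}"
  by (simp add: sym_group_def)

lemma index_matching_bij:
  "bij_betw (index_matching p q) (gram_index p q) (upward_matchings (tops p) (Bot ` {1..q}))"
proof (rule bij_betw_imageI)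
  let ?S = "points p q" and ?U = "upward_matchings (tops p) (Bot ` {1..q})"
  have val: "index_matching p q (edges ?S u, t) = relabel_matching t u" if "u \<in> ?U" for u t
    using partner_edges[of u ?S] upward_matchingsD(1)[OF that] by (simp add: index_matching_def points_eq)
  show "inj_on (index_matching p q) (gram_index p q)"
  proof (rule inj_onI)
    fix x y assume xy: "x \<in> gram_index p q" "y \<in> gram_index p q" "index_matching p q x = index_matching p q y"
    obtain u t where x: "x = (edges ?S u, t)" "u \<in> ?U" "increasing p u" "t permutes {1..p}"
      using xy(1) by (auto simp: upward_monotone_eq carrier_sym_group)
    obtain u' t' where y: "y = (edges ?S u', t')" "u' \<in> ?U" "increasing p u'" "t' permutes {1..p}"
      using xy(2) by (auto simp: upward_monotone_eq carrier_sym_group)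
    have "u = u' \<and> t = t'"
      by (rule relabel_matching_inject[OF x(2,3) y(2,3) x(4) y(4)]) (use xy(3) x y val in simp)
    then show "x = y" using x y by simp
  qed
  show "index_matching p q ` gram_index p q = ?U"
  proof (intro equalityI subsetI)
    fix d assume "d \<in> index_matching p q ` gram_index p q"
    then obtain u t where "d = index_matching p q (edges ?S u, t)" "u \<in> ?U" "t permutes {1..p}"
      by (auto simp: upward_monotone_eq carrier_sym_group)
    then show "d \<in> ?U" using val relabel_matching_upward by simp
  next
    fix d assume "d \<in> ?U"
    then obtain u t where ut: "u \<in> ?U" "increasing p u" "t permutes {1..p}" "d = relabel_matching t u"
      by (rule relabel_matching_surj)
    then have "(edges ?S u, t) \<in> gram_index p q" by (auto simp: upward_monotone_eq carrier_sym_group)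
    then show "d \<in> index_matching p q ` gram_index p q" using val[OF ut(1), of t] ut(4) by (metis imageI)
  qed
qed

lemma diagram_of_perm_inject:
  assumes "\<sigma> permutes {1..p}" "\<tau> permutes {1..p}" "diagram_of_perm p \<sigma> = diagram_of_perm p \<tau>"
  shows "\<sigma> = \<tau>"
proof
  fix i
  show "\<sigma> i = \<tau> i"
  proof (cases "i \<in> {1..p}")
    case True
    then have "{Top i, Bot (\<sigma> i)} \<in> diagram_of_perm p \<sigma>" by (auto simp: diagram_of_perm_def)
    then have "{Top i, Bot (\<sigma> i)} \<in> diagram_of_perm p \<tau>" using assms(3) by simp
    then show ?thesis by (auto simp: diagram_of_perm_def doubleton_eq_iff)
  next
    case False
    then show ?thesis using permutes_not_in[OF assms(1)] permutes_not_in[OF assms(2)] by simp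
  qed
qed

text \<open>Every upper and every lower point lies on exactly one strand, so the strands of a level
  composite define a permutation; it is the value that \<open>perm_of_diagram\<close>
  describes.\<close>

lemma level_traces:
  assumes u: "u \<in> matchings (points p q)" and w: "w \<in> matchings (points p q)"
    and lev: "level (traces (stack (points p q) w u))"
  shows "\<exists>\<sigma>. \<sigma> permutes {1..p} \<and> traces (stack (points p q) w u) = diagram_of_perm p \<sigma>"
proof -
  let ?E = "stack (points p q) w u"
  have Up: "Upper i \<in> \<Union>?E \<longleftrightarrow> i \<in> {1..p}" for i
  proof -
    have "Upper i = in_upper x \<longleftrightarrow> x = Top i" "Upper i \<noteq> in_flipped x" for x by (cases x; auto)+
    then have "Upper i \<in> in_upper ` e \<longleftrightarrow> Top i \<in> e" "Upper i \<notin> in_flipped ` e" for e by (auto simp: image_iff)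
    then have "Upper i \<in> \<Union>?E \<longleftrightarrow> Top i \<in> \<Union>(edges (points p q) u)" by (simp add: stack_def)
    then show ?thesis unfolding Union_edges[OF u] by (auto simp: points_eq tops_def)
  qed
  have Lo: "Lower i \<in> \<Union>?E \<longleftrightarrow> i \<in> {1..p}" for i
  proof -
    have "Lower i = in_flipped x \<longleftrightarrow> x = Top i" "Lower i \<noteq> in_upper x" for x by (cases x; auto)+
    then have "Lower i \<in> in_flipped ` e \<longleftrightarrow> Top i \<in> e" "Lower i \<notin> in_upper ` e" for e by (auto simp: image_iff)
    then have "Lower i \<in> \<Union>?E \<longleftrightarrow> Top i \<in> \<Union>(edges (points p q) w)" by (simp add: stack_def)
    then show ?thesis unfolding Union_edges[OF w] by (auto simp: points_eq tops_def)
  qed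
  have mem: "Top i \<in> trace D \<longleftrightarrow> Upper i \<in> D" "Bot i \<in> trace D \<longleftrightarrow> Lower i \<in> D" for i D
    by (auto simp: trace_def)
  have range: "i \<in> {1..p}" if e: "e \<in> traces ?E" "Top i \<in> e \<or> Bot i \<in> e" for e i
  proof -
    obtain C where C: "C \<in> components ?E" "e = trace C" using e(1) by (auto simp: traces_def)
    then have "C \<subseteq> \<Union>?E" using Union_components[of ?E] by blast
    then show ?thesis using e(2) Up[of i] Lo[of i] C(2) mem by blast
  qed
  have uniq: "e = e'" if e: "e \<in> traces ?E" "e' \<in> traces ?E" "x \<in> e" "x \<in> e'" for e e' x
  proof -
    obtain C C' where C: "C \<in> components ?E" "e = trace C" "C' \<in> components ?E" "e' = trace C'" using e by (auto simp: traces_def)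
    obtain y where "y \<in> C" "y \<in> C'" using e(3,4) C mem by (cases x) auto
    then show ?thesis using component_disjoint[OF C(1,3)] C by auto
  qed
  have ex: "\<exists>j. {Top i, Bot j} \<in> traces ?E" if i: "i \<in> {1..p}" for i
  proof -
    obtain C where C: "C \<in> components ?E" "Upper i \<in> C" using Up[of i] i Union_components[of ?E] by blast
    then have "C \<notin> loops ?E" by (auto simp: loops_def)
    then have e: "trace C \<in> traces ?E" "Top i \<in> trace C" using C mem by (auto simp: traces_def)
    then obtain a b where "trace C = {Top a, Bot b}" using lev by (auto simp: level_def)
    then show ?thesis using e by auto
  qed
  then obtain s where s: "\<And>i. i \<in> {1..p} \<Longrightarrow> {Top i, Bot (s i)} \<in> traces ?E" by metis
  define \<sigma> where "\<sigma> i = (if i \<in> {1..p} then s i else i)" for i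
  have \<sigma>: "{Top i, Bot (\<sigma> i)} \<in> traces ?E" if "i \<in> {1..p}" for i using s[OF that] that by (simp add: \<sigma>_def)
  have "inj_on \<sigma> {1..p}"
  proof (rule inj_onI)
    fix i k assume ik: "i \<in> {1..p}" "k \<in> {1..p}" "\<sigma> i = \<sigma> k"
    have "{Top i, Bot (\<sigma> i)} = {Top k, Bot (\<sigma> k)}" using uniq[OF \<sigma>[OF ik(1)] \<sigma>[OF ik(2)], of "Bot (\<sigma> i)"] ik(3) by simp
    then show "i = k" by (auto simp: doubleton_eq_iff)
  qed
  moreover have "\<sigma> ` {1..p} \<subseteq> {1..p}" using range[OF \<sigma>] by blast
  ultimately have "bij_betw \<sigma> {1..p} {1..p}" by (metis bij_betw_def card_image card_subset_eq finite_atLeastAtMost)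
  then have perm: "\<sigma> permutes {1..p}" by (rule bij_imp_permutes) (simp only: \<sigma>_def if_False)
  have "traces ?E = diagram_of_perm p \<sigma>"
  proof (intro equalityI subsetI)
    fix e assume e: "e \<in> traces ?E"
    then obtain i j where ij: "e = {Top i, Bot j}" using lev by (auto simp: level_def)
    then have i: "i \<in> {1..p}" using range[OF e] by auto
    have "e = {Top i, Bot (\<sigma> i)}" using uniq[OF e \<sigma>[OF i], of "Top i"] ij by auto
    then show "e \<in> diagram_of_perm p \<sigma>" using i by (auto simp: diagram_of_perm_def)
  qed (use \<sigma> in \<open>auto simp: diagram_of_perm_def\<close>)
  then show ?thesis using perm by blast
qed

lemma gram_entry_edges:
  assumes u: "u \<in> matchings (points p q)" and w: "w \<in> matchings (points p q)" and \<sigma>: "\<sigma> permutes {1..p}"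
  shows "gram_entry p (edges (points p q) w) (edges (points p q) u) \<sigma> =
    (if traces (stack (points p q) w u) = diagram_of_perm p \<sigma>
     then Polynomial.monom 1 (card (loops (stack (points p q) w u))) else 0)"
proof -
  let ?E = "stack (points p q) w u"
  have lev: "level (diagram_of_perm p \<tau>)" for \<tau> by (auto simp: level_def diagram_of_perm_def)
  have perm: "perm_of_diagram p (diagram_of_perm p \<tau>) = \<tau>" if "\<tau> permutes {1..p}" for \<tau>
    unfolding perm_of_diagram_def carrier_sym_group using that diagram_of_perm_inject by (intro the_equality) auto
  have "level (traces ?E) \<and> \<sigma> = perm_of_diagram p (traces ?E) \<longleftrightarrow> traces ?E = diagram_of_perm p \<sigma>"
    using level_traces[OF u w] perm lev \<sigma> by metis
  then show ?thesis
    unfolding gram_entry_def closed_loops_flip compose_flip gr_single_def by auto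
qed

lemma left_regular_eq:
  assumes s: "s permutes {1..p}" and t: "t permutes {1..p}"
  shows "left_regular (sym_group p) a s t = a (s \<circ> inv_into UNIV t)"
proof -
  let ?P = "{(x, y). x \<in> carrier (sym_group p) \<and> y \<in> carrier (sym_group p) \<and> x \<otimes>\<^bsub>sym_group p\<^esub> y = s}"
  have mult: "x \<otimes>\<^bsub>sym_group p\<^esub> y = x \<circ> y" for x y by (simp add: sym_group_def)
  have st: "s \<circ> inv_into UNIV t permutes {1..p}" by (rule permutes_compose[OF permutes_inv[OF t] s])
  have "finite (carrier (sym_group p) \<times> carrier (sym_group p))"
    by (simp add: sym_group_def finite_permutations)
  then have fin: "finite ?P" by (rule rev_finite_subset) auto
  have sub: "{(s \<circ> inv_into UNIV t, t)} \<subseteq> ?P"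
    using st t by (auto simp: carrier_sym_group mult comp_assoc permutes_inv_o(2)[OF t])
  have "(\<Sum>(x, y)\<in>?P. a x * gr_single 1 t y) = (\<Sum>(x, y)\<in>{(s \<circ> inv_into UNIV t, t)}. a x * gr_single 1 t y)"
    by (intro sum.mono_neutral_right fin sub) (auto simp: gr_single_def mult comp_assoc permutes_inv_o(1)[OF t] split: if_splits)
  then show ?thesis by (simp add: left_regular_def gr_mult_def gr_single_def)
qed

text \<open>The regular representation is traded here for the larger index set of all upward
  diagrams.\<close>

lemma iota_gram_entry:
  assumes "x \<in> gram_index p q" "y \<in> gram_index p q"
  defines "E \<equiv> stack (points p q) (index_matching p q x) (index_matching p q y)"
  shows "iota (sym_group p) (gram_entry p) x y = (if straight p E then Polynomial.monom 1 (card (loops E)) else 0)"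
proof -
  let ?S = "points p q" and ?U = "upward_matchings (tops p) (Bot ` {1..q})"
  have val: "index_matching p q (edges ?S u, t) = relabel_matching t u" if "u \<in> ?U" for u t
    using partner_edges[of u ?S] upward_matchingsD(1)[OF that] by (simp add: index_matching_def points_eq)
  obtain w s where x: "x = (edges ?S w, s)" "w \<in> ?U" "s permutes {1..p}"
    using assms(1) by (auto simp: upward_monotone_eq carrier_sym_group)
  obtain u t where y: "y = (edges ?S u, t)" "u \<in> ?U" "t permutes {1..p}"
    using assms(2) by (auto simp: upward_monotone_eq carrier_sym_group)
  have m: "u \<in> matchings ?S" "w \<in> matchings ?S" using x y upward_matchingsD(1) by (auto simp: points_eq)
  have E: "E = stack ?S (relabel_matching s w) (relabel_matching t u)" unfolding E_def x(1) y(1) val[OF x(2)] val[OF y(2)] ..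
  have st: "s \<circ> inv_into UNIV t permutes {1..p}" by (rule permutes_compose[OF permutes_inv[OF y(3)] x(3)])
  show ?thesis
    unfolding E straight_relabel[OF y(3) x(3)]
    by (simp add: x(1) y(1) iota_def left_regular_eq[OF x(3) y(3)] gram_entry_edges[OF m st])
qed

section \<open>Roots of the determinant\<close>

definition int_eval :: "complex \<Rightarrow> int poly \<Rightarrow> complex" where
  "int_eval z f = poly (map_poly of_int f) z"

lemma int_eval_hom: "comm_ring_hom (int_eval z)"
proof
  show "int_eval z 0 = 0" by (simp add: int_eval_def)
  show "int_eval z 1 = 1" by (simp add: int_eval_def)
  show "int_eval z (f + g) = int_eval z f + int_eval z g" for f g
  proof -
    have "map_poly of_int (f + g) = map_poly of_int f + (map_poly of_int g :: complex poly)"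
      by (rule poly_eqI) (simp add: coeff_map_poly)
    then show ?thesis by (simp add: int_eval_def)
  qed
  show "int_eval z (f * g) = int_eval z f * int_eval z g" for f g
  proof -
    have "map_poly of_int (f * g) = map_poly of_int f * (map_poly of_int g :: complex poly)"
      by (rule poly_eqI) (simp add: coeff_map_poly coeff_mult)
    then show ?thesis by (simp add: int_eval_def)
  qed
qed

lemma int_eval_monom: "int_eval z (Polynomial.monom 1 n) = z ^ n"
proof -
  have "map_poly of_int (Polynomial.monom 1 n) = (Polynomial.monom 1 n :: complex poly)"
    by (rule poly_eqI) (simp add: coeff_map_poly)
  then show ?thesis by (simp add: int_eval_def poly_monom)
qed

lemma finite_gram_index: "finite (gram_index p q)"
proof -
  have "finite (upward_monotone p q)" unfolding upward_monotone_eq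
    by (intro finite_imageI finite_subset[OF Collect_restrict finite_upward_matchings]) auto
  then show ?thesis by (simp add: sym_group_def finite_permutations)
qed

lemma f_poly_root_iff_singular: "int_eval z (f_poly p q) = 0 \<longleftrightarrow> singular z p {1..q}"
proof -
  interpret h: comm_ring_hom "int_eval z" by (rule int_eval_hom)
  let ?I = "gram_index p q" and ?U = "upward_matchings (tops p) (Bot ` {1..q})"
  let ?n = "card ?I" and ?e = "from_nat_into ?I" and ?M = "iota (sym_group p) (gram_entry p)"
  define g where "g i = index_matching p q (?e i)" for i
  have e: "bij_betw ?e {..<?n} ?I" by (rule bij_betw_from_nat_into_finite[OF finite_gram_index])
  have eI: "?e i \<in> ?I" if "i < ?n" for i using e that by (auto simp: bij_betw_def)
  have g: "bij_betw g {..<?n} ?U"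
    using bij_betw_trans[OF e index_matching_bij] by (simp add: g_def[abs_def] comp_def)
  have entry: "int_eval z (?M (?e i) (?e j)) = gram z p {1..q} (g i) (g j)" if "i < ?n" "j < ?n" for i j
    using iota_gram_entry[OF eI[OF that(1)] eI[OF that(2)]]
    by (simp add: gram_def g_def points_eq int_eval_monom)
  define A where "A = mat ?n ?n (\<lambda>(i, j). gram z p {1..q} (g i) (g j))"
  have A: "A \<in> carrier_mat ?n ?n" by (simp add: A_def)
  have "map_mat (int_eval z) (mat ?n ?n (\<lambda>(i, j). ?M (?e i) (?e j))) = A"
    unfolding A_def by (rule eq_matI) (auto simp: entry)
  then have "int_eval z (f_poly p q) = det A"
    unfolding f_poly_def det_on_def using h.hom_det by metis
  then have "int_eval z (f_poly p q) = 0 \<longleftrightarrow> (\<exists>v. v \<in> carrier_vec ?n \<and> v \<noteq> 0\<^sub>v ?n \<and> A *\<^sub>v v = 0\<^sub>v ?n)"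
    using det_0_iff_vec_prod_zero[OF A] by simp
  also have "\<dots> \<longleftrightarrow> singular z p {1..q}"
  proof
    assume "\<exists>v. v \<in> carrier_vec ?n \<and> v \<noteq> 0\<^sub>v ?n \<and> A *\<^sub>v v = 0\<^sub>v ?n"
    then obtain x where x: "x \<in> carrier_vec ?n" "x \<noteq> 0\<^sub>v ?n" "A *\<^sub>v x = 0\<^sub>v ?n" by auto
    define v where "v u = x $ inv_into {..<?n} g u" for u
    have vg: "v (g i) = x $ i" if "i < ?n" for i
      using g that by (simp add: v_def bij_betw_def)
    obtain i where i: "i < ?n" "x $ i \<noteq> 0" using x(1,2) by (auto simp: vec_eq_iff)
    then have "g i \<in> ?U" "v (g i) \<noteq> 0" using g vg by (auto simp: bij_betw_def)
    moreover have "(\<Sum>u\<in>?U. gram z p {1..q} w u * v u) = 0" if "w \<in> ?U" for w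
    proof -
      obtain k where k: "k < ?n" "w = g k" using g \<open>w \<in> ?U\<close> by (auto simp: bij_betw_def)
      have "(\<Sum>u\<in>?U. gram z p {1..q} w u * v u) = (\<Sum>j<?n. gram z p {1..q} w (g j) * v (g j))"
        using sum.reindex_bij_betw[OF g, of "\<lambda>u. gram z p {1..q} w u * v u"] by simp
      also have "\<dots> = (A *\<^sub>v x) $ k"
        using k x(1) vg by (simp add: A_def scalar_prod_def atLeast0LessThan)
      finally show ?thesis using x(3) k by simp
    qed
    ultimately show "singular z p {1..q}" by (auto simp: singular_def)
  next
    assume "singular z p {1..q}"
    then obtain v u0 where v: "u0 \<in> ?U" "v u0 \<noteq> 0" "\<And>w. w \<in> ?U \<Longrightarrow> (\<Sum>u\<in>?U. gram z p {1..q} w u * v u) = 0"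
      by (auto simp: singular_def)
    define x where "x = vec ?n (\<lambda>i. v (g i))"
    have "A *\<^sub>v x = 0\<^sub>v ?n"
    proof (rule eq_vecI)
      fix k assume "k < dim_vec (0\<^sub>v ?n :: complex vec)"
      then have k: "k < ?n" by simp
      have "(A *\<^sub>v x) $ k = (\<Sum>j<?n. gram z p {1..q} (g k) (g j) * v (g j))"
        using k by (simp add: A_def x_def scalar_prod_def atLeast0LessThan)
      also have "\<dots> = (\<Sum>u\<in>?U. gram z p {1..q} (g k) u * v u)"
        using sum.reindex_bij_betw[OF g, of "\<lambda>u. gram z p {1..q} (g k) u * v u"] by simp
      also have "\<dots> = 0" using v(3) g k by (auto simp: bij_betw_def)
      finally show "(A *\<^sub>v x) $ k = 0\<^sub>v ?n $ k" using k by simp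
    qed (simp add: A_def)
    moreover obtain i where "i < ?n" "u0 = g i" using g v(1) by (auto simp: bij_betw_def)
    then have "x $ i \<noteq> 0\<^sub>v ?n $ i" using v(2) by (simp add: x_def)
    then have "x \<noteq> 0\<^sub>v ?n" by auto
    moreover have "x \<in> carrier_vec ?n" by (simp add: x_def)
    ultimately show "\<exists>v. v \<in> carrier_vec ?n \<and> v \<noteq> 0\<^sub>v ?n \<and> A *\<^sub>v v = 0\<^sub>v ?n" by blast
  qed
  finally show ?thesis .
qed

text \<open>The coefficient at the largest conceivable degree is multiplicative even if some factors
  have smaller degree.\<close>

lemma coeff_prod_top:
  fixes f :: "'i \<Rightarrow> 'a :: comm_ring_1 poly"
  assumes "finite I" "\<And>i. i \<in> I \<Longrightarrow> Polynomial.degree (f i) \<le> k"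
  shows "Polynomial.degree (\<Prod>i\<in>I. f i) \<le> card I * k \<and> Polynomial.coeff (\<Prod>i\<in>I. f i) (card I * k) = (\<Prod>i\<in>I. Polynomial.coeff (f i) k)"
  using assms
proof (induction I rule: finite_induct)
  case (insert x F)
  have IH: "Polynomial.degree (\<Prod>i\<in>F. f i) \<le> card F * k" "Polynomial.coeff (\<Prod>i\<in>F. f i) (card F * k) = (\<Prod>i\<in>F. Polynomial.coeff (f i) k)"
    using insert by auto
  have d: "Polynomial.degree (f x) \<le> k" using insert by auto
  have "Polynomial.degree (f x * (\<Prod>i\<in>F. f i)) \<le> k + card F * k"
    using degree_mult_le[of "f x" "\<Prod>i\<in>F. f i"] IH(1) d by linarith
  moreover have "Polynomial.coeff (f x * (\<Prod>i\<in>F. f i)) (k + card F * k) =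
      Polynomial.coeff (f x) k * Polynomial.coeff (\<Prod>i\<in>F. f i) (card F * k)"
  proof -
    have "Polynomial.coeff (f x * (\<Prod>i\<in>F. f i)) (k + card F * k) =
        (\<Sum>i\<le>k + card F * k. Polynomial.coeff (f x) i * Polynomial.coeff (\<Prod>i\<in>F. f i) (k + card F * k - i))"
      by (rule coeff_mult)
    also have "\<dots> = (\<Sum>i\<in>{k}. Polynomial.coeff (f x) i * Polynomial.coeff (\<Prod>i\<in>F. f i) (k + card F * k - i))"
    proof (rule sum.mono_neutral_right)
      show "\<forall>i\<in>{..k + card F * k} - {k}. Polynomial.coeff (f x) i * Polynomial.coeff (\<Prod>i\<in>F. f i) (k + card F * k - i) = 0"
      proof
        fix i assume "i \<in> {..k + card F * k} - {k}"
        then consider "i > k" | "k + card F * k - i > card F * k" by fastforce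
        then show "Polynomial.coeff (f x) i * Polynomial.coeff (\<Prod>i\<in>F. f i) (k + card F * k - i) = 0"
        proof cases
          case 1
          then have "Polynomial.coeff (f x) i = 0" using d by (intro coeff_eq_0) simp
          then show ?thesis by simp
        next
          case 2
          then have "Polynomial.coeff (\<Prod>i\<in>F. f i) (k + card F * k - i) = 0" using IH(1) by (intro coeff_eq_0) simp
          then show ?thesis by simp
        qed
      qed
    qed auto
    finally show ?thesis by simp
  qed
  ultimately show ?case using insert.hyps IH(2) by (simp add: add_ac)
qed simp

text \<open>In the Leibniz expansion only the identity permutation contributes at degree
  \<open>n * k\<close>.\<close>

lemma coeff_det_top:
  fixes A :: "'a :: comm_ring_1 poly mat"
  assumes A: "A \<in> carrier_mat n n" and deg: "\<And>i j. i < n \<Longrightarrow> j < n \<Longrightarrow> Polynomial.degree (A $$ (i, j)) \<le> k"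
    and top: "\<And>i j. i < n \<Longrightarrow> j < n \<Longrightarrow> Polynomial.coeff (A $$ (i, j)) k = (if i = j then 1 else 0)"
  shows "Polynomial.degree (det A) \<le> n * k" "Polynomial.coeff (det A) (n * k) = 1"
proof -
  let ?P = "{p. p permutes {0..<n}}" and ?f = "\<lambda>p. \<Prod>i = 0..<n. A $$ (i, p i)"
  have p_less: "p i < n" if "p \<in> ?P" "i < n" for p i using permutes_in_image[of p "{0..<n}" i] that by auto
  have prod: "Polynomial.degree (?f p) \<le> n * k \<and> Polynomial.coeff (?f p) (n * k) = (\<Prod>i = 0..<n. Polynomial.coeff (A $$ (i, p i)) k)"
    if "p \<in> ?P" for p
    using coeff_prod_top[of "{0..<n}" "\<lambda>i. A $$ (i, p i)" k] deg p_less[OF that] by simp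
  have signof: "signof p = (1 :: 'a poly) \<or> signof p = (-1 :: 'a poly)" for p by (auto simp: sign_def)
  have det: "det A = (\<Sum>p\<in>?P. signof p * ?f p)" by (rule det_def'[OF A])
  have "Polynomial.degree (signof p * ?f p) \<le> n * k" if "p \<in> ?P" for p
    using signof[of p] prod[OF that] by auto
  then show "Polynomial.degree (det A) \<le> n * k"
    unfolding det by (intro degree_sum_le) (auto simp: finite_permutations)
  have "Polynomial.coeff (signof p * ?f p) (n * k) = (if p = id then 1 else 0)" if p: "p \<in> ?P" for p
  proof (cases "p = id")
    case True
    then show ?thesis using prod[OF p] top by (simp add: sign_id)
  next
    case False
    then obtain i where "p i \<noteq> i" by (auto simp: fun_eq_iff)
    moreover from this have "i < n" using p by (metis (mono_tags) atLeastLessThan_iff mem_Collect_eq permutes_not_in zero_le)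
    ultimately have "(\<Prod>i = 0..<n. Polynomial.coeff (A $$ (i, p i)) k) = 0"
      using top[of i "p i"] p_less[OF p] by (intro prod_zero bexI[of _ i]) auto
    then show ?thesis using prod[OF p] signof[of p] False by auto
  qed
  then have "Polynomial.coeff (det A) (n * k) = (\<Sum>p\<in>?P. if p = id then 1 else 0)"
    unfolding det coeff_sum by (intro sum.cong) auto
  also have "\<dots> = 1" by (simp add: finite_permutations permutes_id)
  finally show "Polynomial.coeff (det A) (n * k) = 1" .
qed

text \<open>\<open>k\<close> is the number of cups, and \<open>straight_loops\<close> says that
  exactly the diagonal entries reach degree \<open>k\<close>.\<close>

lemma f_poly_monic:
  assumes "p \<preceq> q"
  shows "Polynomial.lead_coeff (f_poly p q) = 1"
proof -
  let ?I = "gram_index p q" and ?U = "upward_matchings (tops p) (Bot ` {1..q})"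
  let ?n = "card ?I" and ?e = "from_nat_into ?I" and ?M = "iota (sym_group p) (gram_entry p)"
  define k where "k = (q - p) div 2"
  have k: "q = p + 2 * k" using assms by (auto simp: preceq_def k_def)
  have e: "bij_betw ?e {..<?n} ?I" by (rule bij_betw_from_nat_into_finite[OF finite_gram_index])
  have eI: "?e i \<in> ?I" if "i < ?n" for i using e that by (auto simp: bij_betw_def)
  have upI: "index_matching p q x \<in> ?U" if "x \<in> ?I" for x using index_matching_bij that by (auto simp: bij_betw_def)
  have einj: "index_matching p q (?e i) = index_matching p q (?e j) \<longleftrightarrow> i = j" if "i < ?n" "j < ?n" for i j
    using bij_betw_trans[OF e index_matching_bij] that by (auto simp: bij_betw_def inj_on_def)
  have ent: "Polynomial.degree (?M (?e i) (?e j)) \<le> k \<and> Polynomial.coeff (?M (?e i) (?e j)) k = (if i = j then 1 else 0)"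
    if ij: "i < ?n" "j < ?n" for i j
  proof -
    let ?w = "index_matching p q (?e i)" and ?u = "index_matching p q (?e j)"
    let ?E = "stack (points p q) ?w ?u"
    have M: "?M (?e i) (?e j) = (if straight p ?E then Polynomial.monom 1 (card (loops ?E)) else 0)"
      by (rule iota_gram_entry[OF eI[OF ij(1)] eI[OF ij(2)]])
    have "card {1..q} = p + 2 * k" using k by simp
    note sl = straight_loops[OF upI[OF eI[OF ij(2)]] upI[OF eI[OF ij(1)]] _ this, folded points_eq]
    show ?thesis
    proof (cases "straight p ?E")
      case True
      then have "card (loops ?E) \<le> k" "card (loops ?E) = k \<longleftrightarrow> i = j"
        using sl einj[OF ij] by auto
      then show ?thesis using M True by (simp add: degree_monom_eq)
    next
      case False
      then have "i \<noteq> j" using sl(2) by auto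
      then show ?thesis using M False by simp
    qed
  qed
  let ?A = "mat ?n ?n (\<lambda>(i, j). ?M (?e i) (?e j))"
  have A: "?A \<in> carrier_mat ?n ?n" by simp
  have "f_poly p q = det ?A" by (simp add: f_poly_def det_on_def)
  moreover have "Polynomial.degree (det ?A) \<le> ?n * k" "Polynomial.coeff (det ?A) (?n * k) = 1"
    using coeff_det_top[OF A, of k] ent by auto
  ultimately have "Polynomial.degree (f_poly p q) = ?n * k" "Polynomial.coeff (f_poly p q) (?n * k) = 1"
    using le_degree[of "det ?A" "?n * k"] by auto
  then show ?thesis by simp
qed

lemma parity_card:
  assumes "q = p + 2 * k" "q \<preceq> r" "q' = p + 2 * l" "l \<le> k"
  shows "q' \<le> r" "even (r - q')"
  using assms by (auto simp: preceq_def)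

theorem f_poly_roots:
  "(\<exists>p q. p \<preceq> q \<and> q \<preceq> r \<and> int_eval z (f_poly p q) = 0) \<longleftrightarrow> (\<exists>m\<in>X r. z = of_int m)"
proof
  assume "\<exists>p q. p \<preceq> q \<and> q \<preceq> r \<and> int_eval z (f_poly p q) = 0"
  then obtain p q where pq: "p \<preceq> q" "q \<preceq> r" "singular z p {1..q}" using f_poly_root_iff_singular by auto
  define k where "k = (q - p) div 2"
  have k: "q = p + 2 * k" using pq(1) by (auto simp: preceq_def k_def)
  then have "card {1..q} = p + 2 * k" by simp
  from harmonic_if_singular[OF pq(3) _ this] obtain Q l where Q: "Q \<subseteq> {1..q}" "card Q = p + 2 * Suc l" "Suc l \<le> k"
    "has_harmonic z (tops p) (Bot ` Q)" by auto
  have fin: "finite Q" using Q(1) finite_subset by blast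
  obtain T B :: "point set" where TB: "has_harmonic z T B" "finite T" "finite B" "T \<inter> B = {}" "card B = card T + 2"
    "card B = card Q - l"
    using has_harmonic_one_cup[OF Q(4) _ _ disjoint_tops, of l] Q(2) fin by auto
  obtain m where m: "m \<in> one_cup_values (card B)" "z = of_int m" using has_harmonic_one_cup_value[OF TB(1-5)] by auto
  have r: "card Q \<le> r" "even (r - card Q)" using parity_card[OF k pq(2) Q(2,3)] by auto
  \<comment> \<open>Each bend lowers the number of bottom points by one, so \<open>card B\<close>
    need not have the parity of \<open>r\<close>.\<close>
  have n: "card B = p + 2 + l" using TB(6) Q(2) by simp
  have "m \<in> X r"
  proof (cases "m = 0")
    case False
    then show ?thesis using m(1) r(1) n Q(2) by (fastforce simp: one_cup_values_def X_def)
  next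
    case True
    have "r \<notin> {0, 1, 3, 5}"
    proof
      assume "r \<in> {0, 1, 3, 5}"
      moreover have "card B \<noteq> 3" "card B \<noteq> 5" using m(1) True by (auto simp: one_cup_values_def)
      \<comment> \<open>For \<open>r \<le> 1\<close> there is no cup. For \<open>r = 3\<close> and
        \<open>r = 5\<close> all pairs \<open>(p, l)\<close> except (1, 1) give 3 or 5 bottom
        points, sizes at which \<open>one_cup_values\<close> excludes 0.\<close>
      ultimately have "r = 5" "p = 1" "l = 1" using r n Q(2) by (auto; presburger)+
      then show False
        using no_harmonic_one_five[of "tops p" "Bot ` Q"] Q(2,4) fin disjoint_tops[of p Q] m(2) True by auto
    qed
    then show ?thesis using True by (simp add: X_def X0_def)
  qed
  then show "\<exists>m\<in>X r. z = of_int m" using m(2) by blast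
next
  assume "\<exists>m\<in>X r. z = of_int m"
  then obtain m where m: "m \<in> X r" "z = of_int m" by auto
  have harm: "\<exists>p q. p \<preceq> q \<and> q \<preceq> r \<and> int_eval z (f_poly p q) = 0"
    if "has_harmonic z (tops p) (Bot ` {1..q})" "p < q" "even (q - p)" "q \<le> r" "even (r - q)" for p q
    using singular_if_harmonic[OF that(1)] that f_poly_root_iff_singular by (intro exI[of _ p] exI[of _ q]) (auto simp: preceq_def)
  note tb = finite_tops finite_imageI[OF finite_atLeastAtMost] disjoint_tops
  \<comment> \<open>The \<open>2 * a + 2\<close> points may be divided freely as long as the bottoms
    prevail; the bottom sizes \<open>a + 2\<close> and \<open>a + 3\<close> serve the two parities
    of \<open>r\<close>.\<close>
  have even_case: "\<exists>p q. p \<preceq> q \<and> q \<preceq> r \<and> int_eval z (f_poly p q) = 0" if a: "m = - 2 * int a" "1 \<le> a" "a + 2 \<le> r" for a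
  proof (cases "even (r - (a + 2))")
    case True
    have "has_harmonic z (tops a) (Bot ` {1..a + 2})"
      using has_harmonic_even[OF tb, of a 1 "a + 2" a] m(2) a(1) by simp
    then show ?thesis using harm True a by simp
  next
    case False
    have "has_harmonic z (tops (a - 1)) (Bot ` {1..a + 3})"
      using has_harmonic_even[OF tb, of "a - 1" 1 "a + 3" a] m(2) a(1,2) by simp
    moreover have "a + 3 \<le> r" "even (r - (a + 3))" "even (a + 3 - (a - 1))" using False a by presburger+
    ultimately show ?thesis using harm[of "a - 1" "a + 3"] a by simp
  qed
  consider "m = 0" "r \<notin> {0, 1, 3, 5}" | "1 \<le> m" "m \<le> int r - 2" | i where "1 \<le> i" "i \<le> int r - 2" "m = - 2 * i"
    | "4 - int r \<le> m" "m \<le> - 1"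
    using m(1) by (auto simp: X_def X0_def split: if_splits)
  then show "\<exists>p q. p \<preceq> q \<and> q \<preceq> r \<and> int_eval z (f_poly p q) = 0"
  proof cases
    case 1
    show ?thesis
    proof (cases "even r")
      case True
      have "has_harmonic z (tops 0) (Bot ` {1..2})" using has_harmonic_even[OF tb, of 0 1 2 0] m(2) 1 by simp
      moreover have "2 \<le> r" "even (r - 2)" using 1(2) True by (auto; presburger)+
      ultimately show ?thesis using harm[of 0 2] by simp
    next
      case False
      \<comment> \<open>Seven is the least odd number of bottoms at which 0 occurs; for odd
        \<open>r \<le> 5\<close> it is excluded by the other direction.\<close>
      have "has_harmonic z (tops 5) (Bot ` {1..7})" using has_harmonic_zero_seven[OF tb, of 5 1 7] m(2) 1 by simp
      moreover have "7 \<le> r" "even (r - 7)" using 1(2) False by (auto; presburger)+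
      ultimately show ?thesis using harm[of 5 7] by simp
    qed
  next
    case 2
    define a where "a = nat m"
    have a: "m = int a" "1 \<le> a" "a + 2 \<le> r" using 2 by (auto simp: a_def)
    show ?thesis
    proof (cases "even (r - (a + 2))")
      case True
      have "has_harmonic z (tops a) (Bot ` {1..a + 2})"
        using has_harmonic_positive[OF tb, of a a 1 "a + 2"] m(2) a(1) by simp
      then show ?thesis using harm True a by simp
    next
      case False
      have "has_harmonic z (tops (a - 1)) (Bot ` {1..a + 3})"
        using has_harmonic_positive[OF tb, of "a - 1" a 1 "a + 3"] m(2) a(1,2) by simp
      moreover have "a + 3 \<le> r" "even (r - (a + 3))" "even (a + 3 - (a - 1))" using False a by presburger+
      ultimately show ?thesis using harm[of "a - 1" "a + 3"] a by simp
    qed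
  next
    case (3 i)
    then show ?thesis using even_case[of "nat i"] by auto
  next
    case 4
    show ?thesis
    proof (cases "even m")
      case True
      then show ?thesis using even_case[of "nat (- m) div 2"] 4 by (auto elim!: evenE)
    next
      case False
      then obtain c where c: "m = 2 * c + 1" by (auto elim: oddE)
      \<comment> \<open>\<open>s\<close> solves \<open>3 - 2 * s = m\<close>. Of the
        \<open>4 * s\<close> points, \<open>2 * s + 1\<close> become bottoms for odd
        \<open>r\<close> and \<open>2 * s + 2\<close> for even \<open>r\<close>; both fit because
        \<open>4 - r \<le> m\<close>.\<close>
      define s where "s = nat (1 - c)"
      have "int s = 1 - c" using c 4 by (simp add: s_def)
      then have s: "m = 3 - 2 * int s" "2 \<le> s" "2 * s + 1 \<le> r" using c 4 by linarith+
      show ?thesis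
      proof (cases "even r")
        case True
        have "has_harmonic z (tops (2 * s - 2)) (Bot ` {1..2 * s + 2})"
          using has_harmonic_odd[OF tb, of "2 * s - 2" s 1 "2 * s + 2"] m(2) s(1,2) by simp
        moreover have "2 * s + 2 \<le> r" "even (r - (2 * s + 2))" "even (2 * s + 2 - (2 * s - 2))" using True s by presburger+
        ultimately show ?thesis using harm[of "2 * s - 2" "2 * s + 2"] s by simp
      next
        case False
        have "has_harmonic z (tops (2 * s - 1)) (Bot ` {1..2 * s + 1})"
          using has_harmonic_odd[OF tb, of "2 * s - 1" s 1 "2 * s + 1"] m(2) s(1,2) by simp
        moreover have "even (r - (2 * s + 1))" "even (2 * s + 1 - (2 * s - 1))" using False s by presburger+
        ultimately show ?thesis using harm[of "2 * s - 1" "2 * s + 1"] s by simp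
      qed
    qed
  qed
qed

lemma int_eval_of_int: "int_eval (of_int a) f = of_int (poly f a)"
proof (induction f)
  case (pCons c f)
  interpret h: comm_ring_hom "int_eval (of_int a)" by (rule int_eval_hom)
  have "int_eval (of_int a) (pCons c f) = of_int c + of_int a * int_eval (of_int a) f"
    by (simp add: int_eval_def map_poly_pCons)
  then show ?case using pCons by simp
qed (simp add: int_eval_def)

lemma int_eval_linear: "int_eval z [:- a, 1:] = z - of_int a"
  by (simp add: int_eval_def map_poly_pCons)

text \<open>A complex root that is an integer is a root over the integers and can be divided off
  there; being monic passes to the cofactor.\<close>

lemma monic_split:
  assumes "Polynomial.lead_coeff f = 1" "\<And>z. int_eval z f = 0 \<Longrightarrow> \<exists>m :: int. z = of_int m"
  shows "\<exists>as. f = (\<Prod>a\<leftarrow>as. [:- a, 1:]) \<and> (\<forall>z. int_eval z f = 0 \<longleftrightarrow> z \<in> of_int ` set as)"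
  using assms
proof (induction "Polynomial.degree f" arbitrary: f)
  case 0
  then obtain c where "f = [:c:]" by (metis degree_eq_zeroE)
  then have "f = 1" using 0 by (simp add: one_pCons)
  then show ?case by (intro exI[of _ "[]"]) (simp add: int_eval_def)
next
  case (Suc n)
  let ?F = "map_poly of_int f :: complex poly"
  have "Polynomial.degree ?F = Suc n" using Suc.hyps(2) by (simp add: degree_map_poly)
  then obtain z where z: "poly ?F z = 0" using fundamental_theorem_of_algebra[of ?F] constant_degree[of ?F] by auto
  then obtain a where a: "z = of_int a" using Suc.prems(2)[of z] by (auto simp: int_eval_def)
  then have "poly f a = 0" using z int_eval_of_int[of a f] by (simp add: int_eval_def)
  then obtain g where g: "f = [:- a, 1:] * g" by (auto simp: poly_eq_0_iff_dvd)
  have "f \<noteq> 0" using Suc.prems(1) by auto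
  then have g0: "g \<noteq> 0" using g by auto
  have lc: "Polynomial.lead_coeff g = 1" using Suc.prems(1) unfolding g by (simp only: lead_coeff_mult) simp
  have deg: "n = Polynomial.degree g" using Suc.hyps(2) g0 unfolding g by (subst (asm) degree_mult_eq) auto
  have ev: "int_eval y f = (y - of_int a) * int_eval y g" for y
  proof -
    interpret h: comm_ring_hom "int_eval y" by (rule int_eval_hom)
    show ?thesis unfolding g h.hom_mult int_eval_linear ..
  qed
  have "\<exists>as. g = (\<Prod>a\<leftarrow>as. [:- a, 1:]) \<and> (\<forall>z. int_eval z g = 0 \<longleftrightarrow> z \<in> of_int ` set as)"
    using Suc.hyps(1)[OF deg lc] Suc.prems(2) ev by auto
  then obtain as where as: "g = (\<Prod>a\<leftarrow>as. [:- a, 1:])" "\<forall>z. int_eval z g = 0 \<longleftrightarrow> z \<in> of_int ` set as" by auto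
  show ?case
  proof (intro exI[of _ "a # as"] conjI allI)
    show "f = (\<Prod>a\<leftarrow>a # as. [:- a, 1:])" using g as(1) by simp
    show "int_eval z f = 0 \<longleftrightarrow> z \<in> of_int ` set (a # as)" for z using ev[of z] as(2) by auto
  qed
qed

section \<open>Evaluation in a commutative ring\<close>

context cring
begin

lemma of_int_ring_closed [simp]: "of_int_ring R m \<in> carrier R"
  by (simp add: of_int_ring_def)

lemma of_int_ring_add: "of_int_ring R (x + y) = of_int_ring R x \<oplus> of_int_ring R y"
  by (simp add: of_int_ring_def add.int_pow_mult)

lemma of_int_ring_mult: "of_int_ring R (x * y) = of_int_ring R x \<otimes> of_int_ring R y"
proof -
  have "of_int_ring R x \<otimes> of_int_ring R y = [x] \<cdot> ([y] \<cdot> \<one>)"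
    by (simp add: of_int_ring_def add_pow_ldistr_int)
  then show ?thesis by (simp add: of_int_ring_def add.int_pow_pow mult.commute)
qed

lemma of_int_ring_0: "of_int_ring R 0 = \<zero>"
  by (simp add: of_int_ring_def add_pow_int_ge)

lemma of_int_ring_1: "of_int_ring R 1 = \<one>"
  by (simp add: of_int_ring_def)

lemma of_int_ring_minus: "of_int_ring R (- x) = \<ominus> of_int_ring R x"
  by (simp add: of_int_ring_def add.int_pow_neg)

lemma eval_int_poly_bound:
  assumes "\<delta> \<in> carrier R" "Polynomial.degree f \<le> n"
  shows "eval_int_poly R f \<delta> = (\<Oplus>i\<in>{..n}. of_int_ring R (Polynomial.coeff f i) \<otimes> \<delta> [^] i)"
  unfolding eval_int_poly_def
  by (rule add.finprod_mono_neutral_cong_left) (use assms in \<open>auto simp: coeff_eq_0 of_int_ring_0\<close>)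

lemma eval_int_poly_closed [simp]: "\<delta> \<in> carrier R \<Longrightarrow> eval_int_poly R f \<delta> \<in> carrier R"
  unfolding eval_int_poly_def by (rule finsum_closed) auto

text \<open>Shifting the coefficients by one place corresponds to a factor \<open>\<delta>\<close>.
  Together with \<open>monic_split\<close>, this case of multiplicativity turns the evaluated
  \<open>f_poly\<close> into a product.\<close>

lemma eval_int_poly_linear_mult:
  assumes d: "\<delta> \<in> carrier R"
  shows "eval_int_poly R ([:- a, 1:] * g) \<delta> = (\<delta> \<ominus> of_int_ring R a) \<otimes> eval_int_poly R g \<delta>"
proof -
  let ?n = "Polynomial.degree g" and ?o = "of_int_ring R"
  let ?c = "Polynomial.coeff g"
  have f: "[:- a, 1:] * g = pCons 0 g + Polynomial.smult (- a) g" by simp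
  have deg: "Polynomial.degree ([:- a, 1:] * g) \<le> Suc ?n" using degree_mult_le[of "[:- a, 1:]" g] by simp
  have "eval_int_poly R ([:- a, 1:] * g) \<delta> =
      (\<Oplus>i\<in>{..Suc ?n}. ?o (Polynomial.coeff (pCons 0 g) i) \<otimes> \<delta> [^] i \<oplus> ?o (- a) \<otimes> (?o (?c i) \<otimes> \<delta> [^] i))"
    unfolding eval_int_poly_bound[OF d deg]
  proof (rule finsum_cong')
    fix i
    have cf: "Polynomial.coeff ([:- a, 1:] * g) i = Polynomial.coeff (pCons 0 g) i + (- a) * ?c i" by (simp add: f)
    show "?o (Polynomial.coeff ([:- a, 1:] * g) i) \<otimes> \<delta> [^] i =
        ?o (Polynomial.coeff (pCons 0 g) i) \<otimes> \<delta> [^] i \<oplus> ?o (- a) \<otimes> (?o (?c i) \<otimes> \<delta> [^] i)"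
      unfolding cf of_int_ring_add of_int_ring_mult using d by (simp add: l_distr m_assoc)
  qed (use d in auto)
  also have "\<dots> = (\<Oplus>i\<in>{..Suc ?n}. ?o (Polynomial.coeff (pCons 0 g) i) \<otimes> \<delta> [^] i) \<oplus>
      (\<Oplus>i\<in>{..Suc ?n}. ?o (- a) \<otimes> (?o (?c i) \<otimes> \<delta> [^] i))"
    by (rule finsum_addf) (use d in auto)
  also have "(\<Oplus>i\<in>{..Suc ?n}. ?o (- a) \<otimes> (?o (?c i) \<otimes> \<delta> [^] i)) = ?o (- a) \<otimes> eval_int_poly R g \<delta>"
    unfolding eval_int_poly_bound[OF d le_SucI[OF order_refl], of g]
    by (rule finsum_rdistr[symmetric]) (use d in auto)
  also have "(\<Oplus>i\<in>{..Suc ?n}. ?o (Polynomial.coeff (pCons 0 g) i) \<otimes> \<delta> [^] i) =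
      (\<Oplus>i\<in>{..?n}. ?o (?c i) \<otimes> \<delta> [^] Suc i)"
    by (subst finsum_Suc2) (use d in \<open>auto simp: of_int_ring_0\<close>)
  also have "\<dots> = (\<Oplus>i\<in>{..?n}. \<delta> \<otimes> (?o (?c i) \<otimes> \<delta> [^] i))"
    by (rule finsum_cong') (use d in \<open>auto simp: m_comm m_lcomm\<close>)
  also have "\<dots> = \<delta> \<otimes> eval_int_poly R g \<delta>"
    unfolding eval_int_poly_def by (rule finsum_rdistr[symmetric]) (use d in auto)
  finally show ?thesis using d by (simp add: of_int_ring_minus l_distr minus_eq)
qed

lemma eval_int_poly_1: "eval_int_poly R 1 \<delta> = \<one>"
  by (simp add: eval_int_poly_def of_int_ring_1)

lemma Units_mult_iff:
  assumes "x \<in> carrier R" "y \<in> carrier R"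
  shows "x \<otimes> y \<in> Units R \<longleftrightarrow> x \<in> Units R \<and> y \<in> Units R"
proof
  have factor: "a \<in> Units R" if "a \<in> carrier R" "b \<in> carrier R" "a \<otimes> b \<in> Units R" for a b
  proof -
    have "a \<otimes> (b \<otimes> inv (a \<otimes> b)) = \<one>" using that Units_r_inv[OF that(3)] by (simp add: m_assoc[symmetric])
    moreover from this have "b \<otimes> inv (a \<otimes> b) \<otimes> a = \<one>" using that m_comm[of "b \<otimes> inv (a \<otimes> b)" a] by simp
    ultimately have "\<exists>w\<in>carrier R. w \<otimes> a = \<one> \<and> a \<otimes> w = \<one>"
      using that by (intro bexI[of _ "b \<otimes> inv (a \<otimes> b)"]) auto
    then show ?thesis using that(1) by (simp add: Units_def)
  qed
  assume "x \<otimes> y \<in> Units R"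
  then show "x \<in> Units R \<and> y \<in> Units R" 
    using factor[OF assms] factor[OF assms(2,1)] m_comm[OF assms] by simp
qed auto

lemma eval_int_poly_split_unit:
  assumes "\<delta> \<in> carrier R"
  shows "eval_int_poly R (\<Prod>a\<leftarrow>as. [:- a, 1:]) \<delta> \<in> Units R \<longleftrightarrow> (\<forall>a\<in>set as. \<delta> \<ominus> of_int_ring R a \<in> Units R)"
proof (induction as)
  case (Cons a as)
  have "eval_int_poly R (\<Prod>a\<leftarrow>a # as. [:- a, 1:]) \<delta> = (\<delta> \<ominus> of_int_ring R a) \<otimes> eval_int_poly R (\<Prod>a\<leftarrow>as. [:- a, 1:]) \<delta>"
    using eval_int_poly_linear_mult[OF assms] by simp
  then show ?case using Cons Units_mult_iff assms by simp
qed (simp add: eval_int_poly_1)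

end

theorem proposition7p9:
  fixes k :: "('a, 'm) ring_scheme" and \<delta> :: 'a and r :: nat
  assumes "cring k" and "\<delta> \<in> carrier k"
  shows "nonsingular_upto k \<delta> r \<longleftrightarrow> (\<forall>m \<in> X r. \<delta> \<ominus>\<^bsub>k\<^esub> of_int_ring k m \<in> Units k)"
proof -
  interpret cring k by (rule assms(1))
  have at: "nonsingular_at k \<delta> p q \<longleftrightarrow> (\<forall>m. int_eval (of_int m) (f_poly p q) = 0 \<longrightarrow> \<delta> \<ominus>\<^bsub>k\<^esub> of_int_ring k m \<in> Units k)"
    if pq: "p \<preceq> q" "q \<preceq> r" for p q
  proof -
    \<comment> \<open>By \<open>f_poly_roots\<close> all complex roots lie in \<open>X r\<close>;
      their integrality is what permits the factorisation over the integers and hence in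
      \<open>k\<close>.\<close>
    obtain as where as: "f_poly p q = (\<Prod>a\<leftarrow>as. [:- a, 1:])" "\<forall>z. int_eval z (f_poly p q) = 0 \<longleftrightarrow> z \<in> of_int ` set as"
      using monic_split[OF f_poly_monic[OF pq(1)]] f_poly_roots[of r] pq by blast
    have "int_eval (of_int m) (f_poly p q) = 0 \<longleftrightarrow> m \<in> set as" for m using as(2) by auto
    then show ?thesis unfolding nonsingular_at_def as(1) using eval_int_poly_split_unit[OF assms(2)] by (simp add: as(1) Ball_def)
  qed
  have "m \<in> X r \<longleftrightarrow> (\<exists>p q. p \<preceq> q \<and> q \<preceq> r \<and> int_eval (of_int m) (f_poly p q) = 0)" for m
    unfolding f_poly_roots by auto
  then show ?thesis unfolding nonsingular_upto_def using at by blast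
qed

end
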